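(* Let $d\in\mathbb{N}$ and let $(\boldsymbol{X}_i)_{i\in\mathbb{N}}$ be a sequence of (possibly dependent) $\mathcal{S}_d$-valued random vectors such that each $\boldsymbol{X}_i$ has the same density $f$ (supported in $\mathcal{S}_d$). Let $b=b(n)\in(0,\infty)$ be a bandwidth with $b\to 0$ as $n\to\infty$, and let $\hat f_{n,b}$ be the Dirichlet kernel density estimator based on $\boldsymbol{X}_1,\ldots,\boldsymbol{X}_n$. Suppose that: (1) $f$ is twice continuously differentiable on $\mathcal{S}_d$; (2) for some $p\in(2,\infty)$, the functions $h_{i,j}=f_{\boldsymbol{X}_i,\boldsymbol{X}_j}-f_{\boldsymbol{X}_i}f_{\boldsymbol{X}_j}$, i.e. $h_{i,j}(\boldsymbol{x},\boldsymbol{x}')=f_{\boldsymbol{X}_i,\boldsymbol{X}_j}(\boldsymbol{x},\boldsymbol{x}')-f_{\boldsymbol{X}_i}(\boldsymbol{x})f_{\boldsymbol{X}_j}(\boldsymbol{x}')$, satisfy \[ \sup_{i\neq j}\left\{\int_{\mathcal{S}_d\times\mathcal{S}_d}|h_{i,j}(\boldsymbol{x},\boldsymbol{x}')|^p\,\mathrm{d}\boldsymbol{x}\,\mathrm{d}\boldsymbol{x}'\right\}^{1/p}<\infty; \] (3) for this $p$, the strong mixing coefficients of the sequence satisfy $\alpha(n)=\mathcal{O}(n^{-\nu})$ for some $\nu>2(p-1)/(p-2)$. Then, for any $\boldsymbol{s}\in\mathrm{Int}(\mathcal{S}_d)$, as $n\to\infty$, \[ \mathrm{MSE}[\hat f_{n,b}(\boldsymbol{s})]\equiv\mathsf{E}\big\{|\hat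 f_{n,b}(\boldsymbol{s})-f(\boldsymbol{s})|^2\big\} = b^2 g^2(\boldsymbol{s})+n^{-1}b^{-d/2}\psi(\boldsymbol{s})f(\boldsymbol{s})+\mathrm{o}(b^2)+\mathrm{o}_{\boldsymbol{s}}(n^{-1}b^{-d/2}), \] where \[ g(\boldsymbol{s})=\sum_{i=1}^d(1-(d+1)s_i)\frac{\partial}{\partial s_i}f(\boldsymbol{s})+\frac12\sum_{i,j=1}^d s_i(\mathbf{1}_{\{i=j\}}-s_j)\frac{\partial^2}{\partial s_i\partial s_j}f(\boldsymbol{s}), \] \[ \psi(\boldsymbol{s})=\frac{(4\pi)^{-d/2}}{(1-\|\boldsymbol{s}\|_1)^{1/2}\prod_{i=1}^d s_i^{1/2}}. \]
   Context: Simplex: $\mathcal{S}_d=\{\boldsymbol{s}\in[0,1]^d:\|\boldsymbol{s}\|_1\le 1\}$ and $\mathrm{Int}(\mathcal{S}_d)=\{\boldsymbol{s}\in(0,1)^d:\|\boldsymbol{s}\|_1<1\}$, where $\|\boldsymbol{s}\|_1=\sum_{i=1}^d|s_i|$. All densities are with respect to Lebesgue measure; $f_{\boldsymbol{X}_i}$ denotes the density of $\boldsymbol{X}_i$ (so $f_{\boldsymbol{X}_i}=f$) and $f_{\boldsymbol{X}_i,\boldsymbol{X}_j}$ the joint density of $(\boldsymbol{X}_i,\boldsymbol{X}_j)$. Dirichlet density: for $\boldsymbol{u}=(u_1,\ldots,u_d)\in(0,\infty)^d$, $v\in(0,\infty)$ and $\boldsymbol{s}\in\mathcal{S}_d$,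 \[ K_{\boldsymbol{u},v}(\boldsymbol{s})=\frac{\Gamma(\|\boldsymbol{u}\|_1+v)}{\Gamma(v)\prod_{i=1}^d\Gamma(u_i)}(1-\|\boldsymbol{s}\|_1)^{v-1}\prod_{i=1}^d s_i^{u_i-1}. \] Dirichlet kernel density estimator: for $\boldsymbol{s}\in\mathcal{S}_d$ and $b>0$, let $\kappa_{\boldsymbol{s},b}(\cdot)=K_{\boldsymbol{s}/b+\boldsymbol{1},\,(1-\|\boldsymbol{s}\|_1)/b+1}(\cdot)$ with $\boldsymbol{1}=(1,\ldots,1)\in\mathbb{R}^d$, and \[ \hat f_{n,b}(\boldsymbol{s})=\frac1n\sum_{i=1}^n\kappa_{\boldsymbol{s},b}(\boldsymbol{X}_i). \] Strong mixing coefficient: $\alpha(n)=\sup_{k\ge1}\sup_{A\in\mathcal{F}_1^k,\,B\in\mathcal{F}_{k+n}^\infty}|\mathbb{P}(A\cap B)-\mathbb{P}(A)\mathbb{P}(B)|$, where $\mathcal{F}_i^j$ is the $\sigma$-algebra generated by $(\boldsymbol{X}_i,\ldots,\boldsymbol{X}_j)$. Asymptotic notation: $u=\mathrm{o}(v)$ means $|u/v|\to0$ as $n\to\infty$. A subscript, as in $\mathrm{o}_{\boldsymbol{s}}$, indicates that the convergence rate may depend on the point $\boldsymbol{s}$; without a subscript the rate does not depend on $\boldsymbol{s}$ (it may depend on $f$ and $d$). *)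

theory Defs
  imports "HOL-Probability.Probability" "HOL-Library.Landau_Symbols"
begin

definition norm1 :: "real ^ 'd \<Rightarrow> real" where
  "norm1 s = (\<Sum>i\<in>UNIV. \<bar>s $ i\<bar>)"

definition simplex_set :: "(real ^ 'd) set" where
  "simplex_set = {s. (\<forall>i. s $ i \<in> {0..1}) \<and> norm1 s \<le> 1}"

definition open_simplex :: "(real ^ 'd) set" where
  "open_simplex = {s. (\<forall>i. s $ i \<in> {0<..<1}) \<and> norm1 s < 1}"

text \<open>
  Differentiability is relative to \<open>S\<close>, so that the notion makes sense on closed sets. The
  relative derivatives are unique when \<open>S\<close> is convex with nonempty interior, and \<open>f\<close> is
  unconstrained outside \<open>S\<close> (a density supported in \<open>S\<close> may jump to zero across the boundary).
\<close>
definition twice_cont_diff_on :: "(real ^ 'd \<Rightarrow> real) \<Rightarrow> (real ^ 'd) set \<Rightarrow> bool" where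
  "twice_cont_diff_on f S \<longleftrightarrow>
     (\<exists>(f' :: real ^ 'd \<Rightarrow> (real ^ 'd) \<Rightarrow>\<^sub>L real)
       (f'' :: real ^ 'd \<Rightarrow> (real ^ 'd) \<Rightarrow>\<^sub>L ((real ^ 'd) \<Rightarrow>\<^sub>L real)).
        (\<forall>x\<in>S. (f has_derivative blinfun_apply (f' x)) (at x within S)) \<and>
        (\<forall>x\<in>S. (f' has_derivative blinfun_apply (f'' x)) (at x within S)) \<and>
        continuous_on S f'')"

definition partial_deriv :: "'d \<Rightarrow> (real ^ 'd \<Rightarrow> real) \<Rightarrow> real ^ 'd \<Rightarrow> real" where
  "partial_deriv i f s = deriv (\<lambda>t. f (s + t *\<^sub>R axis i 1)) 0"

text \<open>
  Since \<open>0 powr 0 = 0\<close>, this differs from the convention \<open>0\<^sup>0 = 1\<close> when an exponent and its base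
  both vanish. For the kernel below this cannot happen if \<open>s\<close> lies in the open simplex, where
  all exponents are positive.
\<close>
definition dirichlet_density :: "real ^ 'd \<Rightarrow> real \<Rightarrow> real ^ 'd \<Rightarrow> real" where
  "dirichlet_density u v s =
     Gamma (norm1 u + v) / (Gamma v * (\<Prod>i\<in>UNIV. Gamma (u $ i))) *
     (1 - norm1 s) powr (v - 1) * (\<Prod>i\<in>UNIV. (s $ i) powr (u $ i - 1))"

definition dirichlet_kernel :: "real ^ 'd \<Rightarrow> real \<Rightarrow> real ^ 'd \<Rightarrow> real" where
  "dirichlet_kernel s b = dirichlet_density (\<chi> i. s $ i / b + 1) ((1 - norm1 s) / b + 1)"

definition dirichlet_kde ::
    "(nat \<Rightarrow> 'a \<Rightarrow> real ^ 'd) \<Rightarrow> nat \<Rightarrow> real \<Rightarrow> real ^ 'd \<Rightarrow> 'a \<Rightarrow> real" where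
  "dirichlet_kde X n b s \<omega> = (1 / real n) * (\<Sum>i = 1..n. dirichlet_kernel s b (X i \<omega>))"

definition dirichlet_kde_mse ::
    "'a measure \<Rightarrow> (nat \<Rightarrow> 'a \<Rightarrow> real ^ 'd) \<Rightarrow> (real ^ 'd \<Rightarrow> real) \<Rightarrow> nat \<Rightarrow> real \<Rightarrow> real ^ 'd \<Rightarrow> real"
  where
  "dirichlet_kde_mse M X f n b s =
     prob_space.expectation M (\<lambda>\<omega>. \<bar>dirichlet_kde X n b s \<omega> - f s\<bar>\<^sup>2)"

definition generated_events ::
    "'a measure \<Rightarrow> (nat \<Rightarrow> 'a \<Rightarrow> 'b::topological_space) \<Rightarrow> nat set \<Rightarrow> 'a set set" where
  "generated_events M X I =
     sigma_sets (space M) {X i -` B \<inter> space M | i B. i \<in> I \<and> B \<in> sets borel}"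

definition strong_mixing_coeff ::
    "'a measure \<Rightarrow> (nat \<Rightarrow> 'a \<Rightarrow> 'b::topological_space) \<Rightarrow> nat \<Rightarrow> real" where
  "strong_mixing_coeff M X n =
     (SUP k\<in>{1..}. SUP (A, B)\<in>generated_events M X {1..k} \<times> generated_events M X {k + n..}.
        \<bar>measure M (A \<inter> B) - measure M A * measure M B\<bar>)"

definition bias_coeff :: "(real ^ 'd \<Rightarrow> real) \<Rightarrow> real ^ 'd \<Rightarrow> real" where
  "bias_coeff f s =
     (\<Sum>i\<in>UNIV. (1 - (real CARD('d) + 1) * s $ i) * partial_deriv i f s) +
     1 / 2 * (\<Sum>i\<in>UNIV. \<Sum>j\<in>UNIV.
       s $ i * ((if i = j then 1 else 0) - s $ j) * partial_deriv i (partial_deriv j f) s)"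

definition variance_coeff :: "real ^ 'd \<Rightarrow> real" where
  "variance_coeff s =
     (4 * pi) powr (- (real CARD('d) / 2)) /
     ((1 - norm1 s) powr (1 / 2) * (\<Prod>i\<in>UNIV. (s $ i) powr (1 / 2)))"

end

theory Submission
  imports Defs "HOL-Real_Asymp.Real_Asymp"
begin

text \<open>
  The mean square error is the squared bias plus the variance. Below, \<open>d\<close> is \<open>CARD('d)\<close>.

  \<^emph>\<open>Bias.\<close> The expectation of the estimator at \<open>s\<close> is the expectation of \<open>f \<xi>\<close>, where \<open>\<xi>\<close> has the Dirichlet
  density \<open>dirichlet_kernel s b\<close>. The moments of \<open>\<xi>\<close> are rational functions of \<open>b\<close> and \<open>s\<close>, because multiplying
  a Dirichlet density by a coordinate gives a multiple of another Dirichlet density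
  (\<open>dirichlet_density_size_bias\<close>). The first two moments about \<open>s\<close> produce \<open>b * bias_coeff f s\<close> through
  Taylor's formula. The fourth is of order \<open>b\<^sup>2\<close>, which disposes of the remainder away from \<open>s\<close>. Since
  the simplex is compact, the error is \<open>o(b)\<close> uniformly in \<open>s\<close> (\<open>kernel_measure_bias\<close>).

  \<^emph>\<open>Variance of one summand.\<close> The square of the kernel with bandwidth \<open>b\<close> is a constant times the kernel with
  bandwidth \<open>b / 2\<close>. So the second moment of a summand is this constant times \<open>f s + o(1)\<close>, and the
  duplication formula and the log-convexity of the Gamma function give the asymptotics of the constant
  (\<open>square_ratio_asymp\<close>).

  \<^emph>\<open>Covariances.\<close> The kernel attains its maximum at \<open>s\<close>, and the maximum is of order \<open>b powr (- d / 2)\<close>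
  because the integral is one and the kernel does not drop much on a box of side \<open>sqrt b\<close>
  (\<open>dirichlet_kernel_mode_bound\<close>). Hence a covariance at lag \<open>l\<close> is bounded in two ways: by a multiple of
  \<open>b powr (- d / p)\<close>, from the bound on the \<open>p\<close>-norm of the difference between the joint density and the
  product of the marginal ones (\<open>covariance_joint_density\<close>), and by a multiple of
  \<open>b powr (- d) * l powr (- \<nu>)\<close>, from mixing (\<open>covariance_strong_mixing\<close>). The assumption on \<open>\<nu>\<close> says exactly
  that a weighted geometric mean of the two bounds exists that is summable over \<open>l\<close> with an exponent of
  \<open>b\<close> above \<open>- d / 2\<close>. After summation the covariances are therefore negligible against
  \<open>n powr (- 1) * b powr (- d / 2)\<close>.
\<close>

section \<open>The simplex\<close>

lemma open_simplex_iff: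
  fixes s :: "real ^ 'd"
  shows "s \<in> open_simplex \<longleftrightarrow> (\<forall>i. 0 < s $ i) \<and> (\<Sum>i\<in>UNIV. s $ i) < 1"
proof
  assume s: "s \<in> open_simplex"
  then have pos: "\<forall>i. 0 < s $ i" by (auto simp: open_simplex_def)
  then have "norm1 s = (\<Sum>i\<in>UNIV. s $ i)" by (auto simp: norm1_def less_imp_le intro!: sum.cong)
  with s pos show "(\<forall>i. 0 < s $ i) \<and> (\<Sum>i\<in>UNIV. s $ i) < 1" by (auto simp: open_simplex_def)
next
  assume s: "(\<forall>i. 0 < s $ i) \<and> (\<Sum>i\<in>UNIV. s $ i) < 1"
  then have eq: "norm1 s = (\<Sum>i\<in>UNIV. s $ i)" by (auto simp: norm1_def less_imp_le intro!: sum.cong)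
  have "s $ i \<le> (\<Sum>i\<in>UNIV. s $ i)" for i using s by (intro member_le_sum) (auto simp: less_imp_le)
  then show "s \<in> open_simplex" using s eq by (auto simp: open_simplex_def intro: le_less_trans)
qed

lemma simplex_set_iff:
  fixes s :: "real ^ 'd"
  shows "s \<in> simplex_set \<longleftrightarrow> (\<forall>i. 0 \<le> s $ i) \<and> (\<Sum>i\<in>UNIV. s $ i) \<le> 1"
proof
  assume s: "s \<in> simplex_set"
  then have pos: "\<forall>i. 0 \<le> s $ i" by (auto simp: simplex_set_def)
  then have "norm1 s = (\<Sum>i\<in>UNIV. s $ i)" by (auto simp: norm1_def intro!: sum.cong)
  with s pos show "(\<forall>i. 0 \<le> s $ i) \<and> (\<Sum>i\<in>UNIV. s $ i) \<le> 1" by (auto simp: simplex_set_def)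
next
  assume s: "(\<forall>i. 0 \<le> s $ i) \<and> (\<Sum>i\<in>UNIV. s $ i) \<le> 1"
  then have eq: "norm1 s = (\<Sum>i\<in>UNIV. s $ i)" by (auto simp: norm1_def intro!: sum.cong)
  have "s $ i \<le> (\<Sum>i\<in>UNIV. s $ i)" for i using s by (intro member_le_sum) auto
  then show "s \<in> simplex_set" using s eq by (auto simp: simplex_set_def intro: order_trans)
qed

lemma norm1_eq_sum: "(\<And>i. 0 \<le> s $ i) \<Longrightarrow> norm1 s = (\<Sum>i\<in>UNIV. s $ i)"
  by (simp add: norm1_def)

lemma open_simplex_subset: "open_simplex \<subseteq> simplex_set"
  by (auto simp: open_simplex_iff simplex_set_iff less_imp_le)

lemma open_open_simplex: "open (open_simplex :: (real ^ 'd) set)"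
proof -
  have "open_simplex = (\<Inter>i. {s :: real ^ 'd. 0 < s $ i}) \<inter> {s. (\<Sum>i\<in>UNIV. s $ i) < 1}"
    by (auto simp: open_simplex_iff)
  also have "open \<dots>"
    by (intro open_Int open_INT open_Collect_less continuous_intros ballI) auto
  finally show ?thesis .
qed

lemma compact_simplex_set: "compact (simplex_set :: (real ^ 'd) set)"
proof -
  have "simplex_set = (\<Inter>i. {s :: real ^ 'd. 0 \<le> s $ i}) \<inter> {s. (\<Sum>i\<in>UNIV. s $ i) \<le> 1}"
    by (auto simp: simplex_set_iff)
  also have "closed \<dots>"
    by (intro closed_Int closed_INT closed_Collect_le continuous_intros ballI)
  finally have "closed (simplex_set :: (real ^ 'd) set)" .
  moreover have "bounded (simplex_set :: (real ^ 'd) set)"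
  proof -
    have "simplex_set \<subseteq> cbox 0 (1 :: real ^ 'd)"
      by (auto simp: simplex_set_def mem_box_cart)
    then show ?thesis using bounded_cbox bounded_subset by blast
  qed
  ultimately show ?thesis by (simp add: compact_eq_bounded_closed)
qed

lemma convex_simplex_set: "convex (simplex_set :: (real ^ 'd) set)"
  unfolding convex_alt
proof (intro ballI allI impI)
  fix x y :: "real ^ 'd" and u :: real
  assume x: "x \<in> simplex_set" and y: "y \<in> simplex_set" and u: "0 \<le> u \<and> u \<le> 1"
  have "(\<Sum>i\<in>UNIV. ((1 - u) *\<^sub>R x + u *\<^sub>R y) $ i) =
      (1 - u) * (\<Sum>i\<in>UNIV. x $ i) + u * (\<Sum>i\<in>UNIV. y $ i)"
    by (simp add: sum.distrib sum_distrib_left)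
  also have "\<dots> \<le> (1 - u) * 1 + u * 1"
    using x y u by (intro add_mono mult_left_mono) (auto simp: simplex_set_iff)
  finally show "(1 - u) *\<^sub>R x + u *\<^sub>R y \<in> simplex_set"
    using x y u by (auto simp: simplex_set_iff)
qed

lemma borel_measurable_vec_nth [measurable]: "(\<lambda>x :: real ^ 'd. x $ i) \<in> borel_measurable borel"
  by (intro borel_measurable_continuous_onI continuous_intros)

lemma sets_open_simplex [measurable]: "(open_simplex :: (real ^ 'd) set) \<in> sets borel"
  by (intro borel_open open_open_simplex)

lemma sets_simplex_set [measurable]: "(simplex_set :: (real ^ 'd) set) \<in> sets borel"
  by (intro borel_closed compact_imp_closed compact_simplex_set)

section \<open>The Dirichlet integral\<close>

lemma nn_integral_prod_components:
  fixes g :: "'d::finite \<Rightarrow> real \<Rightarrow> ennreal"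
  assumes [measurable]: "\<And>i. g i \<in> borel_measurable borel"
  shows "(\<integral>\<^sup>+x. (\<Prod>i\<in>UNIV. g i (x $ i)) \<partial>(lborel :: (real ^ 'd) measure)) =
    (\<Prod>i\<in>UNIV. \<integral>\<^sup>+t. g i t \<partial>lborel)"
proof -
  let ?e = "\<lambda>i::'d. axis i (1::real)"
  have inj: "inj ?e" by (auto simp: inj_def axis_eq_axis)
  have B: "(Basis :: (real ^ 'd) set) = range ?e" by (auto simp: Basis_vec_def)
  let ?f = "\<lambda>b. g (inv ?e b)"
  have "(\<integral>\<^sup>+x. (\<Prod>b\<in>Basis. ?f b (x \<bullet> b)) \<partial>(lborel :: (real ^ 'd) measure)) =
      (\<Prod>b\<in>(Basis :: (real ^ 'd) set). \<integral>\<^sup>+t. ?f b t \<partial>lborel)"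
    by (rule nn_integral_lborel_prod) auto
  then show ?thesis
    unfolding B by (simp add: prod.reindex[OF inj] inv_f_f[OF inj] inner_axis)
qed

lemma nn_integral_Gamma:
  assumes "s > (0::real)"
  shows "(\<integral>\<^sup>+t. ennreal (indicator {0<..} t * (t powr (s - 1) * exp (- t))) \<partial>lborel) = ennreal (Gamma s)"
proof -
  have "(\<integral>\<^sup>+t. ennreal (indicator {0<..} t * (t powr (s - 1) * exp (- t))) \<partial>lborel) =
    (\<integral>\<^sup>+t. ennreal (indicator {0..} t * t powr (s - 1) / exp t) \<partial>lborel)"
    by (rule nn_integral_cong) (auto simp: indicator_def exp_minus field_simps)
  then show ?thesis using Gamma_conv_nn_integral_real[OF assms] by simp
qed

lemma nn_integral_scale:
  fixes f :: "real ^ 'd \<Rightarrow> ennreal"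
  assumes [measurable]: "f \<in> borel_measurable borel" and "0 < r"
  shows "(\<integral>\<^sup>+x. f x \<partial>lborel) = ennreal (r ^ CARD('d)) * (\<integral>\<^sup>+x. f (r *\<^sub>R x) \<partial>lborel)"
  using assms(2) by (subst lborel_affine[of r 0])
    (simp_all add: nn_integral_density nn_integral_distr nn_integral_cmult)

text \<open>
  Write the product of Gamma integrals in \<open>y\<close> and \<open>t\<close> with \<open>t = r - (\<Sum>i. y $ i)\<close>: after Fubini the
  inner integral over \<open>{y. (\<Sum>i. y $ i) < r}\<close> is a power of \<open>r\<close> times the integral over the simplex,
  and the remaining integral over \<open>r\<close> is again a Gamma integral.
\<close>
lemma nn_integral_dirichlet:
  fixes u :: "real ^ 'd"
  assumes u: "\<And>i. 0 < u $ i" and v: "0 < v"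
  shows "(\<integral>\<^sup>+x. ennreal (indicator open_simplex x *
       ((1 - (\<Sum>i\<in>UNIV. x $ i)) powr (v - 1) * (\<Prod>i\<in>UNIV. x $ i powr (u $ i - 1)))) \<partial>lborel) =
     ennreal (Gamma v * (\<Prod>i\<in>UNIV. Gamma (u $ i)) / Gamma ((\<Sum>i\<in>UNIV. u $ i) + v))"
proof -
  define P where "P y = (\<Prod>i\<in>UNIV. y $ i powr (u $ i - 1))" for y :: "real ^ 'd"
  define \<sigma> where "\<sigma> y = (\<Sum>i\<in>UNIV. y $ i)" for y :: "real ^ 'd"
  define pos where "pos y \<longleftrightarrow> (\<forall>i. 0 < y $ i)" for y :: "real ^ 'd"
  define F where "F r = (\<integral>\<^sup>+y. ennreal (indicator {y. pos y \<and> \<sigma> y < r} y * ((r - \<sigma> y) powr (v - 1) * P y)) \<partial>lborel)" for r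
  have [measurable]: "P \<in> borel_measurable borel" "\<sigma> \<in> borel_measurable borel"
    unfolding P_def \<sigma>_def by measurable
  have [measurable]: "Measurable.pred borel pos" unfolding pos_def by measurable
  have P_nonneg: "P y \<ge> 0" for y by (simp add: P_def prod_nonneg)
  let ?A = "\<sigma> u + v"
  have A: "0 < ?A" unfolding \<sigma>_def using u v by (intro add_nonneg_pos sum_nonneg) (auto simp: less_imp_le)
  have scale: "F r = ennreal (r powr (?A - 1)) * F 1" if r: "0 < r" for r
  proof -
    have *: "r ^ CARD('d) * (indicator {y. pos y \<and> \<sigma> y < r} (r *\<^sub>R x) *
        ((r - \<sigma> (r *\<^sub>R x)) powr (v - 1) * P (r *\<^sub>R x))) =
        r powr (?A - 1) * (indicator {y. pos y \<and> \<sigma> y < 1} x * ((1 - \<sigma> x) powr (v - 1) * P x))" for x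
    proof (cases "pos x \<and> \<sigma> x < 1")
      case True
      have s: "\<sigma> (r *\<^sub>R x) = r * \<sigma> x" by (simp add: \<sigma>_def sum_distrib_left)
      have "P (r *\<^sub>R x) = (\<Prod>i\<in>UNIV. r powr (u $ i - 1) * x $ i powr (u $ i - 1))"
        unfolding P_def using True r by (intro prod.cong refl) (auto simp: pos_def powr_mult)
      also have "\<dots> = r powr (\<Sum>i\<in>UNIV. u $ i - 1) * P x"
        using r by (simp add: prod.distrib P_def powr_sum)
      also have "(\<Sum>i\<in>UNIV. u $ i - 1) = \<sigma> u - real CARD('d)"
        by (simp add: \<sigma>_def sum_subtractf)
      finally have P: "P (r *\<^sub>R x) = r powr (\<sigma> u - real CARD('d)) * P x" .
      have q: "(r - \<sigma> (r *\<^sub>R x)) powr (v - 1) = r powr (v - 1) * (1 - \<sigma> x) powr (v - 1)"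
        using r True by (subst powr_mult[symmetric]) (auto simp: s algebra_simps)
      have "pos (r *\<^sub>R x)" "\<sigma> (r *\<^sub>R x) < r" using True r by (auto simp: pos_def s)
      moreover have "r ^ CARD('d) * (r powr (v - 1) * r powr (\<sigma> u - real CARD('d))) = r powr (?A - 1)"
        using r by (simp add: powr_realpow[symmetric] powr_add[symmetric] algebra_simps)
      ultimately show ?thesis using True by (simp add: P q ac_simps)
    next
      case False
      then have "\<not> (pos (r *\<^sub>R x) \<and> \<sigma> (r *\<^sub>R x) < r)" using r
        by (auto simp: pos_def \<sigma>_def sum_distrib_left[symmetric] zero_less_mult_iff)
      then show ?thesis using False by auto
    qed
    have "F r = (\<integral>\<^sup>+x. ennreal (r ^ CARD('d) * (indicator {y. pos y \<and> \<sigma> y < r} (r *\<^sub>R x) *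
        ((r - \<sigma> (r *\<^sub>R x)) powr (v - 1) * P (r *\<^sub>R x)))) \<partial>lborel)"
      unfolding F_def using r
      by (subst nn_integral_scale[of _ r]) (simp_all add: nn_integral_cmult[symmetric] ennreal_mult')
    also have "\<dots> = ennreal (r powr (?A - 1)) * F 1"
      unfolding * F_def by (subst nn_integral_cmult[symmetric]) (auto simp: ennreal_mult')
    finally show ?thesis .
  qed
  have "ennreal (\<Prod>i\<in>UNIV. Gamma (u $ i)) =
      (\<Prod>i\<in>UNIV. \<integral>\<^sup>+t. ennreal (indicator {0<..} t * (t powr (u $ i - 1) * exp (- t))) \<partial>lborel)"
    using u by (simp add: nn_integral_Gamma prod_ennreal Gamma_real_pos less_imp_le)
  also have "\<dots> = (\<integral>\<^sup>+y. (\<Prod>i\<in>UNIV. ennreal (indicator {0<..} (y $ i) * (y $ i powr (u $ i - 1) * exp (- (y $ i))))) \<partial>lborel)"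
    by (rule nn_integral_prod_components[symmetric]) measurable
  also have "\<dots> = (\<integral>\<^sup>+y. ennreal (indicator {y. pos y} y * (P y * exp (- \<sigma> y))) \<partial>lborel)"
  proof (intro nn_integral_cong)
    fix y :: "real ^ 'd"
    have "(\<Prod>i\<in>UNIV. indicator {0<..} (y $ i) :: real) = indicator {y. pos y} y"
      by (auto simp: pos_def indicator_def)
    then show "(\<Prod>i\<in>UNIV. ennreal (indicator {0<..} (y $ i) * (y $ i powr (u $ i - 1) * exp (- (y $ i))))) =
      ennreal (indicator {y. pos y} y * (P y * exp (- \<sigma> y)))"
      by (simp add: prod_ennreal prod.distrib P_def \<sigma>_def exp_sum sum_negf[symmetric])
  qed
  finally have G: "ennreal (\<Prod>i\<in>UNIV. Gamma (u $ i)) = \<dots>" .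
  have "ennreal (Gamma v * (\<Prod>i\<in>UNIV. Gamma (u $ i))) =
      ennreal (\<Prod>i\<in>UNIV. Gamma (u $ i)) * ennreal (Gamma v)"
    using u v by (subst mult.commute) (simp add: ennreal_mult prod_nonneg Gamma_real_pos less_imp_le)
  also have "\<dots> = (\<integral>\<^sup>+y. ennreal (indicator {y. pos y} y * (P y * exp (- \<sigma> y))) * ennreal (Gamma v) \<partial>lborel)"
    unfolding G by (rule nn_integral_multc[symmetric]) measurable
  also have "\<dots> = (\<integral>\<^sup>+y. \<integral>\<^sup>+r. ennreal (indicator {(y, r). pos y \<and> \<sigma> y < r} (y, r) *
      (P y * (r - \<sigma> y) powr (v - 1) * exp (- r))) \<partial>lborel \<partial>lborel)"
  proof (intro nn_integral_cong)
    fix y :: "real ^ 'd"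
    have "ennreal (Gamma v) = (\<integral>\<^sup>+t. ennreal (indicator {0<..} t * (t powr (v - 1) * exp (- t))) \<partial>lborel)"
      using v by (simp add: nn_integral_Gamma)
    also have "\<dots> = (\<integral>\<^sup>+r. ennreal (indicator {0<..} (r - \<sigma> y) * ((r - \<sigma> y) powr (v - 1) * exp (- (r - \<sigma> y)))) \<partial>lborel)"
      by (subst nn_integral_real_affine[where c = 1 and t = "- \<sigma> y"]) (auto simp: algebra_simps)
    finally have "ennreal (indicator {y. pos y} y * (P y * exp (- \<sigma> y))) * ennreal (Gamma v) =
      (\<integral>\<^sup>+r. ennreal (indicator {y. pos y} y * (P y * exp (- \<sigma> y))) * ennreal (indicator {0<..} (r - \<sigma> y) * ((r - \<sigma> y) powr (v - 1) * exp (- (r - \<sigma> y)))) \<partial>lborel)"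
      by (simp add: nn_integral_cmult)
    also have "\<dots> = (\<integral>\<^sup>+r. ennreal (indicator {(y, r). pos y \<and> \<sigma> y < r} (y, r) *
      (P y * (r - \<sigma> y) powr (v - 1) * exp (- r))) \<partial>lborel)"
      by (intro nn_integral_cong, subst ennreal_mult'[symmetric])
        (auto simp: indicator_def P_nonneg mult_exp_exp ac_simps)
    finally show "ennreal (indicator {y. pos y} y * (P y * exp (- \<sigma> y))) * ennreal (Gamma v) = \<dots>" .
  qed
  also have "\<dots> = (\<integral>\<^sup>+r. \<integral>\<^sup>+y. ennreal (indicator {(y, r). pos y \<and> \<sigma> y < r} (y, r) *
      (P y * (r - \<sigma> y) powr (v - 1) * exp (- r))) \<partial>lborel \<partial>lborel)"
    by (rule lborel_pair.Fubini'[symmetric]) measurable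
  also have "\<dots> = (\<integral>\<^sup>+r. ennreal (indicator {0<..} r * (r powr (?A - 1) * exp (- r))) * F 1 \<partial>lborel)"
  proof (intro nn_integral_cong)
    fix r :: real
    have "(\<integral>\<^sup>+y. ennreal (indicator {(y, r). pos y \<and> \<sigma> y < r} (y, r) *
      (P y * (r - \<sigma> y) powr (v - 1) * exp (- r))) \<partial>lborel) = ennreal (exp (- r)) * F r"
      unfolding F_def
    proof (subst nn_integral_cmult[symmetric], measurable, intro nn_integral_cong)
      fix y :: "real ^ 'd"
      show "ennreal (indicator {(y, r). pos y \<and> \<sigma> y < r} (y, r) * (P y * (r - \<sigma> y) powr (v - 1) * exp (- r))) =
        ennreal (exp (- r)) * ennreal (indicator {y. pos y \<and> \<sigma> y < r} y * ((r - \<sigma> y) powr (v - 1) * P y))"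
        by (subst ennreal_mult'[symmetric]) (simp_all add: indicator_def mult.commute mult.left_commute)
    qed
    also have "\<dots> = ennreal (indicator {0<..} r * (r powr (?A - 1) * exp (- r))) * F 1"
    proof (cases "0 < r")
      case True
      then show ?thesis by (subst scale[OF True]) (simp add: ennreal_mult' ac_simps)
    next
      case False
      have "0 \<le> \<sigma> y" if "pos y" for y using that by (auto simp: \<sigma>_def pos_def less_imp_le intro!: sum_nonneg)
      then have "{y. pos y \<and> \<sigma> y < r} = {}" using False by force
      then have "F r = 0" unfolding F_def by simp
      then show ?thesis using False by simp
    qed
    finally show "(\<integral>\<^sup>+y. ennreal (indicator {(y, r). pos y \<and> \<sigma> y < r} (y, r) *
      (P y * (r - \<sigma> y) powr (v - 1) * exp (- r))) \<partial>lborel) = \<dots>" .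
  qed
  also have "\<dots> = ennreal (Gamma ?A) * F 1"
    using A by (subst nn_integral_multc) (simp_all add: nn_integral_Gamma)
  finally have eq: "ennreal (Gamma v * (\<Prod>i\<in>UNIV. Gamma (u $ i))) = ennreal (Gamma ?A) * F 1" .
  have G0: "0 < Gamma ?A" using A by (rule Gamma_real_pos)
  have "ennreal (Gamma v * (\<Prod>i\<in>UNIV. Gamma (u $ i)) / Gamma ?A) =
      ennreal (1 / Gamma ?A) * (ennreal (Gamma ?A) * F 1)"
    unfolding eq[symmetric] using G0 by (subst ennreal_mult'[symmetric]) auto
  also have "\<dots> = F 1"
    using G0 by (simp add: mult.assoc[symmetric] ennreal_mult'[symmetric])
  also have "F 1 = (\<integral>\<^sup>+x. ennreal (indicator open_simplex x *
       ((1 - (\<Sum>i\<in>UNIV. x $ i)) powr (v - 1) * (\<Prod>i\<in>UNIV. x $ i powr (u $ i - 1)))) \<partial>lborel)"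
    unfolding F_def P_def \<sigma>_def pos_def
    by (intro nn_integral_cong) (auto simp: indicator_def open_simplex_iff)
  finally show ?thesis by (simp add: \<sigma>_def)
qed

section \<open>Dirichlet distributions and their moments\<close>

text \<open>The indicator removes the values that the density formula takes outside the simplex.\<close>
definition dirichlet :: "real ^ 'd \<Rightarrow> real \<Rightarrow> (real ^ 'd) measure" where
  "dirichlet u v = density lborel (\<lambda>x. ennreal (indicator open_simplex x * dirichlet_density u v x))"

lemma space_dirichlet [simp]: "space (dirichlet u v) = UNIV"
  and sets_dirichlet [simp, measurable_cong]: "sets (dirichlet u v) = sets borel"
  by (simp_all add: dirichlet_def)

lemma borel_measurable_norm1 [measurable]: "norm1 \<in> borel_measurable borel"
  unfolding norm1_def[abs_def] by measurable

lemma borel_measurable_dirichlet_density [measurable]: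
  "dirichlet_density u v \<in> borel_measurable borel"
  unfolding dirichlet_density_def[abs_def] by measurable

lemma dirichlet_density_nonneg:
  assumes "\<And>i. 0 < u $ i" "0 < v"
  shows "0 \<le> dirichlet_density u v x"
proof -
  have "0 \<le> norm1 u" by (simp add: norm1_def sum_nonneg)
  then show ?thesis unfolding dirichlet_density_def using assms
    by (intro mult_nonneg_nonneg divide_nonneg_nonneg prod_nonneg ballI)
       (auto intro!: less_imp_le Gamma_real_pos)
qed

lemma prob_space_dirichlet:
  assumes u: "\<And>i. 0 < u $ i" and v: "0 < v"
  shows "prob_space (dirichlet u v)"
proof
  let ?G = "Gamma v * (\<Prod>i\<in>UNIV. Gamma (u $ i))" and ?A = "(\<Sum>i\<in>UNIV. u $ i) + v"
  have n: "norm1 u = (\<Sum>i\<in>UNIV. u $ i)" using u by (intro norm1_eq_sum) (simp add: less_imp_le)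
  have G: "0 < ?G" using u v by (intro mult_pos_pos prod_pos ballI Gamma_real_pos) auto
  have A: "0 < Gamma ?A" using u v by (intro Gamma_real_pos add_nonneg_pos sum_nonneg) (auto simp: less_imp_le)
  have "emeasure (dirichlet u v) (space (dirichlet u v)) =
    (\<integral>\<^sup>+x. ennreal (Gamma ?A / ?G) * ennreal (indicator open_simplex x *
       ((1 - (\<Sum>i\<in>UNIV. x $ i)) powr (v - 1) * (\<Prod>i\<in>UNIV. x $ i powr (u $ i - 1)))) \<partial>lborel)"
    unfolding dirichlet_def using G A
    by (subst emeasure_density) (auto intro!: nn_integral_cong
      simp: mult.assoc dirichlet_density_def n ennreal_mult'[symmetric] indicator_def norm1_eq_sum open_simplex_iff less_imp_le)
  also have "\<dots> = ennreal (Gamma ?A / ?G) * ennreal (?G / Gamma ?A)"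
    by (subst nn_integral_cmult) (auto simp: nn_integral_dirichlet[OF u v])
  also have "\<dots> = 1"
  proof -
    have "Gamma ?A / ?G * (?G / Gamma ?A) = 1" using less_imp_neq[OF G] less_imp_neq[OF A] by (simp only: times_divide_times_eq) (metis divide_self mult.commute mult_eq_0_iff)
    then show ?thesis using G A by (subst ennreal_mult'[symmetric]) (auto simp only: less_imp_le divide_nonneg_nonneg ennreal_1)
  qed
  finally show "emeasure (dirichlet u v) (space (dirichlet u v)) = 1" .
qed

lemma AE_dirichlet_in_simplex: "AE x in dirichlet u v. x \<in> open_simplex"
  unfolding dirichlet_def by (subst AE_density) (auto simp: indicator_def)

lemma integrable_dirichlet:
  assumes "\<And>i. 0 < u $ i" "0 < v"
    and [measurable]: "\<phi> \<in> borel_measurable borel"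
    and bd: "\<And>x. x \<in> open_simplex \<Longrightarrow> \<bar>\<phi> x :: real\<bar> \<le> B"
  shows "integrable (dirichlet u v) \<phi>"
proof -
  interpret prob_space "dirichlet u v" by (rule prob_space_dirichlet) fact+
  show ?thesis
    using AE_dirichlet_in_simplex[of u v]
    by (intro integrable_const_bound[of _ B]) (auto elim!: eventually_mono simp: bd)
qed

lemma integral_dirichlet:
  assumes "\<And>i. 0 < u $ i" "0 < v" and [measurable]: "\<phi> \<in> borel_measurable borel"
  shows "integral\<^sup>L (dirichlet u v) \<phi> =
    (LINT x|lborel. indicator open_simplex x * dirichlet_density u v x * \<phi> x :: real)"
  unfolding dirichlet_def using dirichlet_density_nonneg[OF assms(1,2)]
  by (subst integral_density) (auto simp: ac_simps)

lemma norm1_add_axis: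
  fixes u :: "real ^ 'd"
  assumes u: "\<And>i. 0 < u $ i"
  shows "norm1 (u + axis i 1) = norm1 u + 1"
proof -
  have "0 \<le> (u + axis i 1) $ j" for j using less_imp_le[OF u] by (auto simp: axis_def intro!: add_nonneg_nonneg)
  then show ?thesis using u by (simp add: norm1_eq_sum less_imp_le sum.distrib axis_def)
qed

text \<open>
  Raising \<open>u $ i\<close> by one multiplies the density by \<open>x $ i\<close>, up to the quotient of the normalising
  constants. Hence every moment of a Dirichlet vector is a product of such quotients.
\<close>
lemma dirichlet_density_size_bias:
  fixes u :: "real ^ 'd"
  assumes u: "\<And>i. 0 < u $ i" and v: "0 < v" and x: "x \<in> open_simplex"
  shows "x $ i * dirichlet_density u v x =
    u $ i / (norm1 u + v) * dirichlet_density (u + axis i 1) v x"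
proof -
  have n: "norm1 u = (\<Sum>i\<in>UNIV. u $ i)" using u by (intro norm1_eq_sum) (simp add: less_imp_le)
  have n': "norm1 (u + axis i 1) = norm1 u + 1" by (rule norm1_add_axis[OF u])
  have A: "0 < norm1 u + v" unfolding n using u v by (intro add_nonneg_pos sum_nonneg) (auto simp: less_imp_le)
  have GA: "Gamma (norm1 u + 1 + v) = (norm1 u + v) * Gamma (norm1 u + v)"
  proof -
    have "norm1 u + v \<notin> \<int>\<^sub>\<le>\<^sub>0" using A nonpos_Ints_nonpos[of "norm1 u + v"] by force
    from Gamma_plus1[OF this] show ?thesis by (simp add: add_ac)
  qed
  have GU: "(\<Prod>j\<in>UNIV. Gamma ((u + axis i 1) $ j)) = u $ i * (\<Prod>j\<in>UNIV. Gamma (u $ j))"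
  proof -
    have ui: "u $ i \<notin> \<int>\<^sub>\<le>\<^sub>0" using u[of i] nonpos_Ints_nonpos[of "u $ i"] by force
    have "(\<Prod>j\<in>UNIV. Gamma ((u + axis i 1) $ j)) =
        Gamma (u $ i + 1) * (\<Prod>j\<in>UNIV - {i}. Gamma (u $ j))"
      by (subst prod.remove[of _ i]) (auto simp: axis_def intro!: prod.cong)
    also have "\<dots> = u $ i * (Gamma (u $ i) * (\<Prod>j\<in>UNIV - {i}. Gamma (u $ j)))"
      by (simp add: Gamma_plus1[OF ui] mult.assoc)
    also have "Gamma (u $ i) * (\<Prod>j\<in>UNIV - {i}. Gamma (u $ j)) = (\<Prod>j\<in>UNIV. Gamma (u $ j))"
      by (rule prod.remove[symmetric]) auto
    finally show ?thesis .
  qed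
  have PX: "(\<Prod>j\<in>UNIV. x $ j powr ((u + axis i 1) $ j - 1)) = x $ i * (\<Prod>j\<in>UNIV. x $ j powr (u $ j - 1))"
  proof -
    have xi: "0 < x $ i" using x by (auto simp: open_simplex_iff)
    have "(\<Prod>j\<in>UNIV. x $ j powr ((u + axis i 1) $ j - 1)) =
        x $ i powr (u $ i) * (\<Prod>j\<in>UNIV - {i}. x $ j powr (u $ j - 1))"
      by (subst prod.remove[of _ i]) (auto simp: axis_def intro!: prod.cong)
    also have "x $ i powr (u $ i) = x $ i * x $ i powr (u $ i - 1)"
      using xi by (simp add: powr_diff)
    also have "\<dots> * (\<Prod>j\<in>UNIV - {i}. x $ j powr (u $ j - 1)) =
      x $ i * (x $ i powr (u $ i - 1) * (\<Prod>j\<in>UNIV - {i}. x $ j powr (u $ j - 1)))" by simp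
    also have "x $ i powr (u $ i - 1) * (\<Prod>j\<in>UNIV - {i}. x $ j powr (u $ j - 1)) = (\<Prod>j\<in>UNIV. x $ j powr (u $ j - 1))"
      by (rule prod.remove[symmetric]) auto
    finally show ?thesis .
  qed
  have cancel: "y * (G / (g * h) * P * Q) = c / a * (a * G / (g * (c * h)) * P * (y * Q))"
    if "a \<noteq> 0" "c \<noteq> 0" for a c g h G P Q y :: real
    using that by simp
  show ?thesis
    unfolding dirichlet_density_def n' GA GU PX using A u[of i] by (intro cancel) auto
qed

lemma expectation_dirichlet_size_bias:
  fixes u :: "real ^ 'd"
  assumes u: "\<And>i. 0 < u $ i" and v: "0 < v" and [measurable]: "\<phi> \<in> borel_measurable borel"
  shows "(LINT x|dirichlet u v. x $ i * \<phi> x) =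
    u $ i / (norm1 u + v) * (LINT x|dirichlet (u + axis i 1) v. \<phi> x :: real)"
proof -
  have upos: "0 < (u + axis i 1) $ j" for j using u[of j] by (auto simp: axis_def intro: add_pos_nonneg)
  have "(LINT x|dirichlet u v. x $ i * \<phi> x) =
    (LINT x|lborel. u $ i / (norm1 u + v) * (indicator open_simplex x * dirichlet_density (u + axis i 1) v x * \<phi> x))"
  proof (subst integral_dirichlet[OF u v], measurable, intro Bochner_Integration.integral_cong refl)
    fix x :: "real ^ 'd"
    show "indicator open_simplex x * dirichlet_density u v x * (x $ i * \<phi> x) =
      u $ i / (norm1 u + v) * (indicator open_simplex x * dirichlet_density (u + axis i 1) v x * \<phi> x)"
      using dirichlet_density_size_bias[OF u v, of x i] by (cases "x \<in> open_simplex") (auto simp: ac_simps)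
  qed
  then show ?thesis by (simp add: integral_dirichlet[OF upos v])
qed

lemma expectation_dirichlet_power:
  fixes u :: "real ^ 'd"
  assumes u: "\<And>i. 0 < u $ i" and v: "0 < v"
  shows "(LINT x|dirichlet u v. (x $ i) ^ k) = pochhammer (u $ i) k / pochhammer (norm1 u + v) k"
  using u
proof (induction k arbitrary: u)
  case 0
  interpret prob_space "dirichlet u v" by (rule prob_space_dirichlet) fact+
  show ?case using prob_space by simp
next
  case (Suc k)
  have upos: "0 < (u + axis i 1) $ j" for j using Suc.prems[of j] by (auto simp: axis_def intro: add_pos_nonneg)
  show ?case
    using Suc.IH[OF upos] expectation_dirichlet_size_bias[OF Suc.prems v, of "\<lambda>x. x $ i ^ k" i]
    unfolding norm1_add_axis[OF Suc.prems] by (simp add: pochhammer_rec add_ac axis_def)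
qed

lemma expectation_dirichlet_product:
  fixes u :: "real ^ 'd"
  assumes u: "\<And>i. 0 < u $ i" and v: "0 < v"
  shows "(LINT x|dirichlet u v. x $ i * x $ j) =
    u $ i * (u $ j + (if i = j then 1 else 0)) / ((norm1 u + v) * (norm1 u + v + 1))"
proof -
  have upos: "0 < (u + axis i 1) $ j" for j using u[of j] by (auto simp: axis_def intro: add_pos_nonneg)
  have "(LINT x|dirichlet u v. x $ i * x $ j) =
     u $ i / (norm1 u + v) * ((u + axis i 1) $ j / (norm1 u + 1 + v))"
    using expectation_dirichlet_power[OF upos v, of j 1]
    by (subst expectation_dirichlet_size_bias[OF u v]) (auto simp: norm1_add_axis[OF u])
  then show ?thesis by (simp add: axis_def add_ac)
qed

section \<open>Moments of the kernel about its mode\<close>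

lemma dirichlet_kernel_parameters_pos:
  fixes s :: "real ^ 'd"
  assumes s: "s \<in> open_simplex" and b: "0 < b"
  shows "0 < (\<chi> i. s $ i / b + 1) $ i" "0 < (1 - norm1 s) / b + 1"
    "norm1 (\<chi> i. s $ i / b + 1) + ((1 - norm1 s) / b + 1) = 1 / b + real CARD('d) + 1"
proof -
  have pos: "0 < s $ i" for i using s by (simp add: open_simplex_iff)
  show 1: "0 < (\<chi> i. s $ i / b + 1) $ i" for i using pos[of i] b by (simp add: add_pos_pos)
  have n: "norm1 s = (\<Sum>i\<in>UNIV. s $ i)" using pos by (intro norm1_eq_sum) (simp add: less_imp_le)
  then show "0 < (1 - norm1 s) / b + 1" using s b by (auto simp: open_simplex_iff intro!: add_pos_pos)
  have "norm1 (\<chi> i. s $ i / b + 1) = (\<Sum>i\<in>UNIV. s $ i / b + 1)"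
    using 1 by (subst norm1_eq_sum) (auto simp: less_imp_le)
  then show "norm1 (\<chi> i. s $ i / b + 1) + ((1 - norm1 s) / b + 1) = 1 / b + real CARD('d) + 1"
    using b by (simp add: n sum.distrib sum_divide_distrib[symmetric] field_simps)
qed

text \<open>
  The law with density \<open>dirichlet_kernel s b\<close>: the expectation of the estimator at \<open>s\<close> is the integral of
  \<open>f\<close> against it.
\<close>
definition kernel_measure :: "real ^ 'd \<Rightarrow> real \<Rightarrow> (real ^ 'd) measure" where
  "kernel_measure s b = dirichlet (\<chi> i. s $ i / b + 1) ((1 - norm1 s) / b + 1)"

lemma space_kernel_measure [simp]: "space (kernel_measure s b) = UNIV"
  and sets_kernel_measure [simp, measurable_cong]: "sets (kernel_measure s b) = sets borel"
  by (simp_all add: kernel_measure_def)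

lemma prob_space_kernel_measure:
  "s \<in> open_simplex \<Longrightarrow> 0 < b \<Longrightarrow> prob_space (kernel_measure s b)"
  unfolding kernel_measure_def by (intro prob_space_dirichlet dirichlet_kernel_parameters_pos)

lemma integrable_kernel_measure:
  assumes "s \<in> open_simplex" "0 < b" "\<phi> \<in> borel_measurable borel"
    "\<And>x. x \<in> open_simplex \<Longrightarrow> \<bar>\<phi> x :: real\<bar> \<le> B"
  shows "integrable (kernel_measure s b) \<phi>"
  unfolding kernel_measure_def using assms by (intro integrable_dirichlet dirichlet_kernel_parameters_pos) auto

lemma integral_kernel_measure:
  assumes "s \<in> open_simplex" "0 < b" "\<phi> \<in> borel_measurable borel"
  shows "integral\<^sup>L (kernel_measure s b) \<phi> =
    (LINT x|lborel. indicator open_simplex x * dirichlet_kernel s b x * \<phi> x :: real)"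
  unfolding kernel_measure_def dirichlet_kernel_def using assms
  by (intro integral_dirichlet dirichlet_kernel_parameters_pos) auto

lemma kernel_measure_power:
  fixes s :: "real ^ 'd"
  assumes s: "s \<in> open_simplex" and b: "0 < b"
  shows "(LINT x|kernel_measure s b. (x $ i) ^ k) =
    pochhammer (s $ i / b + 1) k / pochhammer (1 / b + real CARD('d) + 1) k"
  unfolding kernel_measure_def
  using expectation_dirichlet_power[OF dirichlet_kernel_parameters_pos(1,2)[OF s b], of i k]
  by (simp only: dirichlet_kernel_parameters_pos(3)[OF s b] vec_lambda_beta)

lemma kernel_measure_product:
  fixes s :: "real ^ 'd"
  assumes s: "s \<in> open_simplex" and b: "0 < b"
  shows "(LINT x|kernel_measure s b. x $ i * x $ j) =
    (s $ i / b + 1) * (s $ j / b + 1 + (if i = j then 1 else 0)) /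
    ((1 / b + real CARD('d) + 1) * (1 / b + real CARD('d) + 2))"
proof -
  have "norm1 (\<chi> i. s $ i / b + 1) + ((1 - norm1 s) / b + 1) + 1 = 1 / b + real CARD('d) + 2"
    using dirichlet_kernel_parameters_pos(3)[OF s b] by simp
  then show ?thesis
  unfolding kernel_measure_def
  using expectation_dirichlet_product[OF dirichlet_kernel_parameters_pos(1,2)[OF s b], of i j]
  by (simp only: dirichlet_kernel_parameters_pos(3)[OF s b] vec_lambda_beta)
qed

lemma simplex_coordinate_bounds:
  assumes "x \<in> simplex_set" shows "0 \<le> x $ i" "x $ i \<le> 1"
  using assms by (auto simp: simplex_set_def)

lemma integrable_kernel_power:
  fixes s :: "real ^ 'd"
  assumes "s \<in> open_simplex" "0 < b"
  shows "integrable (kernel_measure s b) (\<lambda>x. (x $ i) ^ k)"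
  using assms
proof (rule integrable_kernel_measure[where B = 1])
  fix x :: "real ^ 'd" assume "x \<in> open_simplex"
  then have "0 \<le> x $ i" "x $ i \<le> 1" using open_simplex_subset simplex_coordinate_bounds by blast+
  then show "\<bar>x $ i ^ k\<bar> \<le> 1" by (simp add: power_le_one)
qed measurable

lemma integrable_kernel_product:
  fixes s :: "real ^ 'd"
  assumes "s \<in> open_simplex" "0 < b"
  shows "integrable (kernel_measure s b) (\<lambda>x. x $ i * x $ j)"
  using assms
proof (rule integrable_kernel_measure[where B = 1])
  fix x :: "real ^ 'd" assume "x \<in> open_simplex"
  then have "0 \<le> x $ i" "x $ i \<le> 1" "0 \<le> x $ j" "x $ j \<le> 1" using open_simplex_subset simplex_coordinate_bounds by blast+
  then show "\<bar>x $ i * x $ j\<bar> \<le> 1" by (simp add: mult_le_one)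
qed measurable

lemma kernel_measure_mean:
  fixes s :: "real ^ 'd"
  assumes s: "s \<in> open_simplex" and b: "0 < b"
  shows "(LINT x|kernel_measure s b. x $ i - s $ i) =
    b * (1 - (real CARD('d) + 1) * s $ i) / (1 + b * (real CARD('d) + 1))"
proof -
  interpret prob_space "kernel_measure s b" by (rule prob_space_kernel_measure[OF s b])
  have "(LINT x|kernel_measure s b. x $ i - s $ i) = (s $ i / b + 1) / (1 / b + real CARD('d) + 1) - s $ i"
    using integrable_kernel_power[OF s b, of i 1] kernel_measure_power[OF s b, of i 1]
    by (simp add: prob_space[simplified])
  also have "(s $ i / b + 1) / (1 / b + real CARD('d) + 1) = (s $ i + b) / (1 + b * (real CARD('d) + 1))"
  proof -
    have "(s $ i / b + 1) = (s $ i + b) / b" "1 / b + real CARD('d) + 1 = (1 + b * (real CARD('d) + 1)) / b"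
      using b by (simp_all add: field_simps)
    then show ?thesis using b by simp
  qed
  also have "(s $ i + b) / (1 + b * (real CARD('d) + 1)) - s $ i =
     b * (1 - (real CARD('d) + 1) * s $ i) / (1 + b * (real CARD('d) + 1))"
  proof -
    have "0 < 1 + b * (real CARD('d) + 1)" using b by (intro add_pos_nonneg) auto
    then show ?thesis by (simp add: field_simps)
  qed
  finally show ?thesis .
qed

text \<open>
  The factor \<open>s $ i * ((if i = j then 1 else 0) - s $ j)\<close> is the covariance of a multinomial trial with
  cell probabilities \<open>s\<close>; it becomes the coefficient of the second derivatives in the bias.
\<close>
lemma kernel_measure_second_moment:
  fixes s :: "real ^ 'd"
  assumes s: "s \<in> open_simplex" and b: "0 < b"
  defines "D \<equiv> real CARD('d) + 1"
  shows "(LINT x|kernel_measure s b. (x $ i - s $ i) * (x $ j - s $ j)) =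
    (b * (s $ i * ((if i = j then 1 else 0) - s $ j)) +
     b\<^sup>2 * (1 + (if i = j then 1 else 0) - (D + 1) * (s $ i + s $ j) + D * (D + 1) * (s $ i * s $ j))) /
    ((1 + b * D) * (1 + b * (D + 1)))"
proof -
  interpret prob_space "kernel_measure s b" by (rule prob_space_kernel_measure[OF s b])
  let ?\<delta> = "if i = j then 1 else (0::real)"
  note [simp] = integrable_kernel_product[OF s b] integrable_kernel_power[OF s b, where k = 1, simplified]
  have "(LINT x|kernel_measure s b. (x $ i - s $ i) * (x $ j - s $ j)) =
     (LINT x|kernel_measure s b. x $ i * x $ j - s $ j * x $ i - s $ i * x $ j + s $ i * s $ j)"
    by (simp add: algebra_simps)
  also have "\<dots> = (LINT x|kernel_measure s b. x $ i * x $ j) -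
      s $ j * (LINT x|kernel_measure s b. x $ i) - s $ i * (LINT x|kernel_measure s b. x $ j) + s $ i * s $ j"
    by (simp add: prob_space[simplified])
  also have "\<dots> = (s $ i / b + 1) * (s $ j / b + 1 + ?\<delta>) / ((1 / b + D) * (1 / b + D + 1)) -
      s $ j * ((s $ i / b + 1) / (1 / b + D)) - s $ i * ((s $ j / b + 1) / (1 / b + D)) + s $ i * s $ j"
    using kernel_measure_power[OF s b, of i 1] kernel_measure_power[OF s b, of j 1]
    by (simp add: kernel_measure_product[OF s b] D_def add_ac)
  also have "s $ i / b + 1 = (s $ i + b) / b" using b by (simp add: field_simps)
  also have "s $ j / b + 1 = (s $ j + b) / b" using b by (simp add: field_simps)
  also have "(s $ j + b) / b + ?\<delta> = (s $ j + b + b * ?\<delta>) / b" using b by (simp add: field_simps)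
  also have "1 / b + D + 1 = (1 + b * (D + 1)) / b" using b by (simp add: field_simps)
  also have "1 / b + D = (1 + b * D) / b" using b by (simp add: field_simps)
  also have "((s $ i + b) / b) * ((s $ j + b + b * ?\<delta>) / b) / (((1 + b * D) / b) * ((1 + b * (D + 1)) / b)) -
    s $ j * (((s $ i + b) / b) / ((1 + b * D) / b)) - s $ i * (((s $ j + b) / b) / ((1 + b * D) / b)) + s $ i * s $ j =
    ((s $ i + b) * (s $ j + b + b * ?\<delta>) - s $ j * (s $ i + b) * (1 + b * (D + 1)) -
      s $ i * (s $ j + b) * (1 + b * (D + 1)) + s $ i * s $ j * ((1 + b * D) * (1 + b * (D + 1)))) /
    ((1 + b * D) * (1 + b * (D + 1)))"
  proof -
    have "0 < 1 + b * D" "0 < 1 + b * (D + 1)" using b unfolding D_def by (auto intro!: add_pos_nonneg)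
    moreover have "u * w / (p * q) - y * (u / p) - x * (z / p) + x * y =
      (u * w - y * u * q - x * z * q + x * y * (p * q)) / (p * q)" if "0 < p" "0 < q" for u w p q x y z :: real
      using that by (simp add: field_simps)
    ultimately show ?thesis using b by simp
  qed
  also have "(s $ i + b) * (s $ j + b + b * ?\<delta>) - s $ j * (s $ i + b) * (1 + b * (D + 1)) -
      s $ i * (s $ j + b) * (1 + b * (D + 1)) + s $ i * s $ j * ((1 + b * D) * (1 + b * (D + 1))) =
    b * (s $ i * (?\<delta> - s $ j)) + b\<^sup>2 * (1 + ?\<delta> - (D + 1) * (s $ i + s $ j) + D * (D + 1) * (s $ i * s $ j))"
    by (simp add: algebra_simps power2_eq_square)
  finally show ?thesis .
qed

text \<open>
  The terms of order \<open>1\<close> and \<open>b\<close> in the numerator of the fourth moment cancel; \<open>Q\<close> is what is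
  left after division by \<open>b\<^sup>2\<close>.
\<close>
lemma kernel_measure_fourth_moment:
  fixes s :: "real ^ 'd" and i :: 'd
  assumes s: "s \<in> open_simplex" and b: "0 < b"
  defines "D \<equiv> real CARD('d) + 1" and "z \<equiv> s $ i"
  defines "Q \<equiv> 3*z^2 - 6*z^3 + 3*z^4
    + b * (26*z - 72*z^2 - 20*z^2*D + 64*z^3 + 42*z^3*D + 6*z^3*D^2 - 18*z^4 - 22*z^4*D - 6*z^4*D^2)
    + b^2 * (24 - 72*z - 24*z*D + 72*z^2 + 60*z^2*D + 12*z^2*D^2 - 24*z^3 - 44*z^3*D - 24*z^3*D^2
       - 4*z^3*D^3 + 6*z^4*D + 11*z^4*D^2 + 6*z^4*D^3 + z^4*D^4)"
  shows "(LINT x|kernel_measure s b. (x $ i - s $ i) ^ 4) =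
    b\<^sup>2 * Q / ((1 + b * D) * (1 + b * (D + 1)) * (1 + b * (D + 2)) * (1 + b * (D + 3)))"
proof -
  interpret prob_space "kernel_measure s b" by (rule prob_space_kernel_measure[OF s b])
  note [simp] = integrable_kernel_power[OF s b] integrable_kernel_power[OF s b, where k = 1, simplified]
  let ?m = "\<lambda>k. LINT x|kernel_measure s b. (x $ i) ^ k"
  define A where "A = 1 / b + D"
  define w where "w = z / b + 1"
  have m: "?m k = pochhammer w k / pochhammer A k" for k
    unfolding w_def z_def A_def D_def by (simp add: kernel_measure_power[OF s b] add_ac)
  have "(LINT x|kernel_measure s b. (x $ i - s $ i) ^ 4) =
     (LINT x|kernel_measure s b. (x $ i) ^ 4 - 4 * z * (x $ i) ^ 3 + 6 * z^2 * (x $ i) ^ 2 - 4 * z^3 * (x $ i) ^ 1 + z^4)"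
    unfolding z_def by (intro Bochner_Integration.integral_cong) (auto simp: power4_eq_xxxx power2_eq_square power3_eq_cube algebra_simps)
  also have "\<dots> = ?m 4 - 4 * z * ?m 3 + 6 * z^2 * ?m 2 - 4 * z^3 * ?m 1 + z^4"
    by (simp add: prob_space[simplified])
  also have "\<dots> = w * (w + 1) * (w + 2) * (w + 3) / (A * (A + 1) * (A + 2) * (A + 3))
     - 4 * z * (w * (w + 1) * (w + 2) / (A * (A + 1) * (A + 2)))
     + 6 * z^2 * (w * (w + 1) / (A * (A + 1))) - 4 * z^3 * (w / A) + z^4"
    unfolding m by (simp add: pochhammer_rec eval_nat_numeral add_ac mult_ac)
  also have "\<dots> = (w * (w + 1) * (w + 2) * (w + 3)
     - 4 * z * (w * (w + 1) * (w + 2)) * (A + 3)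
     + 6 * z^2 * (w * (w + 1)) * ((A + 2) * (A + 3)) - 4 * z^3 * w * ((A + 1) * (A + 2) * (A + 3))
     + z^4 * (A * (A + 1) * (A + 2) * (A + 3))) / (A * (A + 1) * (A + 2) * (A + 3))"
  proof -
    have "0 < A" using b unfolding A_def D_def by (intro add_pos_nonneg) auto
    moreover have "n4 / (p * q * r * t) - x3 * (n3 / (p * q * r)) + x2 * (n2 / (p * q)) - x1 * (n1 / p) + y =
       (n4 - x3 * n3 * t + x2 * n2 * (r * t) - x1 * n1 * (q * r * t) + y * (p * q * r * t)) / (p * q * r * t)"
      if "0 < p" "0 < q" "0 < r" "0 < t" for n1 n2 n3 n4 x1 x2 x3 y p q r t :: real
      using that by (simp add: divide_simps)
    ultimately show ?thesis by simp
  qed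
  \<comment> \<open>Each of the four factors of a product is multiplied by \<open>b\<close>, which clears the denominators \<open>1 / b\<close>.\<close>
  also have "\<dots> = (b^4 * (w * (w + 1) * (w + 2) * (w + 3)
     - 4 * z * (w * (w + 1) * (w + 2)) * (A + 3)
     + 6 * z^2 * (w * (w + 1)) * ((A + 2) * (A + 3)) - 4 * z^3 * w * ((A + 1) * (A + 2) * (A + 3))
     + z^4 * (A * (A + 1) * (A + 2) * (A + 3)))) / (b^4 * (A * (A + 1) * (A + 2) * (A + 3)))"
    using b by simp
  also have "b^4 * (w * (w + 1) * (w + 2) * (w + 3)
     - 4 * z * (w * (w + 1) * (w + 2)) * (A + 3)
     + 6 * z^2 * (w * (w + 1)) * ((A + 2) * (A + 3)) - 4 * z^3 * w * ((A + 1) * (A + 2) * (A + 3))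
     + z^4 * (A * (A + 1) * (A + 2) * (A + 3))) =
     (b*w) * (b*w + b) * (b*w + 2*b) * (b*w + 3*b)
     - 4 * z * ((b*w) * (b*w + b) * (b*w + 2*b)) * (b*A + 3*b)
     + 6 * z^2 * ((b*w) * (b*w + b)) * ((b*A + 2*b) * (b*A + 3*b)) - 4 * z^3 * (b*w) * ((b*A + b) * (b*A + 2*b) * (b*A + 3*b))
     + z^4 * (b*A * (b*A + b) * (b*A + 2*b) * (b*A + 3*b))"
    by algebra
  also have "b^4 * (A * (A + 1) * (A + 2) * (A + 3)) = b*A * (b*A + b) * (b*A + 2*b) * (b*A + 3*b)"
    by algebra
  also have "b * w = z + b" using b by (simp add: w_def algebra_simps)
  also have "b * A = 1 + b * D" using b by (simp add: A_def algebra_simps)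
  also have "(z + b) * (z + b + b) * (z + b + 2 * b) * (z + b + 3 * b)
     - 4 * z * ((z + b) * (z + b + b) * (z + b + 2 * b)) * (1 + b * D + 3 * b)
     + 6 * z^2 * ((z + b) * (z + b + b)) * ((1 + b * D + 2 * b) * (1 + b * D + 3 * b))
     - 4 * z^3 * (z + b) * ((1 + b * D + b) * (1 + b * D + 2 * b) * (1 + b * D + 3 * b))
     + z^4 * ((1 + b * D) * (1 + b * D + b) * (1 + b * D + 2 * b) * (1 + b * D + 3 * b)) = b\<^sup>2 * Q"
    unfolding Q_def by algebra
  finally show ?thesis by (simp add: algebra_simps)
qed

text \<open>
  The quotient \<open>Q\<close> is a continuous function of \<open>(b, s $ i)\<close> on the compact unit square; this is what makes
  the constant independent of \<open>s\<close>.
\<close>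
lemma kernel_measure_fourth_moment_le:
  "\<exists>C\<ge>0. \<forall>s::real ^ 'd. \<forall>b i. s \<in> open_simplex \<longrightarrow> 0 < b \<longrightarrow> b \<le> 1 \<longrightarrow>
     (LINT x|kernel_measure s b. (x $ i - s $ i) ^ 4) \<le> C * b\<^sup>2"
proof -
  define D where "D = real CARD('d) + 1"
  define Q where "Q = (\<lambda>(b::real, z::real). 3*z^2 - 6*z^3 + 3*z^4
    + b * (26*z - 72*z^2 - 20*z^2*D + 64*z^3 + 42*z^3*D + 6*z^3*D^2 - 18*z^4 - 22*z^4*D - 6*z^4*D^2)
    + b^2 * (24 - 72*z - 24*z*D + 72*z^2 + 60*z^2*D + 12*z^2*D^2 - 24*z^3 - 44*z^3*D - 24*z^3*D^2
       - 4*z^3*D^3 + 6*z^4*D + 11*z^4*D^2 + 6*z^4*D^3 + z^4*D^4))"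
  have "compact (Q ` ({0..1} \<times> {0..1}))"
    unfolding Q_def split_def by (intro compact_continuous_image continuous_intros compact_Times compact_Icc)
  then have "bounded (Q ` ({0..1} \<times> {0..1}))" by (rule compact_imp_bounded)
  then obtain C where "\<forall>y\<in>Q ` ({0..1} \<times> {0..1}). \<bar>y\<bar> \<le> C" unfolding bounded_real by blast
  then have C: "\<And>b z. b \<in> {0..1} \<Longrightarrow> z \<in> {0..1} \<Longrightarrow> \<bar>Q (b, z)\<bar> \<le> C" by blast
  have C0: "0 \<le> C" using C[of 0 0] by auto
  have "(LINT x|kernel_measure s b. (x $ i - s $ i) ^ 4) \<le> C * b\<^sup>2"
    if s: "s \<in> open_simplex" and b: "0 < b" "b \<le> 1" for s :: "real ^ 'd" and b i
  proof -
    let ?p = "(1 + b * D) * (1 + b * (D + 1)) * (1 + b * (D + 2)) * (1 + b * (D + 3))"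
    have D: "0 \<le> D" by (simp add: D_def)
    have p: "1 * 1 * 1 * 1 \<le> ?p" using b D by (intro mult_mono) auto
    have si: "s $ i \<in> {0..1}" using s open_simplex_subset by (auto simp: simplex_set_def)
    have "(LINT x|kernel_measure s b. (x $ i - s $ i) ^ 4) = b\<^sup>2 * Q (b, s $ i) / ?p"
      using kernel_measure_fourth_moment[OF s b(1), of i] unfolding D_def[symmetric] Q_def by simp
    also have "\<dots> \<le> \<bar>b\<^sup>2 * Q (b, s $ i)\<bar> / ?p" using p by (intro divide_right_mono) auto
    also have "\<dots> \<le> \<bar>b\<^sup>2 * Q (b, s $ i)\<bar> / 1" using p by (intro divide_left_mono) auto
    also have "\<dots> \<le> C * b\<^sup>2" using C[of b "s $ i"] b si
      by (simp add: abs_mult mult.commute[of "b\<^sup>2"] mult_right_mono)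
    finally show ?thesis .
  qed
  with C0 show ?thesis by blast
qed

lemma kernel_measure_second_moment_approx:
  "\<exists>C\<ge>0. \<forall>s::real ^ 'd. \<forall>b i j. s \<in> open_simplex \<longrightarrow> 0 < b \<longrightarrow> b \<le> 1 \<longrightarrow>
     \<bar>(LINT x|kernel_measure s b. (x $ i - s $ i) * (x $ j - s $ j)) -
       b * (s $ i * ((if i = j then 1 else 0) - s $ j))\<bar> \<le> C * b\<^sup>2"
proof -
  define D where "D = real CARD('d) + 1"
  have D: "1 \<le> D" by (simp add: D_def)
  define C where "C = 2 + (D + 1) * 2 + D * (D + 1) * 1 + 1 * (2 * D + 1 + D * (D + 1))"
  have "0 \<le> C" using D by (simp add: C_def)
  moreover have "\<bar>(LINT x|kernel_measure s b. (x $ i - s $ i) * (x $ j - s $ j)) -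
       b * (s $ i * ((if i = j then 1 else 0) - s $ j))\<bar> \<le> C * b\<^sup>2"
    if s: "s \<in> open_simplex" and b: "0 < b" "b \<le> 1" for s :: "real ^ 'd" and b i j
  proof -
    define p where "p = (1 + b * D) * (1 + b * (D + 1))"
    define a where "a = s $ i * ((if i = j then 1 else 0) - s $ j)"
    define q where "q = 1 + (if i = j then 1 else 0) - (D + 1) * (s $ i + s $ j) + D * (D + 1) * (s $ i * s $ j)"
    define e where "e = 2 * D + 1 + b * (D * (D + 1))"
    have sij: "0 \<le> s $ i" "s $ i \<le> 1" "0 \<le> s $ j" "s $ j \<le> 1"
      using s open_simplex_subset simplex_coordinate_bounds by blast+
    have "1 * 1 \<le> p" unfolding p_def using b D by (intro mult_mono) auto
    then have p: "1 \<le> p" by simp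
    have pe: "p = 1 + b * e" by (simp add: p_def e_def algebra_simps)
    have ss: "s $ i * s $ j \<le> 1" using sij by (simp add: mult_le_one)
    have "\<bar>q\<bar> \<le> \<bar>1 + (if i = j then 1 else 0)\<bar> + \<bar>(D + 1) * (s $ i + s $ j)\<bar> + \<bar>D * (D + 1) * (s $ i * s $ j)\<bar>"
      unfolding q_def by linarith
    also have "\<dots> \<le> 2 + (D + 1) * 2 + D * (D + 1) * 1"
      unfolding abs_mult using sij D ss by (intro add_mono mult_mono) auto
    finally have q: "\<bar>q\<bar> \<le> 2 + (D + 1) * 2 + D * (D + 1) * 1" .
    have "\<bar>a\<bar> \<le> 1 * 1" unfolding a_def abs_mult using sij by (intro mult_mono) auto
    moreover have "\<bar>e\<bar> \<le> 2 * D + 1 + D * (D + 1)"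
      using b D by (simp add: e_def mult_left_le_one_le)
    ultimately have ae: "\<bar>a * e\<bar> \<le> 1 * (2 * D + 1 + D * (D + 1))"
      unfolding abs_mult by (intro mult_mono) auto
    have "(LINT x|kernel_measure s b. (x $ i - s $ i) * (x $ j - s $ j)) - b * a = (b * a + b\<^sup>2 * q) / p - b * a"
      using kernel_measure_second_moment[OF s b(1), of i j] unfolding D_def[symmetric] a_def q_def p_def by simp
    also have "\<dots> = b\<^sup>2 * (q - a * e) / p"
      using p by (simp add: field_simps) (simp add: pe algebra_simps power2_eq_square)
    finally have "\<bar>(LINT x|kernel_measure s b. (x $ i - s $ i) * (x $ j - s $ j)) - b * a\<bar> = b\<^sup>2 * \<bar>q - a * e\<bar> / p"
      using p by (simp add: abs_mult)
    also have "\<dots> \<le> b\<^sup>2 * \<bar>q - a * e\<bar> / 1" using p by (intro divide_left_mono) auto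
    also have "\<dots> \<le> C * b\<^sup>2" using q ae unfolding C_def
      by (simp add: mult.commute[of "b\<^sup>2"] del: abs_mult) (intro mult_right_mono, linarith, simp)
    finally show ?thesis by (simp add: a_def)
  qed
  ultimately show ?thesis by blast
qed

lemma kernel_measure_mean_approx:
  "\<exists>C\<ge>0. \<forall>s::real ^ 'd. \<forall>b i. s \<in> open_simplex \<longrightarrow> 0 < b \<longrightarrow>
     \<bar>(LINT x|kernel_measure s b. x $ i - s $ i) - b * (1 - (real CARD('d) + 1) * s $ i)\<bar> \<le> C * b\<^sup>2"
proof -
  define D where "D = real CARD('d) + 1"
  have D: "1 \<le> D" by (simp add: D_def)
  have "\<bar>(LINT x|kernel_measure s b. x $ i - s $ i) - b * (1 - D * s $ i)\<bar> \<le> ((1 + D) * D) * b\<^sup>2"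
    if s: "s \<in> open_simplex" and b: "0 < b" for s :: "real ^ 'd" and b i
  proof -
    let ?m = "1 - D * s $ i"
    have si: "0 \<le> s $ i" "s $ i \<le> 1" using s open_simplex_subset simplex_coordinate_bounds by blast+
    then have "0 \<le> D * s $ i" "D * s $ i \<le> D" using D by (auto simp: mult_left_le)
    then have m: "\<bar>?m\<bar> \<le> 1 + D" by linarith
    have p: "1 \<le> 1 + b * D" using b D by simp
    have "(LINT x|kernel_measure s b. x $ i - s $ i) - b * ?m = b * ?m / (1 + b * D) - b * ?m"
      using kernel_measure_mean[OF s b, of i] by (simp add: D_def)
    also have "\<dots> = - (b\<^sup>2 * (?m * D) / (1 + b * D))"
      using p by (simp add: field_simps power2_eq_square)
    finally have "\<bar>(LINT x|kernel_measure s b. x $ i - s $ i) - b * ?m\<bar> = b\<^sup>2 * (\<bar>?m\<bar> * D) / (1 + b * D)"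
      using p D by (simp add: abs_mult)
    also have "\<dots> \<le> b\<^sup>2 * (\<bar>?m\<bar> * D) / 1" using p D by (intro divide_left_mono) auto
    also have "\<dots> \<le> ((1 + D) * D) * b\<^sup>2" using m D
      by (simp add: mult.commute[of "b\<^sup>2"] mult_right_mono)
    finally show ?thesis .
  qed
  moreover have "0 \<le> (1 + D) * D" using D by simp
  ultimately show ?thesis unfolding D_def by blast
qed

section \<open>Taylor's formula and the bias\<close>

text \<open>
  On the segment from \<open>s\<close> to \<open>x\<close> only the quadratic form \<open>h \<mapsto> f'' s h h\<close> enters, so the mean value theorem
  in one real variable suffices. The derivatives are relative to \<open>S\<close>, which covers boundary points.
\<close>
lemma taylor_second_order_convex:
  fixes f :: "'v::real_normed_vector \<Rightarrow> real"
    and f' :: "'v \<Rightarrow> 'v \<Rightarrow>\<^sub>L real" and f'' :: "'v \<Rightarrow> 'v \<Rightarrow>\<^sub>L 'v \<Rightarrow>\<^sub>L real"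
  assumes S: "convex S"
    and f': "\<And>y. y \<in> S \<Longrightarrow> (f has_derivative f' y) (at y within S)"
    and f'': "\<And>y. y \<in> S \<Longrightarrow> (f' has_derivative f'' y) (at y within S)"
    and s: "s \<in> S" and x: "x \<in> S"
    and e: "\<And>y. y \<in> closed_segment s x \<Longrightarrow> norm (f'' y - f'' s) \<le> e"
  shows "\<bar>f x - f s - f' s (x - s) - f'' s (x - s) (x - s) / 2\<bar> \<le> e * (norm (x - s))\<^sup>2"
proof -
  let ?L = "closed_segment s x" and ?h = "x - s"
  have e0: "0 \<le> e" using e[of s] by simp
  have L: "?L \<subseteq> S" by (rule closed_segment_subset[OF s x S])
  have pt: "s + t *\<^sub>R ?h \<in> ?L" if "t \<in> {0..1}" for t
    using that by (auto simp: closed_segment_def algebra_simps intro!: exI[of _ t])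
  have lin: "norm (f' (s + t *\<^sub>R ?h) - f' s - f'' s (t *\<^sub>R ?h)) \<le> norm ?h * e" if t: "t \<in> {0..1}" for t
  proof -
    have "norm (f' (s + t *\<^sub>R ?h) - f' s - f'' s (s + t *\<^sub>R ?h - s)) \<le> norm (s + t *\<^sub>R ?h - s) * e"
    proof (rule differentiable_bound_linearization[where S = ?L])
      fix r :: real assume "r \<in> {0..1}"
      then have "r * t \<in> {0..1}" using t by (auto simp: mult_le_one)
      from pt[OF this] show "s + r *\<^sub>R (s + t *\<^sub>R ?h - s) \<in> ?L" by simp
    next
      fix y assume "y \<in> ?L"
      then show "(f' has_derivative blinfun_apply (f'' y)) (at y within ?L)"
        using f'' L by (blast intro: has_derivative_subset)
    next
      fix y assume "y \<in> ?L"
      then show "onorm (blinfun_apply (f'' y) - blinfun_apply (f'' s)) \<le> e"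
        using e by (simp add: norm_blinfun.rep_eq minus_blinfun.rep_eq fun_diff_def)
    qed simp
    also have "\<dots> \<le> norm ?h * e"
      using t e0 by (intro mult_right_mono) (auto simp: mult_left_le_one_le)
    finally show ?thesis by simp
  qed
  define \<psi> where "\<psi> t = f (s + t *\<^sub>R ?h) - t * f' s ?h - t\<^sup>2 / 2 * f'' s ?h ?h" for t :: real
  have der: "(\<psi> has_derivative (\<lambda>r. r * (f' (s + t *\<^sub>R ?h) ?h - f' s ?h - t * f'' s ?h ?h))) (at t within {0..1})"
    if t: "0 \<le> t" "t \<le> 1" for t
  proof -
    have "((\<lambda>t. f (s + t *\<^sub>R ?h)) has_derivative (\<lambda>r. f' (s + t *\<^sub>R ?h) (r *\<^sub>R ?h))) (at t within {0..1})"
    proof (rule has_derivative_in_compose2[where g = f and t = S])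
      show "(f has_derivative blinfun_apply (f' y)) (at y within S)" if "y \<in> S" for y by (rule f'[OF that])
      show "(\<lambda>t. s + t *\<^sub>R ?h) ` {0..1} \<subseteq> S" using pt L by blast
      show "((\<lambda>t. s + t *\<^sub>R ?h) has_derivative (\<lambda>r. r *\<^sub>R ?h)) (at t within {0..1})"
        by (auto intro!: derivative_eq_intros)
    qed (use t in auto)
    then show ?thesis unfolding \<psi>_def
      by (auto intro!: derivative_eq_intros simp: blinfun.scaleR_right right_diff_distrib mult_ac)
  qed
  obtain t where t: "t \<in> {0<..<1}"
    and mvt: "\<psi> 1 - \<psi> 0 = (1 - 0) * (f' (s + t *\<^sub>R ?h) ?h - f' s ?h - t * f'' s ?h ?h)"
    using mvt_simple[of 0 1 \<psi>, OF _ der] by auto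
  have "f x - f s - f' s ?h - f'' s ?h ?h / 2 = \<psi> 1 - \<psi> 0" by (simp add: \<psi>_def)
  also have "\<dots> = (f' (s + t *\<^sub>R ?h) - f' s - f'' s (t *\<^sub>R ?h)) ?h"
    using mvt by (simp add: blinfun.diff_left blinfun.scaleR_right blinfun.scaleR_left)
  also have "\<bar>\<dots>\<bar> \<le> norm (f' (s + t *\<^sub>R ?h) - f' s - f'' s (t *\<^sub>R ?h)) * norm ?h"
    using norm_blinfun[of "f' (s + t *\<^sub>R ?h) - f' s - f'' s (t *\<^sub>R ?h)" ?h] by simp
  also have "\<dots> \<le> (norm ?h * e) * norm ?h"
    using lin[of t] t by (intro mult_right_mono) auto
  finally show ?thesis by (simp add: power2_eq_square mult_ac)
qed

text \<open>
  Points \<open>x\<close> near \<open>s\<close> are covered by the modulus of continuity of \<open>f''\<close>; for the others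
  \<open>(norm (x - s))\<^sup>2\<close> is at most a multiple of \<open>norm (x - s) ^ 4\<close>.
\<close>
lemma taylor_second_order_compact_convex:
  fixes f :: "'v::real_normed_vector \<Rightarrow> real"
    and f' :: "'v \<Rightarrow> 'v \<Rightarrow>\<^sub>L real" and f'' :: "'v \<Rightarrow> 'v \<Rightarrow>\<^sub>L 'v \<Rightarrow>\<^sub>L real"
  assumes S: "convex S" "compact S"
    and f': "\<And>y. y \<in> S \<Longrightarrow> (f has_derivative f' y) (at y within S)"
    and f'': "\<And>y. y \<in> S \<Longrightarrow> (f' has_derivative f'' y) (at y within S)"
    and cont: "continuous_on S f''"
    and e: "0 < e"
  obtains C where "0 \<le> C" "\<And>s x. s \<in> S \<Longrightarrow> x \<in> S \<Longrightarrow>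
    \<bar>f x - f s - f' s (x - s) - f'' s (x - s) (x - s) / 2\<bar> \<le> e * (norm (x - s))\<^sup>2 + C * (norm (x - s)) ^ 4"
proof -
  have "uniformly_continuous_on S f''" using cont S(2) by (rule compact_uniformly_continuous)
  then obtain d where d: "0 < d" "\<And>y z. y \<in> S \<Longrightarrow> z \<in> S \<Longrightarrow> dist y z < d \<Longrightarrow> dist (f'' y) (f'' z) < e"
    using e unfolding uniformly_continuous_on_def by metis
  have "bounded (f'' ` S)" using compact_continuous_image[OF cont S(2)] by (rule compact_imp_bounded)
  then obtain B where B: "0 < B" "\<And>y. y \<in> S \<Longrightarrow> norm (f'' y) \<le> B" unfolding bounded_pos by blast
  show ?thesis
  proof
    show "0 \<le> 2 * B / d\<^sup>2" using B by simp
    fix s x assume s: "s \<in> S" and x: "x \<in> S"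
    have L: "closed_segment s x \<subseteq> S" by (rule closed_segment_subset[OF s x S(1)])
    let ?n = "norm (x - s)"
    show "\<bar>f x - f s - f' s (x - s) - f'' s (x - s) (x - s) / 2\<bar> \<le> e * ?n\<^sup>2 + 2 * B / d\<^sup>2 * ?n ^ 4"
    proof (cases "?n < d")
      case True
      have "\<bar>f x - f s - f' s (x - s) - f'' s (x - s) (x - s) / 2\<bar> \<le> e * ?n\<^sup>2"
      proof (rule taylor_second_order_convex[OF S(1) f' f'' s x])
        fix y assume y: "y \<in> closed_segment s x"
        then obtain t where t: "0 \<le> t" "t \<le> 1" "y = (1 - t) *\<^sub>R s + t *\<^sub>R x" by (auto simp: closed_segment_def)
        then have "y - s = t *\<^sub>R (x - s)" by (simp add: algebra_simps)
        then have "dist y s \<le> dist s x" using t by (simp add: dist_norm norm_minus_commute mult_left_le_one_le)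
        then show "norm (f'' y - f'' s) \<le> e"
          using d(2)[of y s] y L s True by (auto simp: dist_norm norm_minus_commute)
      qed
      also have "\<dots> \<le> e * ?n\<^sup>2 + 2 * B / d\<^sup>2 * ?n ^ 4" using B by simp
      finally show ?thesis .
    next
      case False
      have "\<bar>f x - f s - f' s (x - s) - f'' s (x - s) (x - s) / 2\<bar> \<le> (2 * B) * ?n\<^sup>2"
      proof (rule taylor_second_order_convex[OF S(1) f' f'' s x])
        fix y assume y: "y \<in> closed_segment s x"
        have "norm (f'' y - f'' s) \<le> norm (f'' y) + norm (f'' s)" by (rule norm_triangle_ineq4)
        also have "\<dots> \<le> 2 * B" using B(2)[of y] B(2)[of s] y L s by auto
        finally show "norm (f'' y - f'' s) \<le> 2 * B" .
      qed
      also have "\<dots> = 2 * B / d\<^sup>2 * (d\<^sup>2 * ?n\<^sup>2)" using d(1) by simp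
      also have "\<dots> \<le> 2 * B / d\<^sup>2 * (?n\<^sup>2 * ?n\<^sup>2)"
        using False d(1) B by (intro mult_left_mono mult_right_mono power_mono) auto
      also have "?n\<^sup>2 * ?n\<^sup>2 = ?n ^ 4" by (simp add: power2_eq_square power4_eq_xxxx)
      also have "2 * B / d\<^sup>2 * ?n ^ 4 \<le> e * ?n\<^sup>2 + 2 * B / d\<^sup>2 * ?n ^ 4" using e by simp
      finally show ?thesis .
    qed
  qed
qed

lemma blinfun_eq_sum_axis:
  fixes g :: "(real ^ 'd) \<Rightarrow>\<^sub>L 'w::real_normed_vector"
  shows "g h = (\<Sum>i\<in>UNIV. (h $ i) *\<^sub>R g (axis i 1))"
proof -
  have "h = (\<Sum>i\<in>UNIV. (h $ i) *\<^sub>R axis i 1)"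
    by (simp add: vec_eq_iff axis_def if_distrib[of "\<lambda>x. _ * x"] cong: if_cong)
  then have "g h = g (\<Sum>i\<in>UNIV. (h $ i) *\<^sub>R axis i 1)" by simp
  then show ?thesis by (simp add: blinfun.sum_right blinfun.scaleR_right)
qed

lemma partial_deriv_eq:
  fixes s :: "real ^ 'd"
  assumes f': "(f has_derivative f') (at s)"
  shows "partial_deriv i f s = f' (axis i 1)"
proof -
  have "((\<lambda>t. s + t *\<^sub>R axis i 1) has_derivative (\<lambda>t. t *\<^sub>R axis i (1::real))) (at (0::real))"
    by (auto intro!: derivative_eq_intros)
  moreover have "(f has_derivative f') (at (s + 0 *\<^sub>R axis i 1))" using f' by simp
  ultimately have "((\<lambda>t. f (s + t *\<^sub>R axis i 1)) has_derivative (\<lambda>t. f' (t *\<^sub>R axis i (1::real)))) (at (0::real))"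
    by (rule has_derivative_compose)
  then have "((\<lambda>t. f (s + t *\<^sub>R axis i 1)) has_real_derivative f' (axis i 1)) (at 0)"
    using linear_scale[OF has_derivative_linear[OF f']]
    by (simp add: has_field_derivative_def mult_commute_abs)
  then show ?thesis unfolding partial_deriv_def by (rule DERIV_imp_deriv)
qed

text \<open>
  At interior points the derivatives relative to the closed simplex are ordinary derivatives, so the
  iterated partial derivatives are entries of \<open>f''\<close>.
\<close>
lemma bias_coeff_eq:
  fixes s :: "real ^ 'd"
  assumes f': "\<And>x. x \<in> simplex_set \<Longrightarrow> (f has_derivative blinfun_apply (f' x)) (at x within simplex_set)"
    and f'': "\<And>x. x \<in> simplex_set \<Longrightarrow> (f' has_derivative blinfun_apply (f'' x)) (at x within simplex_set)"
    and s: "s \<in> open_simplex"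
  shows "bias_coeff f s = (\<Sum>i\<in>UNIV. (1 - (real CARD('d) + 1) * s $ i) * f' s (axis i 1)) +
     1 / 2 * (\<Sum>i\<in>UNIV. \<Sum>j\<in>UNIV.
       s $ i * ((if i = j then 1 else 0) - s $ j) * f'' s (axis i 1) (axis j 1))"
proof -
  have int: "at x within simplex_set = at x" if "x \<in> open_simplex" for x :: "real ^ 'd"
    using at_within_open_subset[OF that open_open_simplex open_simplex_subset] .
  have pd: "partial_deriv j f x = f' x (axis j 1)" if "x \<in> open_simplex" for x j
    using f'[of x] that open_simplex_subset int[OF that] by (intro partial_deriv_eq) auto
  have "partial_deriv i (partial_deriv j f) s = f'' s (axis i 1) (axis j 1)" for i j
  proof -
    have "((\<lambda>x. f' x (axis j 1)) has_derivative (\<lambda>h. f'' s h (axis j 1))) (at s)"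
      using f''[of s] s open_simplex_subset int[OF s]
      by (intro bounded_linear.has_derivative[OF blinfun.bounded_linear_left]) auto
    then have "(partial_deriv j f has_derivative (\<lambda>h. f'' s h (axis j 1))) (at s)"
      by (rule has_derivative_transform_within_open[OF _ open_open_simplex s]) (simp add: pd)
    then show ?thesis by (rule partial_deriv_eq)
  qed
  then show ?thesis using pd[OF s] by (simp add: bias_coeff_def)
qed

lemma norm_squared_eq_sum: "(norm (x :: real ^ 'd))\<^sup>2 = (\<Sum>i\<in>UNIV. (x $ i)\<^sup>2)"
  by (simp add: norm_vec_def L2_set_def sum_nonneg)

lemma norm_power4_le_sum: "(norm (x :: real ^ 'd)) ^ 4 \<le> real CARD('d) * (\<Sum>i\<in>UNIV. (x $ i) ^ 4)"
proof -
  have "(norm x) ^ 4 = ((norm x)\<^sup>2)\<^sup>2" by simp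
  also have "\<dots> \<le> (\<Sum>i\<in>UNIV. ((x $ i)\<^sup>2)\<^sup>2) * real CARD('d)"
    unfolding norm_squared_eq_sum by (rule sum_squared_le_sum_of_squares)
  finally show ?thesis by (simp add: mult.commute)
qed

lemma integrable_kernel_centered:
  fixes s :: "real ^ 'd"
  assumes s: "s \<in> open_simplex" and b: "0 < b"
  shows "integrable (kernel_measure s b) (\<lambda>x. (x $ i - s $ i) ^ k)"
    and "integrable (kernel_measure s b) (\<lambda>x. (x $ i - s $ i) * (x $ j - s $ j))"
proof -
  have 1: "\<bar>x $ i - s $ i\<bar> \<le> 1" if "x \<in> open_simplex" for x :: "real ^ 'd" and i
  proof -
    have "0 \<le> x $ i" "x $ i \<le> 1" "0 \<le> s $ i" "s $ i \<le> 1"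
      using that s open_simplex_subset simplex_coordinate_bounds by blast+
    then show ?thesis by auto
  qed
  show "integrable (kernel_measure s b) (\<lambda>x. (x $ i - s $ i) ^ k)"
    by (rule integrable_kernel_measure[OF s b, where B = 1]) (use 1 in \<open>auto simp: power_abs power_le_one\<close>)
  show "integrable (kernel_measure s b) (\<lambda>x. (x $ i - s $ i) * (x $ j - s $ j))"
    by (rule integrable_kernel_measure[OF s b, where B = 1]) (use 1 in \<open>auto simp: abs_mult mult_le_one\<close>)
qed

lemma bounded_on_simplex:
  fixes F :: "real ^ 'd \<Rightarrow> 'w::real_normed_vector"
  assumes "continuous_on simplex_set F"
  obtains B where "0 < B" "\<And>y. y \<in> simplex_set \<Longrightarrow> norm (F y) \<le> B"
proof -
  have "bounded (F ` simplex_set)"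
    using compact_continuous_image[OF assms compact_simplex_set] by (rule compact_imp_bounded)
  then show ?thesis using that unfolding bounded_pos by blast
qed

text \<open>
  Integrating the Taylor polynomial at \<open>s\<close> turns the first two moments of the kernel measure into
  \<open>b * bias_coeff f s\<close> up to order \<open>b\<^sup>2\<close>. The remainder contributes at most a small multiple of the second
  moment, which has order \<open>b\<close>, plus a multiple of the fourth moment, which has order \<open>b\<^sup>2\<close>. All
  constants come from suprema over the compact simplex, so nothing depends on \<open>s\<close>.
\<close>
lemma kernel_measure_bias:
  fixes f :: "real ^ 'd \<Rightarrow> real"
  assumes smooth: "twice_cont_diff_on f simplex_set"
    and [measurable]: "f \<in> borel_measurable borel"
    and e: "0 < e"
  shows "\<exists>b0>0. \<forall>b s. 0 < b \<longrightarrow> b < b0 \<longrightarrow> s \<in> open_simplex \<longrightarrow>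
    \<bar>(LINT x|kernel_measure s b. f x) - f s - b * bias_coeff f s\<bar> \<le> e * b"
proof -
  let ?d = "real CARD('d)"
  obtain f' f'' where f': "\<And>x. x \<in> simplex_set \<Longrightarrow> (f has_derivative blinfun_apply (f' x)) (at x within simplex_set)"
    and f'': "\<And>x. x \<in> simplex_set \<Longrightarrow> (f' has_derivative blinfun_apply (f'' x)) (at x within simplex_set)"
    and cont: "continuous_on simplex_set f''"
    using smooth unfolding twice_cont_diff_on_def by blast
  have cont0: "continuous_on simplex_set f" and cont1: "continuous_on simplex_set f'"
    using f' f'' has_derivative_continuous continuous_on_eq_continuous_within by blast+
  obtain B0 where B0: "0 < B0" "\<And>y. y \<in> simplex_set \<Longrightarrow> norm (f y) \<le> B0" using bounded_on_simplex[OF cont0] by blast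
  obtain B1 where B1: "0 < B1" "\<And>y. y \<in> simplex_set \<Longrightarrow> norm (f' y) \<le> B1" using bounded_on_simplex[OF cont1] by blast
  obtain B2 where B2: "0 < B2" "\<And>y. y \<in> simplex_set \<Longrightarrow> norm (f'' y) \<le> B2" using bounded_on_simplex[OF cont] by blast
  obtain C1 where C1: "0 \<le> C1" "\<And>(s :: real ^ 'd) b i. s \<in> open_simplex \<Longrightarrow> 0 < b \<Longrightarrow>
     \<bar>(LINT x|kernel_measure s b. x $ i - s $ i) - b * (1 - (?d + 1) * s $ i)\<bar> \<le> C1 * b\<^sup>2"
    using kernel_measure_mean_approx[where 'd = 'd] by blast
  obtain C2 where C2: "0 \<le> C2" "\<And>(s :: real ^ 'd) b i j. s \<in> open_simplex \<Longrightarrow> 0 < b \<Longrightarrow> b \<le> 1 \<Longrightarrow>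
     \<bar>(LINT x|kernel_measure s b. (x $ i - s $ i) * (x $ j - s $ j)) -
       b * (s $ i * ((if i = j then 1 else 0) - s $ j))\<bar> \<le> C2 * b\<^sup>2"
    using kernel_measure_second_moment_approx[where 'd = 'd] by blast
  obtain C4 where C4: "0 \<le> C4" "\<And>(s :: real ^ 'd) b i. s \<in> open_simplex \<Longrightarrow> 0 < b \<Longrightarrow> b \<le> 1 \<Longrightarrow>
     (LINT x|kernel_measure s b. (x $ i - s $ i) ^ 4) \<le> C4 * b\<^sup>2"
    using kernel_measure_fourth_moment_le[where 'd = 'd] by blast
  \<comment> \<open>The sum of the second moments over the coordinates is at most \<open>?d * (1 + C2) * b\<close>; \<open>e'\<close> leaves half of \<open>e\<close>.\<close>
  define e' where "e' = e / 2 / (?d * (1 + C2))"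
  have e'd: "e' * (?d * (1 + C2)) = e / 2" using C2(1) by (simp add: e'_def add_nonneg_eq_0_iff)
  have e': "0 < e'" using e C2(1) by (simp add: e'_def)
  obtain CT where CT: "0 \<le> CT" "\<And>s x. s \<in> simplex_set \<Longrightarrow> x \<in> simplex_set \<Longrightarrow>
    \<bar>f x - f s - f' s (x - s) - f'' s (x - s) (x - s) / 2\<bar> \<le> e' * (norm (x - s))\<^sup>2 + CT * (norm (x - s)) ^ 4"
    using taylor_second_order_compact_convex[OF convex_simplex_set compact_simplex_set f' f'' cont e'] by blast
  define K where "K = CT * ?d * (?d * C4) + ?d * (C1 * B1) + ?d * (?d * (C2 * B2)) / 2"
  have K: "0 \<le> K" using CT C1 C2 C4 B1 B2 by (simp add: K_def)
  define b0 where "b0 = min 1 (e / (2 * (K + 1)))"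
  have b0: "0 < b0" using e K by (simp add: b0_def)
  have "\<bar>(LINT x|kernel_measure s b. f x) - f s - b * bias_coeff f s\<bar> \<le> e * b"
    if b: "0 < b" "b < b0" and s: "s \<in> open_simplex" for b s
  proof -
    have b1: "b \<le> 1" using b by (simp add: b0_def)
    have sS: "s \<in> simplex_set" using s open_simplex_subset by blast
    interpret prob_space "kernel_measure s b" by (rule prob_space_kernel_measure[OF s b(1)])
    note cent = integrable_kernel_centered[OF s b(1)]
    note cent1 = integrable_kernel_centered(1)[OF s b(1), where k = 1, simplified]
    have intf: "integrable (kernel_measure s b) f"
      by (rule integrable_kernel_measure[OF s b(1), where B = B0]) (use B0(2) open_simplex_subset in auto)
    define a where "a i = f' s (axis i 1)" for i
    define A where "A i j = f'' s (axis i 1) (axis j 1)" for i j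
    have a: "\<bar>a i\<bar> \<le> B1" for i
      using norm_blinfun[of "f' s" "axis i 1"] B1(2)[OF sS] by (simp add: a_def)
    have A: "\<bar>A i j\<bar> \<le> B2" for i j
      using norm_blinfun[of "f'' s (axis i 1)" "axis j 1"] norm_blinfun[of "f'' s" "axis i 1"] B2(2)[OF sS] by (simp add: A_def)
    define T where "T x = f s + (\<Sum>i\<in>UNIV. (x $ i - s $ i) * a i) +
      (\<Sum>i\<in>UNIV. \<Sum>j\<in>UNIV. ((x $ i - s $ i) * (x $ j - s $ j)) * A i j) / 2" for x
    have T: "T x = f s + f' s (x - s) + f'' s (x - s) (x - s) / 2" for x
    proof -
      have "f'' s (x - s) (x - s) = (\<Sum>i\<in>UNIV. (x $ i - s $ i) * f'' s (axis i 1) (x - s))"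
        by (subst (1) blinfun_eq_sum_axis) (simp add: blinfun.sum_left blinfun.scaleR_left)
      also have "\<dots> = (\<Sum>i\<in>UNIV. \<Sum>j\<in>UNIV. ((x $ i - s $ i) * (x $ j - s $ j)) * A i j)"
        unfolding A_def
        by (subst blinfun_eq_sum_axis[of "f'' s (axis _ 1)"]) (simp add: sum_distrib_left mult.assoc)
      finally have 2: "f'' s (x - s) (x - s) = \<dots>" .
      have 1: "f' s (x - s) = (\<Sum>i\<in>UNIV. (x $ i - s $ i) * a i)"
        unfolding a_def by (subst blinfun_eq_sum_axis) simp
      show ?thesis unfolding 1 2 T_def ..
    qed
    have intT: "integrable (kernel_measure s b) T"
      unfolding T_def using cent cent1 by (intro Bochner_Integration.integrable_add Bochner_Integration.integrable_sum integrable_mult_left Bochner_Integration.integrable_divide integrable_const) auto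
    have ET: "(LINT x|kernel_measure s b. T x) = f s + (\<Sum>i\<in>UNIV. (LINT x|kernel_measure s b. x $ i - s $ i) * a i) +
      (\<Sum>i\<in>UNIV. \<Sum>j\<in>UNIV. (LINT x|kernel_measure s b. (x $ i - s $ i) * (x $ j - s $ j)) * A i j) / 2"
      unfolding T_def using cent cent1
      by (simp add: Bochner_Integration.integrable_sum integrable_mult_left Bochner_Integration.integral_sum prob_space[simplified] del: Bochner_Integration.integral_diff)
    define V where "V x = e' * (\<Sum>i\<in>UNIV. (x $ i - s $ i)\<^sup>2) + CT * (?d * (\<Sum>i\<in>UNIV. (x $ i - s $ i) ^ 4))" for x
    have intV: "integrable (kernel_measure s b) V"
      unfolding V_def using cent by (intro Bochner_Integration.integrable_add Bochner_Integration.integrable_sum integrable_mult_right) auto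
    have V: "\<bar>f x - T x\<bar> \<le> V x" if x: "x \<in> open_simplex" for x
    proof -
      have "\<bar>f x - T x\<bar> \<le> e' * (norm (x - s))\<^sup>2 + CT * (norm (x - s)) ^ 4"
        using CT(2)[OF sS, of x] x open_simplex_subset unfolding T by (auto simp: algebra_simps)
      also have "\<dots> \<le> V x"
        unfolding V_def using norm_power4_le_sum[of "x - s"] CT(1) e'
        by (intro add_mono mult_left_mono) (auto simp: norm_squared_eq_sum)
      finally show ?thesis .
    qed
    have AE: "AE x in kernel_measure s b. x \<in> open_simplex"
      unfolding kernel_measure_def by (rule AE_dirichlet_in_simplex)
    have "\<bar>(LINT x|kernel_measure s b. f x) - (LINT x|kernel_measure s b. T x)\<bar> =
      \<bar>LINT x|kernel_measure s b. f x - T x\<bar>" using intf intT by simp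
    also have "\<dots> \<le> (LINT x|kernel_measure s b. \<bar>f x - T x\<bar>)" by (rule integral_abs_bound)
    also have "\<dots> \<le> (LINT x|kernel_measure s b. V x)"
      using intf intT intV AE V by (intro integral_mono_AE) (auto elim!: eventually_mono)
    also have "\<dots> = e' * (\<Sum>i\<in>UNIV. (LINT x|kernel_measure s b. (x $ i - s $ i)\<^sup>2)) +
      CT * (?d * (\<Sum>i\<in>UNIV. (LINT x|kernel_measure s b. (x $ i - s $ i) ^ 4)))"
      unfolding V_def using cent by (simp add: Bochner_Integration.integrable_sum Bochner_Integration.integral_sum)
    also have "\<dots> \<le> e' * (\<Sum>i\<in>(UNIV::'d set). (1 + C2) * b) + CT * (?d * (\<Sum>i\<in>(UNIV::'d set). C4 * b\<^sup>2))"
    proof (intro add_mono mult_left_mono sum_mono)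
      fix i
      have "0 \<le> s $ i" "s $ i \<le> 1" using sS simplex_coordinate_bounds by blast+
      then have "b * (s $ i * (1 - s $ i)) \<le> b * 1" using b by (intro mult_left_mono mult_le_one) auto
      moreover have "C2 * b\<^sup>2 \<le> C2 * b" using b b1 C2(1) by (intro mult_left_mono) (auto simp: power2_eq_square)
      ultimately show "(LINT x|kernel_measure s b. (x $ i - s $ i)\<^sup>2) \<le> (1 + C2) * b"
        using C2(2)[OF s b(1) b1, of i i] by (simp add: power2_eq_square algebra_simps)
    qed (use e' CT C4(2)[OF s b(1) b1] in auto)
    also have "\<dots> = (e' * (?d * (1 + C2))) * b + CT * ?d * (?d * C4) * b\<^sup>2"
      by (simp add: algebra_simps)
    also have "\<dots> = e / 2 * b + CT * ?d * (?d * C4) * b\<^sup>2" unfolding e'd ..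
    finally have 1: "\<bar>(LINT x|kernel_measure s b. f x) - (LINT x|kernel_measure s b. T x)\<bar> \<le> e / 2 * b + CT * ?d * (?d * C4) * b\<^sup>2" .
    have g: "bias_coeff f s = (\<Sum>i\<in>UNIV. (1 - (?d + 1) * s $ i) * a i) +
     1 / 2 * (\<Sum>i\<in>UNIV. \<Sum>j\<in>UNIV. s $ i * ((if i = j then 1 else 0) - s $ j) * A i j)"
      unfolding a_def A_def by (rule bias_coeff_eq[OF f' f'' s])
    have lin: "(c + (\<Sum>i\<in>UNIV. m i * a i) + (\<Sum>i\<in>UNIV. \<Sum>j\<in>UNIV. M i j * A i j) / 2) - c -
        b * ((\<Sum>i\<in>UNIV. l i * a i) + 1 / 2 * (\<Sum>i\<in>UNIV. \<Sum>j\<in>UNIV. L i j * A i j)) =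
        (\<Sum>i\<in>UNIV. (m i - b * l i) * a i) + (\<Sum>i\<in>UNIV. \<Sum>j\<in>UNIV. (M i j - b * L i j) * A i j) / 2"
      for c m l M L
      by (simp add: left_diff_distrib sum_subtractf distrib_left diff_divide_distrib mult.assoc sum_distrib_left[symmetric])
    have eq: "(LINT x|kernel_measure s b. T x) - f s - b * bias_coeff f s =
      (\<Sum>i\<in>UNIV. ((LINT x|kernel_measure s b. x $ i - s $ i) - b * (1 - (?d + 1) * s $ i)) * a i) +
      (\<Sum>i\<in>UNIV. \<Sum>j\<in>UNIV. ((LINT x|kernel_measure s b. (x $ i - s $ i) * (x $ j - s $ j)) -
         b * (s $ i * ((if i = j then 1 else 0) - s $ j))) * A i j) / 2"
      unfolding ET g by (rule lin)
    have "\<bar>(LINT x|kernel_measure s b. T x) - f s - b * bias_coeff f s\<bar> \<le> (\<Sum>i\<in>(UNIV::'d set). C1 * b\<^sup>2 * B1) + (\<Sum>i\<in>(UNIV::'d set). \<Sum>j\<in>(UNIV::'d set). C2 * b\<^sup>2 * B2) / 2"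
      unfolding eq
    proof (intro order_trans[OF abs_triangle_ineq] add_mono)
      show "\<bar>\<Sum>i\<in>UNIV. ((LINT x|kernel_measure s b. x $ i - s $ i) - b * (1 - (?d + 1) * s $ i)) * a i\<bar> \<le> (\<Sum>i\<in>(UNIV::'d set). C1 * b\<^sup>2 * B1)"
        by (intro order_trans[OF sum_abs] sum_mono, unfold abs_mult, intro mult_mono C1(2)[OF s b(1)] a)
          (use C1(1) in auto)
      show "\<bar>(\<Sum>i\<in>UNIV. \<Sum>j\<in>UNIV. ((LINT x|kernel_measure s b. (x $ i - s $ i) * (x $ j - s $ j)) -
         b * (s $ i * ((if i = j then 1 else 0) - s $ j))) * A i j) / 2\<bar> \<le> (\<Sum>i\<in>(UNIV::'d set). \<Sum>j\<in>(UNIV::'d set). C2 * b\<^sup>2 * B2) / 2"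
        unfolding abs_divide abs_numeral
      proof (intro divide_right_mono order_trans[OF sum_abs] sum_mono)
        fix i j
        show "\<bar>((LINT x|kernel_measure s b. (x $ i - s $ i) * (x $ j - s $ j)) -
         b * (s $ i * ((if i = j then 1 else 0) - s $ j))) * A i j\<bar> \<le> C2 * b\<^sup>2 * B2"
          unfolding abs_mult by (intro mult_mono C2(2)[OF s b(1) b1] A) (use C2(1) in auto)
      qed simp
    qed
    also have "\<dots> = (?d * (C1 * B1) + ?d * (?d * (C2 * B2)) / 2) * b\<^sup>2" by (simp add: algebra_simps)
    finally have 2: "\<bar>(LINT x|kernel_measure s b. T x) - f s - b * bias_coeff f s\<bar> \<le> \<dots>" .
    have "\<bar>(LINT x|kernel_measure s b. f x) - f s - b * bias_coeff f s\<bar> \<le> e / 2 * b + K * b\<^sup>2"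
      using 1 2 unfolding K_def by (simp add: algebra_simps)
    also have "\<dots> \<le> e / 2 * b + e / 2 * b"
    proof -
      have "b * (2 * (K + 1)) \<le> e" using b K by (simp add: b0_def field_simps)
      then have "K * b \<le> e / 2" using b by (simp add: algebra_simps)
      then have "(K * b) * b \<le> e / 2 * b" using b by (intro mult_right_mono) auto
      moreover have "K * b\<^sup>2 = (K * b) * b" by (simp add: power2_eq_square)
      ultimately show ?thesis by linarith
    qed
    finally show ?thesis by (simp add: mult.commute)
  qed
  with b0 show ?thesis by blast
qed

lemma bounded_bias_coeff:
  fixes f :: "real ^ 'd \<Rightarrow> real"
  assumes smooth: "twice_cont_diff_on f simplex_set"
  obtains G where "0 < G" "\<And>s. s \<in> open_simplex \<Longrightarrow> \<bar>bias_coeff f s\<bar> \<le> G"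
proof -
  obtain f' f'' where f': "\<And>x. x \<in> simplex_set \<Longrightarrow> (f has_derivative blinfun_apply (f' x)) (at x within simplex_set)"
    and f'': "\<And>x. x \<in> simplex_set \<Longrightarrow> (f' has_derivative blinfun_apply (f'' x)) (at x within simplex_set)"
    and cont: "continuous_on simplex_set f''"
    using smooth unfolding twice_cont_diff_on_def by blast
  have cont1: "continuous_on simplex_set f'"
    using f'' has_derivative_continuous continuous_on_eq_continuous_within by blast
  define g where "g s = (\<Sum>i\<in>UNIV. (1 - (real CARD('d) + 1) * s $ i) * f' s (axis i 1)) +
     1 / 2 * (\<Sum>i\<in>UNIV. \<Sum>j\<in>UNIV.
       s $ i * ((if i = j then 1 else 0) - s $ j) * f'' s (axis i 1) (axis j 1))" for s
  have "continuous_on simplex_set g"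
    unfolding g_def by (intro continuous_intros cont cont1)
  then obtain G where G: "0 < G" "\<And>s. s \<in> simplex_set \<Longrightarrow> norm (g s) \<le> G"
    using bounded_on_simplex by blast
  show ?thesis
  proof (rule that[OF G(1)])
    fix s :: "real ^ 'd" assume s: "s \<in> open_simplex"
    have "bias_coeff f s = g s" unfolding g_def by (rule bias_coeff_eq[OF f' f'' s])
    then show "\<bar>bias_coeff f s\<bar> \<le> G" using G(2)[of s] s open_simplex_subset by auto
  qed
qed

section \<open>The maximum of the kernel\<close>

text \<open>
  A vanishing base makes \<open>powr\<close> vanish whatever the exponent, so the closed and the open simplex can be
  exchanged in all integrals of kernels.
\<close>
lemma dirichlet_density_boundary:
  assumes x: "x \<in> simplex_set" "x \<notin> open_simplex"
  shows "dirichlet_density u v x = 0"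
proof (cases "\<exists>i. x $ i = 0")
  case True
  then have "(\<Prod>i\<in>UNIV. x $ i powr (u $ i - 1)) = 0" by (intro prod_zero) auto
  then show ?thesis by (simp add: dirichlet_density_def)
next
  case False
  then have "\<forall>i. 0 < x $ i" using x by (auto simp: simplex_set_iff less_le)
  then have "(\<Sum>i\<in>UNIV. x $ i) = 1" using x by (auto simp: simplex_set_iff open_simplex_iff)
  moreover have "norm1 x = (\<Sum>i\<in>UNIV. x $ i)" using x by (intro norm1_eq_sum) (auto simp: simplex_set_iff)
  ultimately show ?thesis by (simp add: dirichlet_density_def)
qed

definition kernel_constant :: "real ^ 'd \<Rightarrow> real \<Rightarrow> real" where
  "kernel_constant s b = Gamma (1 / b + real CARD('d) + 1) /
     (Gamma ((1 - norm1 s) / b + 1) * (\<Prod>i\<in>UNIV. Gamma (s $ i / b + 1)))"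

text \<open>
  The probability vectors behind this are \<open>s\<close> and \<open>x\<close>, each completed by the coordinate that makes the
  sum one.
\<close>
definition neg_cross_entropy :: "real ^ 'd \<Rightarrow> real ^ 'd \<Rightarrow> real" where
  "neg_cross_entropy s x = (1 - norm1 s) * ln (1 - norm1 x) + (\<Sum>i\<in>UNIV. s $ i * ln (x $ i))"

lemma open_simplex_pos:
  fixes s :: "real ^ 'd"
  assumes s: "s \<in> open_simplex"
  shows "0 < s $ i" "0 < 1 - norm1 s" "norm1 s = (\<Sum>i\<in>UNIV. s $ i)"
proof -
  show 1: "0 < s $ i" for i using s by (simp add: open_simplex_iff)
  show "norm1 s = (\<Sum>i\<in>UNIV. s $ i)" using 1 by (intro norm1_eq_sum) (simp add: less_imp_le)
  then show "0 < 1 - norm1 s" using s by (simp add: open_simplex_iff)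
qed

lemma kernel_constant_pos:
  fixes s :: "real ^ 'd"
  assumes s: "s \<in> open_simplex" and b: "0 < b"
  shows "0 < kernel_constant s b"
  unfolding kernel_constant_def using open_simplex_pos[OF s] b
  by (intro divide_pos_pos mult_pos_pos prod_pos ballI Gamma_real_pos add_pos_pos) (auto intro!: add_pos_nonneg)

lemma dirichlet_kernel_eq:
  fixes s :: "real ^ 'd"
  assumes s: "s \<in> open_simplex" and b: "0 < b" and x: "x \<in> open_simplex"
  shows "dirichlet_kernel s b x = kernel_constant s b * exp (neg_cross_entropy s x / b)"
proof -
  have "exp (neg_cross_entropy s x / b) = exp ((1 - norm1 s) / b * ln (1 - norm1 x) + (\<Sum>i\<in>UNIV. s $ i / b * ln (x $ i)))"
    by (simp add: neg_cross_entropy_def add_divide_distrib sum_divide_distrib)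
  also have "\<dots> = (1 - norm1 x) powr ((1 - norm1 s) / b) * (\<Prod>i\<in>UNIV. (x $ i) powr (s $ i / b))"
    using open_simplex_pos[OF x] by (simp add: exp_add exp_sum powr_def less_imp_neq[THEN not_sym])
  finally have e: "exp (neg_cross_entropy s x / b) = \<dots>" .
  show ?thesis
    unfolding e dirichlet_kernel_def dirichlet_density_def kernel_constant_def
      dirichlet_kernel_parameters_pos(3)[OF s b] by simp
qed

lemma dirichlet_kernel_nonneg:
  fixes s :: "real ^ 'd"
  assumes "s \<in> open_simplex" "0 < b"
  shows "0 \<le> dirichlet_kernel s b x"
  unfolding dirichlet_kernel_def using assms
  by (intro dirichlet_density_nonneg dirichlet_kernel_parameters_pos)

text \<open>Gibbs' inequality; it identifies \<open>s\<close> as the mode of the kernel.\<close>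
lemma neg_cross_entropy_le:
  fixes s x :: "real ^ 'd"
  assumes s: "s \<in> open_simplex" and x: "x \<in> open_simplex"
  shows "neg_cross_entropy s x \<le> neg_cross_entropy s s"
proof -
  have *: "a * ln y \<le> a * ln a + (y - a)" if "0 < a" "0 < y" for a y :: real
  proof -
    have "ln (y / a) \<le> y / a - 1" using that by (intro ln_le_minus_one) auto
    then have "a * ln (y / a) \<le> a * (y / a - 1)" using that by (intro mult_left_mono) auto
    then show ?thesis using that by (simp add: ln_div algebra_simps)
  qed
  have "neg_cross_entropy s x \<le> ((1 - norm1 s) * ln (1 - norm1 s) + ((1 - norm1 x) - (1 - norm1 s))) +
     (\<Sum>i\<in>UNIV. s $ i * ln (s $ i) + (x $ i - s $ i))"
    unfolding neg_cross_entropy_def using open_simplex_pos(1,2)[OF s] open_simplex_pos(1,2)[OF x]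
    by (intro add_mono sum_mono *) auto
  also have "\<dots> = neg_cross_entropy s s"
    unfolding neg_cross_entropy_def using open_simplex_pos(3)[OF s] open_simplex_pos(3)[OF x]
    by (simp add: sum.distrib sum_subtractf)
  finally show ?thesis .
qed

lemma dirichlet_kernel_le_mode:
  fixes s x :: "real ^ 'd"
  assumes s: "s \<in> open_simplex" and b: "0 < b" and x: "x \<in> simplex_set"
  shows "dirichlet_kernel s b x \<le> dirichlet_kernel s b s"
proof (cases "x \<in> open_simplex")
  case True
  then show ?thesis
    using kernel_constant_pos[OF s b] neg_cross_entropy_le[OF s True] b
    by (simp add: dirichlet_kernel_eq[OF s b] s divide_right_mono)
next
  case False
  then have "dirichlet_kernel s b x = 0" unfolding dirichlet_kernel_def using x by (rule dirichlet_density_boundary[rotated])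
  then show ?thesis using dirichlet_kernel_nonneg[OF s b] by simp
qed

text \<open>
  A quantitative converse of Gibbs' inequality, from \<open>ln y \<le> y - 1\<close> at \<open>y = s $ i / x $ i\<close>: near its
  mode the kernel decays no faster than a Gaussian of variance of order \<open>b\<close>.
\<close>
lemma neg_cross_entropy_ge:
  fixes s x :: "real ^ 'd"
  assumes s: "s \<in> open_simplex" and x: "x \<in> open_simplex"
  shows "neg_cross_entropy s s - ((norm1 x - norm1 s)\<^sup>2 / (1 - norm1 x) + (\<Sum>i\<in>UNIV. (x $ i - s $ i)\<^sup>2 / x $ i)) \<le> neg_cross_entropy s x"
proof -
  have *: "a * ln a + (y - a) - (y - a)\<^sup>2 / y \<le> a * ln y" if "0 < a" "0 < y" for a y :: real
  proof -
    have "ln (a / y) \<le> a / y - 1" using that by (intro ln_le_minus_one) auto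
    then have "a * ln (a / y) \<le> a * (a / y - 1)" using that by (intro mult_left_mono) auto
    moreover have "a * (a / y - 1) = (y - a)\<^sup>2 / y - (y - a)" using that by (simp add: field_simps power2_eq_square)
    ultimately show ?thesis using that by (simp add: ln_div algebra_simps)
  qed
  have "neg_cross_entropy s s - ((norm1 x - norm1 s)\<^sup>2 / (1 - norm1 x) + (\<Sum>i\<in>UNIV. (x $ i - s $ i)\<^sup>2 / x $ i)) =
    ((1 - norm1 s) * ln (1 - norm1 s) + ((1 - norm1 x) - (1 - norm1 s)) - ((1 - norm1 x) - (1 - norm1 s))\<^sup>2 / (1 - norm1 x)) +
     (\<Sum>i\<in>UNIV. s $ i * ln (s $ i) + (x $ i - s $ i) - (x $ i - s $ i)\<^sup>2 / x $ i)"
    unfolding neg_cross_entropy_def using open_simplex_pos(3)[OF s] open_simplex_pos(3)[OF x]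
    by (simp add: sum.distrib sum_subtractf power2_commute)
  also have "\<dots> \<le> neg_cross_entropy s x"
    unfolding neg_cross_entropy_def using open_simplex_pos(1,2)[OF s] open_simplex_pos(1,2)[OF x]
    by (intro add_mono sum_mono *) auto
  finally show ?thesis .
qed

lemma dirichlet_kernel_integral:
  fixes s :: "real ^ 'd"
  assumes s: "s \<in> open_simplex" and b: "0 < b"
  shows "integrable lborel (\<lambda>x. indicator open_simplex x * dirichlet_kernel s b x)"
    and "(LINT x|lborel. indicator open_simplex x * dirichlet_kernel s b x) = 1"
proof -
  interpret prob_space "kernel_measure s b" by (rule prob_space_kernel_measure[OF s b])
  have "integrable (kernel_measure s b) (\<lambda>x. 1 :: real)" by simp
  then show "integrable lborel (\<lambda>x. indicator open_simplex x * dirichlet_kernel s b x)"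
    unfolding kernel_measure_def dirichlet_def dirichlet_kernel_def[symmetric]
    by (subst (asm) integrable_density) (use dirichlet_kernel_nonneg[OF s b] in \<open>auto simp: dirichlet_kernel_def\<close>)
  show "(LINT x|lborel. indicator open_simplex x * dirichlet_kernel s b x) = 1"
    using integral_kernel_measure[OF s b, of "\<lambda>_. 1"] prob_space by simp
qed

text \<open>
  On the box of side \<open>2 * \<delta> * sqrt b\<close> around its mode \<open>s\<close> the kernel stays above a fixed fraction of
  its maximum, and its integral is one. So the maximum is at most a multiple of the reciprocal of
  the volume of the box.
\<close>
lemma dirichlet_kernel_mode_bound:
  fixes s :: "real ^ 'd"
  assumes s: "s \<in> open_simplex"
  obtains C where "0 < C" "\<And>b. 0 < b \<Longrightarrow> b \<le> 1 \<Longrightarrow> dirichlet_kernel s b s \<le> C * b powr (- (real CARD('d) / 2))"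
proof -
  let ?d = "real CARD('d)"
  define m where "m = Min (insert (1 - norm1 s) (range (\<lambda>i. s $ i)))"
  have m0: "0 < m" unfolding m_def using open_simplex_pos[OF s] by (subst Min_gr_iff) auto
  have mi: "m \<le> s $ i" for i unfolding m_def by (intro Min_le) auto
  have m1: "m \<le> 1 - norm1 s" unfolding m_def by (intro Min_le) auto
  \<comment> \<open>With this \<open>\<delta>\<close> every coordinate, the last one included, stays above \<open>m / 2\<close> on the box.\<close>
  define \<delta> where "\<delta> = m / (2 * ?d)"
  have d1: "1 \<le> ?d" by (simp add: Suc_leI)
  have \<delta>: "0 < \<delta>" "?d * \<delta> = m / 2" "\<delta> \<le> m / 2" using m0 d1 by (auto simp: \<delta>_def field_simps)
  define C0 where "C0 = (?d * \<delta>)\<^sup>2 / (m / 2) + ?d * (\<delta>\<^sup>2 / (m / 2))"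
  have "dirichlet_kernel s b s \<le> exp C0 / (2 * \<delta>) ^ CARD('d) * b powr (- (?d / 2))" if b: "0 < b" "b \<le> 1" for b
  proof -
    define h where "h = \<delta> * sqrt b"
    have h: "0 < h" "h \<le> \<delta>" "h\<^sup>2 = \<delta>\<^sup>2 * b" using \<delta> b by (auto simp: h_def mult_left_le power_mult_distrib)
    define Q where "Q = cbox (\<chi> i. s $ i - h) (\<chi> i. s $ i + h)"
    have Q: "x \<in> open_simplex \<and> dirichlet_kernel s b s * exp (- C0) \<le> dirichlet_kernel s b x" if "x \<in> Q" for x
    proof -
      have xi: "\<bar>x $ i - s $ i\<bar> \<le> h" for i using that unfolding Q_def mem_box_cart by (auto simp: abs_le_iff algebra_simps)
      have xpos: "m / 2 \<le> x $ i" for i using xi[of i] mi[of i] h \<delta> by linarith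
      have "\<bar>(\<Sum>i\<in>UNIV. x $ i) - norm1 s\<bar> = \<bar>\<Sum>i\<in>UNIV. x $ i - s $ i\<bar>"
        by (simp add: open_simplex_pos(3)[OF s] sum_subtractf)
      also have "\<dots> \<le> (\<Sum>i\<in>(UNIV::'d set). h)" by (intro order_trans[OF sum_abs] sum_mono xi)
      finally have sx: "\<bar>(\<Sum>i\<in>UNIV. x $ i) - norm1 s\<bar> \<le> ?d * h" by simp
      also have "\<dots> \<le> ?d * \<delta>" using h by (intro mult_left_mono) auto
      finally have "(\<Sum>i\<in>UNIV. x $ i) \<le> 1 - m / 2" using m1 \<delta> by linarith
      moreover have "0 < x $ i" for i using xpos[of i] m0 by linarith
      ultimately have x: "x \<in> open_simplex" using m0 by (auto simp: open_simplex_iff)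
      note nx = open_simplex_pos(3)[OF x]
      have x1: "m / 2 \<le> 1 - norm1 x" using \<open>(\<Sum>i\<in>UNIV. x $ i) \<le> 1 - m / 2\<close> nx by simp
      have sq: "(x $ i - s $ i)\<^sup>2 \<le> h\<^sup>2" for i using xi[of i] h by (subst power2_le_iff_abs_le) auto
      have sq1: "(norm1 x - norm1 s)\<^sup>2 \<le> (?d * h)\<^sup>2" using sx h nx by (subst power2_le_iff_abs_le) auto
      have "(norm1 x - norm1 s)\<^sup>2 / (1 - norm1 x) + (\<Sum>i\<in>UNIV. (x $ i - s $ i)\<^sup>2 / x $ i) \<le>
         (?d * h)\<^sup>2 / (m / 2) + (\<Sum>i\<in>(UNIV::'d set). h\<^sup>2 / (m / 2))"
        using m0 x1 xpos sq sq1
        by (intro add_mono sum_mono frac_le) auto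
      also have "\<dots> = b * C0" using h(3) by (simp add: C0_def power_mult_distrib algebra_simps)
      finally have "neg_cross_entropy s s - b * C0 \<le> neg_cross_entropy s x" using neg_cross_entropy_ge[OF s x] by linarith
      then have "(neg_cross_entropy s s - b * C0) / b \<le> neg_cross_entropy s x / b" using b by (intro divide_right_mono) auto
      then have "neg_cross_entropy s s / b - C0 \<le> neg_cross_entropy s x / b" using b by (simp add: diff_divide_distrib)
      then have "exp (neg_cross_entropy s s / b) * exp (- C0) \<le> exp (neg_cross_entropy s x / b)"
        by (simp add: mult_exp_exp)
      then have "kernel_constant s b * (exp (neg_cross_entropy s s / b) * exp (- C0)) \<le> kernel_constant s b * exp (neg_cross_entropy s x / b)"
        using kernel_constant_pos[OF s b(1)] by (intro mult_left_mono) auto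
      then show ?thesis using x by (simp add: dirichlet_kernel_eq[OF s b(1)] s mult.assoc)
    qed
    have "dirichlet_kernel s b s * exp (- C0) * (2 * h) ^ CARD('d) = dirichlet_kernel s b s * exp (- C0) * measure lborel Q"
    proof -
      have ne: "Q \<noteq> {}" unfolding Q_def using h by (auto simp: interval_ne_empty_cart)
      have "measure lborel Q = (\<Prod>i\<in>(UNIV::'d set). 2 * h)"
        using content_cbox_cart[OF ne[unfolded Q_def]] by (simp add: Q_def)
      then show ?thesis by simp
    qed
    also have "\<dots> = (LINT x|lborel. dirichlet_kernel s b s * exp (- C0) * indicator Q x)"
      by (simp add: Q_def emeasure_lborel_cbox_eq)
    also have "\<dots> \<le> (LINT x|lborel. indicator open_simplex x * dirichlet_kernel s b x)"
    proof (rule integral_mono)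
      show "integrable lborel (\<lambda>x. dirichlet_kernel s b s * exp (- C0) * indicator Q x)"
        by (intro integrable_mult_right integrable_real_indicator) (auto simp: Q_def emeasure_lborel_cbox_eq)
      show "integrable lborel (\<lambda>x. indicator open_simplex x * dirichlet_kernel s b x)"
        by (rule dirichlet_kernel_integral[OF s b(1)])
      show "dirichlet_kernel s b s * exp (- C0) * indicator Q x \<le> indicator open_simplex x * dirichlet_kernel s b x" for x
        using Q[of x] dirichlet_kernel_nonneg[OF s b(1), of x] by (auto simp: indicator_def)
    qed
    also have "\<dots> = 1"
      by (rule dirichlet_kernel_integral[OF s b(1)])
    finally have le: "dirichlet_kernel s b s * exp (- C0) * (2 * h) ^ CARD('d) \<le> 1" .
    have "(2 * h) ^ CARD('d) = (2 * \<delta>) ^ CARD('d) * b powr (?d / 2)"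
    proof -
      have "(2 * h) ^ CARD('d) = (2 * \<delta>) ^ CARD('d) * (sqrt b) ^ CARD('d)"
        by (simp add: h_def power_mult_distrib)
      also have "(sqrt b) ^ CARD('d) = b powr (?d / 2)"
        using b by (simp add: powr_realpow[symmetric] powr_half_sqrt[symmetric] powr_powr)
      finally show ?thesis .
    qed
    then have "dirichlet_kernel s b s \<le> 1 / (exp (- C0) * ((2 * \<delta>) ^ CARD('d) * b powr (?d / 2)))"
      using le \<delta> b by (subst pos_le_divide_eq) (auto simp: mult.assoc)
    also have "\<dots> = exp C0 / (2 * \<delta>) ^ CARD('d) * b powr (- (?d / 2))"
      by (simp add: exp_minus powr_minus field_simps)
    finally show ?thesis .
  qed
  moreover have "0 < exp C0 / (2 * \<delta>) ^ CARD('d)" using \<delta> by simp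
  ultimately show ?thesis using that by blast
qed

section \<open>The square of the kernel\<close>

text \<open>
  For natural \<open>z\<close> this is the central binomial coefficient \<open>2 * z choose z\<close> divided by \<open>4 ^ z\<close>.
\<close>
definition duplication_ratio :: "real \<Rightarrow> real" where
  "duplication_ratio z = Gamma (2 * z + 1) / (Gamma (z + 1))\<^sup>2 / 4 powr z"

lemma Gamma_plus1_pos: "0 < z \<Longrightarrow> Gamma (z + 1) = z * Gamma (z :: real)"
  by (rule Gamma_plus1) (auto elim!: nonpos_Ints_cases)

lemma Gamma_legendre_duplication_real:
  fixes z :: real
  assumes "0 < z"
  shows "Gamma z * Gamma (z + 1/2) = 2 powr (1 - 2 * z) * sqrt pi * Gamma (2 * z)"
proof -
  have 1: "complex_of_real z \<notin> \<int>\<^sub>\<le>\<^sub>0" "complex_of_real z + 1/2 \<notin> \<int>\<^sub>\<le>\<^sub>0"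
    using assms by (auto elim!: nonpos_Ints_cases simp: complex_eq_iff)
  have "complex_of_real (Gamma z * Gamma (z + 1/2)) = Gamma (complex_of_real z) * Gamma (complex_of_real z + 1/2)"
    by (simp add: Gamma_complex_of_real[symmetric])
  also have "\<dots> = exp ((1 - 2 * complex_of_real z) * of_real (ln 2)) * of_real (sqrt pi) * Gamma (2 * complex_of_real z)"
    by (rule Gamma_legendre_duplication[OF 1])
  also have "\<dots> = complex_of_real (exp ((1 - 2 * z) * ln 2) * sqrt pi * Gamma (2 * z))"
    by (simp add: Gamma_complex_of_real[symmetric] exp_of_real[symmetric])
  finally show ?thesis by (simp only: of_real_eq_iff powr_def) simp
qed

lemma Gamma_midpoint_le:
  fixes x y :: real
  assumes "0 < x" "0 < y"
  shows "(Gamma ((x + y) / 2))\<^sup>2 \<le> Gamma x * Gamma y"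
proof -
  have "ln (Gamma ((1 - 1/2) *\<^sub>R x + (1/2) *\<^sub>R y)) \<le> (1 - 1/2) * ln (Gamma x) + (1/2) * ln (Gamma y)"
    using convex_onD[OF log_convex_Gamma_real, of "1/2" x y] assms by simp
  moreover have "(1 - 1/2) *\<^sub>R x + (1/2) *\<^sub>R y = (x + y) / 2" by simp
  ultimately have "2 * ln (Gamma ((x + y) / 2)) \<le> ln (Gamma x) + ln (Gamma y)" by (simp add: add_divide_distrib)
  moreover have G: "0 < Gamma ((x + y) / 2)" "0 < Gamma x" "0 < Gamma y" using assms by (auto intro: Gamma_real_pos)
  ultimately have "ln ((Gamma ((x + y) / 2))\<^sup>2) \<le> ln (Gamma x * Gamma y)"
    by (simp add: ln_mult ln_realpow)
  then show ?thesis using G by simp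
qed

text \<open>
  By the duplication formula the quotient equals \<open>Gamma (z + 1 / 2) / (sqrt pi * Gamma (z + 1))\<close>, which log-convexity of
  the Gamma function pins down to order \<open>1 / sqrt z\<close> from both sides.
\<close>
lemma duplication_ratio_asymp:
  "((\<lambda>z. duplication_ratio z * sqrt z) \<longlongrightarrow> 1 / sqrt pi) at_top"
proof -
  define G where "G z = Gamma (z + 1/2) / Gamma (z + 1) * sqrt z" for z :: real
  have eq: "duplication_ratio z * sqrt z = G z / sqrt pi" if z: "0 < z" for z
  proof -
    have "Gamma (z + 1/2) * Gamma (z + 1) = 2 powr (- (2 * z)) * sqrt pi * Gamma (2 * z + 1)"
      using Gamma_legendre_duplication_real[of "z + 1/2"] z by (simp add: algebra_simps)
    also have "2 powr (- (2 * z)) = 1 / 4 powr z"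
    proof -
      have "(4::real) powr z = (2 powr 2) powr z" by simp
      also have "\<dots> = 2 powr (2 * z)" by (rule powr_powr)
      finally show ?thesis by (simp add: powr_minus_divide)
    qed
    finally have "Gamma (2 * z + 1) / 4 powr z = Gamma (z + 1/2) * Gamma (z + 1) / sqrt pi" by (simp add: field_simps)
    moreover have "0 < Gamma (z + 1)" using z by (intro Gamma_real_pos) auto
    ultimately show ?thesis
      by (simp add: duplication_ratio_def G_def field_simps power2_eq_square)
  qed
  have bounds: "sqrt (z / (z + 1/2)) \<le> G z \<and> G z \<le> 1" if z: "0 < z" for z
  proof -
    have pos: "0 < Gamma (z + 1/2)" "0 < Gamma (z + 1)" "0 < Gamma z" using z by (auto intro!: Gamma_real_pos)
    have "(z + (z + 1)) / 2 = z + 1/2" by simp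
    then have "(Gamma (z + 1/2))\<^sup>2 \<le> Gamma z * Gamma (z + 1)" using Gamma_midpoint_le[of z "z + 1"] z by (simp only:)
    then have "(Gamma (z + 1/2))\<^sup>2 * z \<le> (z * Gamma z) * Gamma (z + 1)" using z by (simp add: mult_ac)
    then have "(Gamma (z + 1/2))\<^sup>2 * z \<le> (Gamma (z + 1))\<^sup>2" using z by (simp add: Gamma_plus1_pos power2_eq_square)
    then have "(G z)\<^sup>2 \<le> 1\<^sup>2" using z pos by (simp add: G_def power_mult_distrib power_divide divide_le_eq_1)
    then have 1: "G z \<le> 1" by (rule power2_le_imp_le) simp
    have "(z + 1/2 + (z + 1/2 + 1)) / 2 = z + 1" by (simp add: field_simps)
    then have "(Gamma (z + 1))\<^sup>2 \<le> Gamma (z + 1/2) * Gamma (z + 1/2 + 1)"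
      using Gamma_midpoint_le[of "z + 1/2" "z + 1/2 + 1"] z by (simp only:)
    also have "\<dots> = (z + 1/2) * (Gamma (z + 1/2))\<^sup>2"
      using z by (subst Gamma_plus1_pos) (auto simp: power2_eq_square)
    finally have "z * (Gamma (z + 1))\<^sup>2 \<le> z * ((z + 1/2) * (Gamma (z + 1/2))\<^sup>2)" using z by (intro mult_left_mono) auto
    then have "z \<le> (z + 1/2) * (Gamma (z + 1/2))\<^sup>2 * z / (Gamma (z + 1))\<^sup>2"
      using pos by (subst pos_le_divide_eq) (auto simp only: mult_ac zero_less_power)
    then have "z / (z + 1/2) \<le> (Gamma (z + 1/2))\<^sup>2 * z / (Gamma (z + 1))\<^sup>2"
      using z by (subst pos_divide_le_eq) (auto simp only: mult_ac times_divide_eq_right times_divide_eq_left)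
    also have "\<dots> = (G z)\<^sup>2" using z by (simp add: G_def power_mult_distrib power_divide)
    finally have "z / (z + 1/2) \<le> (G z)\<^sup>2" .
    then have "sqrt (z / (z + 1/2)) \<le> G z" using z pos by (intro real_le_lsqrt) (auto simp: G_def)
    with 1 show ?thesis by simp
  qed
  have "(G \<longlongrightarrow> 1) at_top"
  proof (rule tendsto_sandwich)
    show "((\<lambda>z::real. sqrt (z / (z + 1/2))) \<longlongrightarrow> 1) at_top" by real_asymp
    show "((\<lambda>z::real. 1::real) \<longlongrightarrow> 1) at_top" by simp
    show "\<forall>\<^sub>F z in at_top. sqrt (z / (z + 1/2)) \<le> G z" "\<forall>\<^sub>F z in at_top. G z \<le> 1"
      by (rule eventually_mono[OF eventually_gt_at_top[of "0::real"]], use bounds in blast)+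
  qed
  then have "((\<lambda>z. G z / sqrt pi) \<longlongrightarrow> 1 / sqrt pi) at_top" by (intro tendsto_intros) auto
  then show ?thesis
    by (rule Lim_transform_eventually)
      (rule eventually_mono[OF eventually_gt_at_top[of "0::real"]], use eq in simp)
qed

definition square_ratio :: "real ^ 'd \<Rightarrow> real \<Rightarrow> real" where
  "square_ratio s b = (kernel_constant s b)\<^sup>2 / kernel_constant s (b / 2)"

text \<open>
  Squaring a Dirichlet kernel doubles its exponents, which is the same as halving the bandwidth. The
  second moment of the estimator's summands is thereby reduced to a first moment.
\<close>
lemma dirichlet_kernel_square:
  fixes s :: "real ^ 'd"
  assumes s: "s \<in> open_simplex" and b: "0 < b" and x: "x \<in> open_simplex"
  shows "(dirichlet_kernel s b x)\<^sup>2 = square_ratio s b * dirichlet_kernel s (b / 2) x"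
proof -
  have "(exp (neg_cross_entropy s x / b))\<^sup>2 = exp (neg_cross_entropy s x / (b / 2))"
    by (simp add: exp_double[symmetric])
  moreover have "0 < kernel_constant s (b / 2)" using b by (intro kernel_constant_pos s) auto
  ultimately show ?thesis using b
    by (simp add: dirichlet_kernel_eq[OF s _ x] square_ratio_def power_mult_distrib)
qed

lemma pochhammer_asymp:
  fixes c :: real
  assumes "0 < c"
  shows "((\<lambda>N. pochhammer (c * N + 1) k / N ^ k) \<longlongrightarrow> c ^ k) at_top"
proof (induction k)
  case (Suc k)
  have "((\<lambda>N. (c * N + 1 + real k) / N) \<longlongrightarrow> c) at_top" using assms by real_asymp
  from tendsto_mult[OF Suc this] show ?case
    by (simp add: pochhammer_Suc mult.commute)
qed simp

lemma Gamma_eq_pochhammer: "0 < z \<Longrightarrow> Gamma (z + real n) = pochhammer z n * Gamma (z :: real)"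
proof (induction n)
  case (Suc n)
  then have "Gamma (z + real n + 1) = (z + real n) * Gamma (z + real n)"
    by (intro Gamma_plus1_pos) auto
  then show ?case using Suc by (simp add: pochhammer_Suc add_ac mult_ac)
qed simp

text \<open>
  The powers of four cancel because the coordinates of \<open>s\<close>, completed by \<open>1 - norm1 s\<close>, sum to one.
\<close>
lemma square_ratio_eq:
  fixes s :: "real ^ 'd"
  assumes s: "s \<in> open_simplex" and N: "0 < N"
  defines "d \<equiv> CARD('d)"
  shows "square_ratio s (1 / N) = (pochhammer (N + 1) d)\<^sup>2 / pochhammer (2 * N + 1) d *
    (duplication_ratio ((1 - norm1 s) * N) * (\<Prod>i\<in>UNIV. duplication_ratio (s $ i * N)) / duplication_ratio N)"
proof -
  note pos = open_simplex_pos[OF s]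
  have four: "4 powr ((1 - norm1 s) * N) * (\<Prod>i\<in>UNIV. 4 powr (s $ i * N)) = 4 powr N"
  proof -
    have "(\<Prod>i\<in>UNIV. 4 powr (s $ i * N)) = 4 powr (norm1 s * N)"
      by (simp add: powr_sum pos(3) sum_distrib_right)
    then show ?thesis by (simp add: powr_add[symmetric] algebra_simps)
  qed
  have dp: "Gamma (2 * z + 1) / (Gamma (z + 1))\<^sup>2 = duplication_ratio z * 4 powr z" for z
    by (simp add: duplication_ratio_def)
  have "square_ratio s (1 / N) = (Gamma (N + 1 + real d))\<^sup>2 / Gamma (2 * N + 1 + real d) *
    (Gamma (2 * ((1 - norm1 s) * N) + 1) / (Gamma ((1 - norm1 s) * N + 1))\<^sup>2) *
    ((\<Prod>i\<in>UNIV. Gamma (2 * (s $ i * N) + 1)) / (\<Prod>i\<in>UNIV. (Gamma (s $ i * N + 1))\<^sup>2))"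
    unfolding square_ratio_def kernel_constant_def d_def
    by (simp add: power_divide power_mult_distrib prod_power_distrib add_ac mult_ac)
  also have "\<dots> = (Gamma (N + 1 + real d))\<^sup>2 / Gamma (2 * N + 1 + real d) *
    (duplication_ratio ((1 - norm1 s) * N) * 4 powr ((1 - norm1 s) * N)) *
    ((\<Prod>i\<in>UNIV. duplication_ratio (s $ i * N)) * (\<Prod>i\<in>UNIV. 4 powr (s $ i * N)))"
    unfolding prod_dividef[symmetric] dp by (simp add: prod.distrib)
  also have "\<dots> = (Gamma (N + 1 + real d))\<^sup>2 / Gamma (2 * N + 1 + real d) *
    (duplication_ratio ((1 - norm1 s) * N) * (\<Prod>i\<in>UNIV. duplication_ratio (s $ i * N))) * 4 powr N"
    unfolding four[symmetric] by (simp add: mult_ac)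
  also have "(Gamma (N + 1 + real d))\<^sup>2 / Gamma (2 * N + 1 + real d) =
     (pochhammer (N + 1) d)\<^sup>2 / pochhammer (2 * N + 1) d / (Gamma (2 * N + 1) / (Gamma (N + 1))\<^sup>2)"
    using N by (simp add: Gamma_eq_pochhammer power_mult_distrib)
  finally show ?thesis unfolding dp by simp
qed

text \<open>
  With \<open>N = 1 / b\<close> there are \<open>d + 1\<close> duplication ratios in the numerator, of order
  \<open>1 / sqrt (pi * s $ i * N)\<close>, and one in the denominator; the Pochhammer symbols contribute \<open>(N / 2) ^ d\<close>.
\<close>
lemma square_ratio_asymp:
  fixes s :: "real ^ 'd"
  assumes s: "s \<in> open_simplex"
  shows "((\<lambda>b. square_ratio s b * b powr (real CARD('d) / 2)) \<longlongrightarrow> variance_coeff s) (at_right 0)"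
proof -
  define d where "d = CARD('d)"
  note pos = open_simplex_pos[OF s]
  let ?r = "\<lambda>z. duplication_ratio z * sqrt z"
  have lim: "((\<lambda>N. ?r (c * N)) \<longlongrightarrow> 1 / sqrt pi) at_top" if "0 < c" for c
    by (rule filterlim_compose[OF duplication_ratio_asymp]) (use that in real_asymp)
  let ?F = "\<lambda>N. (pochhammer (1 * N + 1) d / N ^ d)\<^sup>2 / (pochhammer (2 * N + 1) d / N ^ d) *
     (?r ((1 - norm1 s) * N) * (\<Prod>i\<in>UNIV. ?r (s $ i * N)) / ?r (1 * N)) /
     (sqrt (1 - norm1 s) * (\<Prod>i\<in>UNIV. sqrt (s $ i)))"
  have "(?F \<longlongrightarrow> (1 ^ d)\<^sup>2 / 2 ^ d * (1 / sqrt pi * (\<Prod>i\<in>(UNIV::'d set). 1 / sqrt pi) / (1 / sqrt pi)) /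
     (sqrt (1 - norm1 s) * (\<Prod>i\<in>UNIV. sqrt (s $ i)))) at_top"
    using pos by (intro tendsto_intros pochhammer_asymp lim) (auto simp: less_imp_neq[THEN not_sym] prod_zero_iff)
  also have "(1 ^ d)\<^sup>2 / 2 ^ d * (1 / sqrt pi * (\<Prod>i\<in>(UNIV::'d set). 1 / sqrt pi) / (1 / sqrt pi)) /
     (sqrt (1 - norm1 s) * (\<Prod>i\<in>UNIV. sqrt (s $ i))) = variance_coeff s"
  proof -
    have "(4 * pi) powr (- (real d / 2)) = 1 / ((4 * pi) powr (1/2)) ^ d"
      by (simp add: powr_minus powr_realpow[symmetric] powr_powr field_simps)
    also have "\<dots> = 1 / (2 * sqrt pi) ^ d" by (simp add: powr_half_sqrt real_sqrt_mult)
    finally show ?thesis using pos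
      by (simp add: variance_coeff_def d_def powr_half_sqrt less_imp_le power_mult_distrib power_divide)
  qed
  finally have F: "(?F \<longlongrightarrow> variance_coeff s) at_top" .
  have eq: "?F N = square_ratio s (1 / N) * (1 / N) powr (real d / 2)" if N: "0 < N" for N
  proof -
    have "(\<Prod>i\<in>UNIV. ?r (s $ i * N)) = (\<Prod>i\<in>UNIV. duplication_ratio (s $ i * N)) * ((\<Prod>i\<in>UNIV. sqrt (s $ i)) * sqrt N ^ d)"
      by (simp add: prod.distrib real_sqrt_mult d_def)
    moreover have "(1 / N) powr (real d / 2) = sqrt N ^ d / N ^ d"
    proof -
      have "(1 / N) powr (real d / 2) = 1 / sqrt N ^ d"
        using N by (simp add: powr_divide powr_half_sqrt[symmetric] powr_realpow[symmetric] powr_powr)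
      also have "\<dots> = sqrt N ^ d / N ^ d" using N
        by (simp add: divide_simps power_mult_distrib[symmetric])
      finally show ?thesis .
    qed
    moreover have cancel: "P\<^sup>2 / Q * (D0 * (c0 * n) * (D * (c * nd)) / (D1 * n)) / (c0 * c) * 1 / k = P\<^sup>2 / Q * (D0 * D / D1) * (nd / k)"
      if "c0 \<noteq> 0" "c \<noteq> 0" "n \<noteq> 0" for P Q D0 D1 D c0 c n nd k :: real
      using that by simp
    have "(\<Prod>i\<in>UNIV. sqrt (s $ i)) \<noteq> 0" using pos by (simp add: prod_zero_iff less_imp_neq[THEN not_sym])
    moreover have "(P / k)\<^sup>2 / (Q / k) = P\<^sup>2 / Q / k" for P Q k :: real by (simp add: power2_eq_square)
    ultimately show ?thesis using N pos
      unfolding square_ratio_eq[OF s N] d_def[symmetric]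
      by (simp add: real_sqrt_mult mult_ac)
  qed
  have "((\<lambda>b. ?F (inverse b)) \<longlongrightarrow> variance_coeff s) (at_right 0)"
    by (rule filterlim_compose[OF F filterlim_inverse_at_top_right])
  moreover have "\<forall>\<^sub>F b in at_right 0. ?F (inverse b) = square_ratio s b * b powr (real d / 2)"
    using eventually_at_right_less[of "0::real"]
  proof eventually_elim
    case (elim b)
    have "1 / inverse b = b" by (simp add: field_simps)
    then show ?case using eq[of "inverse b"] elim by (simp only: positive_imp_inverse_positive)
  qed
  ultimately show ?thesis
    unfolding d_def[symmetric] by (rule Lim_transform_eventually)
qed

section \<open>Covariance inequalities\<close>

text \<open>
  Writing \<open>U\<close> as the integral over \<open>t\<close> of the indicators of \<open>t < U\<close> reduces a bound on
  its covariance with \<open>W\<close> to the covariances of these indicators with \<open>W\<close>.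
\<close>
lemma (in prob_space) covariance_le_of_level_sets:
  fixes U W :: "'a \<Rightarrow> real"
  assumes [measurable]: "U \<in> borel_measurable M" "W \<in> borel_measurable M"
    and U: "\<And>\<omega>. \<omega> \<in> space M \<Longrightarrow> 0 \<le> U \<omega> \<and> U \<omega> \<le> B"
    and W: "\<And>\<omega>. \<omega> \<in> space M \<Longrightarrow> \<bar>W \<omega>\<bar> \<le> K"
    and c: "\<And>t. \<bar>expectation (\<lambda>\<omega>. indicator {\<omega>. t < U \<omega>} \<omega> * W \<omega>) - prob {\<omega>\<in>space M. t < U \<omega>} * expectation W\<bar> \<le> c"
  shows "\<bar>expectation (\<lambda>\<omega>. U \<omega> * W \<omega>) - expectation U * expectation W\<bar> \<le> B * c"
proof -
  interpret L: pair_sigma_finite M "lborel :: real measure" ..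
  define W' where "W' \<omega> = W \<omega> - expectation W" for \<omega>
  have [measurable]: "W' \<in> borel_measurable M" unfolding W'_def by measurable
  have B: "0 \<le> B" using U not_empty by fastforce
  have K: "0 \<le> K" using W not_empty by fastforce
  have intU: "integrable M U" by (rule integrable_const_bound[of _ B]) (use U in auto)
  have intW: "integrable M W" by (rule integrable_const_bound[of _ K]) (use W in auto)
  have intUW: "integrable M (\<lambda>\<omega>. U \<omega> * W \<omega>)"
    by (rule integrable_const_bound[of _ "B * K"]) (use U W B in \<open>auto simp: abs_mult intro!: AE_I2 mult_mono\<close>)
  have EW: "\<bar>expectation W\<bar> \<le> K"
  proof -
    have "\<bar>expectation W\<bar> \<le> expectation (\<lambda>\<omega>. \<bar>W \<omega>\<bar>)" by (rule integral_abs_bound)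
    also have "\<dots> \<le> expectation (\<lambda>\<omega>. K)" using intW W by (intro integral_mono) auto
    finally show ?thesis by (simp add: prob_space)
  qed
  define F where "F = (\<lambda>(\<omega>, t). indicator {(\<omega>, t). 0 \<le> t \<and> t < B \<and> t < U \<omega>} (\<omega>, t) * W' \<omega> :: real)"
  have [measurable]: "F \<in> borel_measurable (M \<Otimes>\<^sub>M (lborel :: real measure))" unfolding F_def by measurable
  have intF: "integrable (M \<Otimes>\<^sub>M (lborel :: real measure)) F"
  proof (rule Bochner_Integration.integrable_bound)
    show "integrable (M \<Otimes>\<^sub>M (lborel :: real measure)) (\<lambda>z. 2 * K * indicator (space M \<times> {0..B}) z)"
      by (intro integrable_mult_right integrable_real_indicator)
        (use B in \<open>auto simp: lborel.emeasure_pair_measure_Times emeasure_space_1 ennreal_mult_less_top\<close>)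
    show "AE z in M \<Otimes>\<^sub>M (lborel :: real measure). norm (F z) \<le> norm (2 * K * indicator (space M \<times> {0..B}) z)"
    proof (rule AE_I2)
      fix z assume "z \<in> space (M \<Otimes>\<^sub>M (lborel :: real measure))"
      then obtain \<omega> t where z: "z = (\<omega>, t)" "\<omega> \<in> space M" by (auto simp: space_pair_measure)
      have "\<bar>W' \<omega>\<bar> \<le> 2 * K" using W[OF z(2)] EW unfolding W'_def by linarith
      then show "norm (F z) \<le> norm (2 * K * indicator (space M \<times> {0..B}) z)"
        using z K by (auto simp: F_def indicator_def abs_mult)
    qed
  qed measurable
  have "expectation (\<lambda>\<omega>. U \<omega> * W \<omega>) - expectation U * expectation W = expectation (\<lambda>\<omega>. U \<omega> * W' \<omega>)"
    using intU intUW by (simp add: W'_def right_diff_distrib)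
  also have "\<dots> = expectation (\<lambda>\<omega>. LINT t|lborel. F (\<omega>, t))"
  proof (rule Bochner_Integration.integral_cong[OF refl])
    fix \<omega> assume \<omega>: "\<omega> \<in> space M"
    have "F (\<omega>, t) = indicator {0..<U \<omega>} t * W' \<omega>" for t using U[OF \<omega>] by (auto simp: F_def indicator_def)
    then show "U \<omega> * W' \<omega> = (LINT t|lborel. F (\<omega>, t))" using U[OF \<omega>] by simp
  qed
  also have "\<dots> = (LINT t|lborel. expectation (\<lambda>\<omega>. F (\<omega>, t)))"
    by (rule L.Fubini_integral[symmetric]) (use intF in \<open>simp add: F_def case_prod_beta'\<close>)
  also have "\<bar>\<dots>\<bar> \<le> (LINT t|lborel. c * indicator {0..<B} t)"
  proof (rule order_trans[OF integral_abs_bound], rule integral_mono)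
    have "integrable lborel (\<lambda>t. expectation (\<lambda>\<omega>. F (\<omega>, t)))"
      by (rule L.integrable_snd) (use intF in \<open>simp add: F_def case_prod_beta'\<close>)
    then show "integrable lborel (\<lambda>t. \<bar>expectation (\<lambda>\<omega>. F (\<omega>, t))\<bar>)" by simp
    show "integrable lborel (\<lambda>t. c * indicator {0..<B} t)"
      using B by (intro integrable_mult_right integrable_real_indicator) auto
    fix t :: real
    show "\<bar>expectation (\<lambda>\<omega>. F (\<omega>, t))\<bar> \<le> c * indicator {0..<B} t"
    proof (cases "t \<in> {0..<B}")
      case True
      let ?I = "\<lambda>\<omega>. indicator {\<omega>. t < U \<omega>} \<omega> :: real"
      have intI: "integrable M ?I" by (rule integrable_const_bound[of _ 1]) (auto simp: indicator_def)
      have intIW: "integrable M (\<lambda>\<omega>. ?I \<omega> * W \<omega>)"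
        by (rule integrable_const_bound[of _ K]) (use W K in \<open>auto simp: indicator_def\<close>)
      have "expectation (\<lambda>\<omega>. F (\<omega>, t)) = expectation (\<lambda>\<omega>. ?I \<omega> * W \<omega> - ?I \<omega> * expectation W)"
        using True by (intro Bochner_Integration.integral_cong) (auto simp: F_def W'_def indicator_def)
      also have "\<dots> = expectation (\<lambda>\<omega>. ?I \<omega> * W \<omega>) - expectation ?I * expectation W"
        using intI intIW by simp
      also have "expectation ?I = expectation (indicator {\<omega>\<in>space M. t < U \<omega>})"
        by (intro Bochner_Integration.integral_cong) (auto simp: indicator_def)
      also have "\<dots> = prob {\<omega>\<in>space M. t < U \<omega>}" by simp
      finally show ?thesis using c[of t] True by simp
    next
      case False
      then have "F (\<omega>, t) = 0" for \<omega> by (auto simp: F_def indicator_def)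
      then show ?thesis using False by simp
    qed
  qed
  also have "\<dots> = B * c" using B by simp
  finally show ?thesis .
qed

text \<open>Applying the reduction to level sets in both factors leaves the covariances of events.\<close>
lemma (in prob_space) covariance_le_of_events:
  fixes U V :: "'a \<Rightarrow> real"
  assumes [measurable]: "U \<in> borel_measurable M" "V \<in> borel_measurable M"
    and U: "\<And>\<omega>. \<omega> \<in> space M \<Longrightarrow> 0 \<le> U \<omega> \<and> U \<omega> \<le> B"
    and V: "\<And>\<omega>. \<omega> \<in> space M \<Longrightarrow> 0 \<le> V \<omega> \<and> V \<omega> \<le> B"
    and a: "\<And>s t. \<bar>prob ({\<omega>\<in>space M. s < U \<omega>} \<inter> {\<omega>\<in>space M. t < V \<omega>}) -
        prob {\<omega>\<in>space M. s < U \<omega>} * prob {\<omega>\<in>space M. t < V \<omega>}\<bar> \<le> a"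
  shows "\<bar>expectation (\<lambda>\<omega>. U \<omega> * V \<omega>) - expectation U * expectation V\<bar> \<le> B\<^sup>2 * a"
proof -
  have "\<bar>expectation (\<lambda>\<omega>. U \<omega> * V \<omega>) - expectation U * expectation V\<bar> \<le> B * (B * a)"
  proof (rule covariance_le_of_level_sets[where K = B])
    fix s :: real
    let ?I = "\<lambda>\<omega>. indicator {\<omega>\<in>space M. s < U \<omega>} \<omega> :: real"
    have "\<bar>expectation (\<lambda>\<omega>. V \<omega> * ?I \<omega>) - expectation V * expectation ?I\<bar> \<le> B * a"
    proof (rule covariance_le_of_level_sets[where K = 1])
      fix t :: real
      have "(\<lambda>\<omega>. indicator {\<omega>. t < V \<omega>} \<omega> * ?I \<omega>) = (\<lambda>\<omega>. indicator ({\<omega>\<in>space M. s < U \<omega>} \<inter> {\<omega>\<in>space M. t < V \<omega>}) \<omega>)"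
        by (auto simp: indicator_def)
      then show "\<bar>expectation (\<lambda>\<omega>. indicator {\<omega>. t < V \<omega>} \<omega> * ?I \<omega>) - prob {\<omega>\<in>space M. t < V \<omega>} * expectation ?I\<bar> \<le> a"
        using a[of s t] by (simp add: mult.commute)
    qed (use V in \<open>auto simp: indicator_def\<close>)
    moreover have "expectation (\<lambda>\<omega>. V \<omega> * ?I \<omega>) = expectation (\<lambda>\<omega>. indicator {\<omega>. s < U \<omega>} \<omega> * V \<omega>)"
      by (intro Bochner_Integration.integral_cong) (auto simp: indicator_def)
    ultimately show "\<bar>expectation (\<lambda>\<omega>. indicator {\<omega>. s < U \<omega>} \<omega> * V \<omega>) - prob {\<omega>\<in>space M. s < U \<omega>} * expectation V\<bar> \<le> B * a"
      by (simp add: mult.commute)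
  qed (use U V in auto)
  then show ?thesis by (simp add: power2_eq_square mult.assoc)
qed

lemma (in prob_space) abs_event_covariance_le_one: "\<bar>prob (C \<inter> D) - prob C * prob D\<bar> \<le> 1"
proof -
  have "0 \<le> prob C * prob D" "prob C * prob D \<le> 1" by (auto intro!: mult_le_one)
  moreover have "0 \<le> prob (C \<inter> D)" "prob (C \<inter> D) \<le> 1" by auto
  ultimately show ?thesis by linarith
qed

text \<open>
  The suprema in the mixing coefficient are over sets bounded by one, so they are genuine upper bounds.
\<close>
lemma strong_mixing_coeff_ge:
  assumes "prob_space M" and k: "1 \<le> k"
    and A: "A \<in> generated_events M X {1..k}" and B: "B \<in> generated_events M X {k + n..}"
  shows "\<bar>measure M (A \<inter> B) - measure M A * measure M B\<bar> \<le> strong_mixing_coeff M X n"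
proof -
  interpret prob_space M by fact
  let ?g = "\<lambda>(A, B). \<bar>prob (A \<inter> B) - prob A * prob B\<bar>"
  let ?S = "\<lambda>k. generated_events M X {1..k} \<times> generated_events M X {k + n..}"
  have bd: "bdd_above (?g ` T)" for T by (rule bdd_aboveI[of _ 1]) (auto simp: abs_event_covariance_le_one)
  have ne: "?S k \<noteq> {}" for k
    by (auto simp: generated_events_def intro: sigma_sets.Empty)
  have sup1: "(SUP z\<in>?S k. ?g z) \<le> 1" for k
    by (rule cSUP_least[OF ne]) (auto simp: abs_event_covariance_le_one)
  have "\<bar>prob (A \<inter> B) - prob A * prob B\<bar> \<le> (SUP z\<in>?S k. ?g z)"
    using cSUP_upper[OF _ bd, of "(A, B)" "?S k"] A B by simp
  also have "\<dots> \<le> (SUP k\<in>{1..}. SUP z\<in>?S k. ?g z)"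
  proof (rule cSUP_upper)
    show "bdd_above ((\<lambda>k. SUP z\<in>?S k. ?g z) ` {1..})"
      by (rule bdd_aboveI[of _ 1]) (use sup1 in blast)
  qed (use k in auto)
  finally show ?thesis by (simp add: strong_mixing_coeff_def)
qed

lemma strong_mixing_coeff_nonneg:
  assumes "prob_space M"
  shows "0 \<le> strong_mixing_coeff M X n"
  using strong_mixing_coeff_ge[OF assms order_refl, of "{}" X "{}" n]
  by (simp add: generated_events_def sigma_sets.Empty)

lemma strong_mixing_coeff_le_one:
  assumes "prob_space M"
  shows "strong_mixing_coeff M X n \<le> 1"
proof -
  interpret prob_space M by fact
  have ne: "generated_events M X {1..k} \<times> generated_events M X {k + n..} \<noteq> {}" for k
    by (auto simp: generated_events_def intro: sigma_sets.Empty)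
  show ?thesis unfolding strong_mixing_coeff_def
    by (intro cSUP_least ne) (auto simp: abs_event_covariance_le_one)
qed

lemma covariance_strong_mixing:
  fixes X :: "nat \<Rightarrow> 'a \<Rightarrow> 'b::topological_space" and k :: "'b \<Rightarrow> real"
  assumes "prob_space M" and ij: "1 \<le> i" "i < j"
    and X: "X i \<in> borel_measurable M" "X j \<in> borel_measurable M"
    and k: "k \<in> borel_measurable borel" and bd: "\<And>x. 0 \<le> k x \<and> k x \<le> B"
  shows "\<bar>(LINT \<omega>|M. k (X i \<omega>) * k (X j \<omega>)) - (LINT \<omega>|M. k (X i \<omega>)) * (LINT \<omega>|M. k (X j \<omega>))\<bar>
    \<le> B\<^sup>2 * strong_mixing_coeff M X (j - i)"
proof -
  interpret prob_space M by fact
  have ev: "{\<omega> \<in> space M. t < k (X l \<omega>)} \<in> generated_events M X I" if "l \<in> I" for t l I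
  proof -
    have "{\<omega> \<in> space M. t < k (X l \<omega>)} = X l -` {x. t < k x} \<inter> space M" by auto
    moreover have "{x. t < k x} \<in> sets borel" using k by measurable
    ultimately show ?thesis using that unfolding generated_events_def by (intro sigma_sets.Basic) blast
  qed
  show ?thesis
  proof (rule covariance_le_of_events)
    fix s t :: real
    show "\<bar>prob ({\<omega> \<in> space M. s < k (X i \<omega>)} \<inter> {\<omega> \<in> space M. t < k (X j \<omega>)}) -
        prob {\<omega> \<in> space M. s < k (X i \<omega>)} * prob {\<omega> \<in> space M. t < k (X j \<omega>)}\<bar> \<le> strong_mixing_coeff M X (j - i)"
      using ij by (intro strong_mixing_coeff_ge[OF \<open>prob_space M\<close> ij(1)] ev) auto
  qed (use X k bd in auto)
qed

text \<open>
  The covariance is the integral of \<open>k x * k y\<close> against \<open>g x y - f x * f y\<close>. Where the latter is at most \<open>T\<close>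
  in absolute value the contribution is at most \<open>T\<close>, since \<open>k\<close> has integral at most one; elsewhere it is
  dominated by its \<open>p\<close>-th power times \<open>T powr (1 - p)\<close>. For \<open>T = B powr (2 / p)\<close> both parts have the size
  that Hoelder's inequality gives.
\<close>
lemma covariance_joint_density:
  fixes X Y :: "'a \<Rightarrow> 'b::euclidean_space" and k f :: "'b \<Rightarrow> real" and g :: "'b \<Rightarrow> 'b \<Rightarrow> real"
  assumes "prob_space M"
    and X: "distributed M lborel X (\<lambda>x. ennreal (f x))" and Y: "distributed M lborel Y (\<lambda>x. ennreal (f x))"
    and XY: "distributed M (lborel \<Otimes>\<^sub>M lborel) (\<lambda>\<omega>. (X \<omega>, Y \<omega>)) (\<lambda>(x, y). ennreal (g x y))"
    and f0: "\<And>x. 0 \<le> f x" and g0: "\<And>x y. 0 \<le> g x y"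
    and k[measurable]: "k \<in> borel_measurable borel" and bd: "\<And>x. 0 \<le> k x \<and> k x \<le> B"
    and supp: "\<And>x. x \<notin> S \<Longrightarrow> k x = 0" and S[measurable]: "S \<in> sets borel"
    and intk: "integrable lborel k" and k1: "(LINT x|lborel. k x) \<le> 1"
    and p: "1 < p"
    and h: "set_integrable (lborel \<Otimes>\<^sub>M lborel) (S \<times> S) (\<lambda>(x, y). \<bar>g x y - f x * f y\<bar> powr p)"
    and hH: "(LINT (x, y) : S \<times> S | lborel \<Otimes>\<^sub>M lborel. \<bar>g x y - f x * f y\<bar> powr p) \<le> H"
    and T: "0 < T"
  shows "\<bar>(LINT \<omega>|M. k (X \<omega>) * k (Y \<omega>)) - (LINT \<omega>|M. k (X \<omega>)) * (LINT \<omega>|M. k (Y \<omega>))\<bar>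
    \<le> T + B\<^sup>2 * T powr (1 - p) * H"
proof -
  interpret prob_space M by fact
  let ?L = "lborel \<Otimes>\<^sub>M lborel :: ('b \<times> 'b) measure"
  have B: "0 \<le> B" using bd[of undefined] by linarith
  have fm[measurable]: "f \<in> borel_measurable borel" using distributed_real_measurable[OF f0 X] by simp
  have XY': "distributed M ?L (\<lambda>\<omega>. (X \<omega>, Y \<omega>)) (\<lambda>z. ennreal (case z of (x, y) \<Rightarrow> g x y))"
    using XY by (simp add: case_prod_beta')
  have gm[measurable]: "(\<lambda>(x, y). g x y) \<in> borel_measurable ?L"
    using distributed_real_measurable[OF _ XY'] g0 by auto
  have E1: "(LINT \<omega>|M. k (Z \<omega>)) = (LINT x|lborel. f x * k x)" if "distributed M lborel Z (\<lambda>x. ennreal (f x))" for Z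
    using distributed_integral[OF that, of k] f0 by simp
  have E2: "(LINT \<omega>|M. k (X \<omega>) * k (Y \<omega>)) = (LINT z|?L. (case z of (x, y) \<Rightarrow> g x y) * (k (fst z) * k (snd z)))"
    using distributed_integral[OF XY', of "\<lambda>z. k (fst z) * k (snd z)"] g0 by auto
  have intf: "integrable lborel f"
    using distributed_integrable[OF X, of "\<lambda>_. 1"] f0 by simp
  have intfk: "integrable lborel (\<lambda>x. f x * k x)"
  proof (rule Bochner_Integration.integrable_bound)
    show "integrable lborel (\<lambda>x. B * f x)" using intf by simp
    show "AE x in lborel. norm (f x * k x) \<le> norm (B * f x)"
      using bd f0 B by (intro AE_I2) (simp add: abs_mult mult.commute[of B] mult_left_mono)
  qed measurable
  have prod_int: "integrable ?L (\<lambda>z. u (fst z) * v (snd z))" and prod_eq: "(LINT z|?L. u (fst z) * v (snd z)) = (LINT x|lborel. u x) * (LINT x|lborel. v x)"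
    if [measurable]: "u \<in> borel_measurable borel" "v \<in> borel_measurable borel" and uv: "integrable lborel u" "integrable lborel v" for u v :: "'b \<Rightarrow> real"
  proof -
    show i: "integrable ?L (\<lambda>z. u (fst z) * v (snd z))"
      by (rule lborel_pair.Fubini_integrable) (use uv in \<open>auto simp: abs_mult\<close>)
    have "(LINT x|lborel. LINT y|lborel. u x * v y) = (LINT z|?L. u (fst z) * v (snd z))"
      using lborel_pair.integral_fst'[OF i] by simp
    then show "(LINT z|?L. u (fst z) * v (snd z)) = (LINT x|lborel. u x) * (LINT x|lborel. v x)" by simp
  qed
  define \<eta> where "\<eta> z = (case z of (x, y) \<Rightarrow> g x y - f x * f y)" for z
  have [measurable]: "\<eta> \<in> borel_measurable ?L" unfolding \<eta>_def case_prod_beta' by measurable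
  define kk where "kk z = k (fst z) * k (snd z)" for z
  have [measurable]: "kk \<in> borel_measurable ?L" unfolding kk_def by measurable
  have intkk: "integrable ?L kk" and Ikk: "(LINT z|?L. kk z) = (LINT x|lborel. k x) * (LINT x|lborel. k x)"
    unfolding kk_def by (intro prod_int prod_eq k intk)+
  have kk: "0 \<le> kk z" "kk z \<le> B\<^sup>2 * indicator (S \<times> S) z" for z
    using bd supp B by (auto simp: kk_def power2_eq_square indicator_def mem_Times_iff intro!: mult_mono)
  have "integrable M (\<lambda>\<omega>. k (X \<omega>) * k (Y \<omega>))"
    using distributed_measurable[OF X] distributed_measurable[OF Y] bd B
    by (intro integrable_const_bound[of _ "B * B"]) (auto simp: abs_mult intro!: mult_mono)
  then have intg: "integrable ?L (\<lambda>z. (case z of (x, y) \<Rightarrow> g x y) * (k (fst z) * k (snd z)))"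
    using distributed_integrable[OF XY', of "\<lambda>z. k (fst z) * k (snd z)"] g0 by auto
  have intff: "integrable ?L (\<lambda>z. (f (fst z) * k (fst z)) * (f (snd z) * k (snd z)))"
    by (rule prod_int) (use intfk in auto)
  have intH: "integrable ?L (\<lambda>z. indicator (S \<times> S) z * \<bar>\<eta> z\<bar> powr p)"
    using h by (simp add: set_integrable_def \<eta>_def case_prod_beta')
  have HE: "(LINT z|?L. indicator (S \<times> S) z * \<bar>\<eta> z\<bar> powr p) \<le> H"
    using hH by (simp add: set_lebesgue_integral_def \<eta>_def case_prod_beta')
  have intkh: "integrable ?L (\<lambda>z. kk z * \<eta> z)"
    using Bochner_Integration.integrable_diff[OF intg intff]
    by (simp add: kk_def \<eta>_def case_prod_beta' algebra_simps)
  have "(LINT \<omega>|M. k (X \<omega>) * k (Y \<omega>)) - (LINT \<omega>|M. k (X \<omega>)) * (LINT \<omega>|M. k (Y \<omega>)) =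
    (LINT z|?L. (case z of (x, y) \<Rightarrow> g x y) * (k (fst z) * k (snd z))) -
    (LINT z|?L. (f (fst z) * k (fst z)) * (f (snd z) * k (snd z)))"
    unfolding E2 E1[OF X] E1[OF Y] by (subst prod_eq) (use intfk in auto)
  also have "\<dots> = (LINT z|?L. kk z * \<eta> z)"
    using Bochner_Integration.integral_diff[OF intg intff]
    by (simp add: kk_def \<eta>_def case_prod_beta' algebra_simps)
  finally have cov: "(LINT \<omega>|M. k (X \<omega>) * k (Y \<omega>)) - (LINT \<omega>|M. k (X \<omega>)) * (LINT \<omega>|M. k (Y \<omega>)) = \<dots>" .
  have split: "a \<le> T + a powr p * T powr (1 - p)" if "0 \<le> a" for a
  proof (cases "a \<le> T")
    case True then show ?thesis by (simp add: add_increasing2)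
  next
    case False
    have "a powr p * a powr (1 - p) = a" using False T by (simp add: powr_add[symmetric])
    moreover have "a powr (1 - p) \<le> T powr (1 - p)" using False T p by (intro powr_mono2') auto
    then have "a powr p * a powr (1 - p) \<le> a powr p * T powr (1 - p)" by (intro mult_left_mono) auto
    ultimately show ?thesis using T by linarith
  qed
  have "\<bar>LINT z|?L. kk z * \<eta> z\<bar> \<le> (LINT z|?L. \<bar>kk z * \<eta> z\<bar>)" by (rule integral_abs_bound)
  also have "\<dots> \<le> (LINT z|?L. T * kk z + B\<^sup>2 * T powr (1 - p) * (indicator (S \<times> S) z * \<bar>\<eta> z\<bar> powr p))"
  proof (rule integral_mono)
    show "integrable ?L (\<lambda>z. \<bar>kk z * \<eta> z\<bar>)" using intkh by simp
    show "integrable ?L (\<lambda>z. T * kk z + B\<^sup>2 * T powr (1 - p) * (indicator (S \<times> S) z * \<bar>\<eta> z\<bar> powr p))"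
      using intkk intH by (intro Bochner_Integration.integrable_add integrable_mult_right)
    fix z
    have "\<bar>kk z * \<eta> z\<bar> \<le> kk z * (T + \<bar>\<eta> z\<bar> powr p * T powr (1 - p))"
      using kk(1)[of z] split[of "\<bar>\<eta> z\<bar>"] by (simp add: abs_mult mult_left_mono)
    also have "\<dots> = T * kk z + kk z * (\<bar>\<eta> z\<bar> powr p * T powr (1 - p))" by (simp add: algebra_simps)
    also have "\<dots> \<le> T * kk z + (B\<^sup>2 * indicator (S \<times> S) z) * (\<bar>\<eta> z\<bar> powr p * T powr (1 - p))"
      by (intro add_left_mono mult_right_mono kk) auto
    finally show "\<bar>kk z * \<eta> z\<bar> \<le> T * kk z + B\<^sup>2 * T powr (1 - p) * (indicator (S \<times> S) z * \<bar>\<eta> z\<bar> powr p)"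
      by (simp add: mult_ac)
  qed
  also have "\<dots> = T * ((LINT x|lborel. k x) * (LINT x|lborel. k x)) + B\<^sup>2 * T powr (1 - p) * (LINT z|?L. indicator (S \<times> S) z * \<bar>\<eta> z\<bar> powr p)"
    using intkk intH by (simp add: Ikk)
  also have "\<dots> \<le> T * 1 + B\<^sup>2 * T powr (1 - p) * H"
  proof (intro add_mono mult_left_mono HE)
    have "0 \<le> (LINT x|lborel. k x)" using bd by (intro Bochner_Integration.integral_nonneg) auto
    then show "(LINT x|lborel. k x) * (LINT x|lborel. k x) \<le> 1" using k1 by (intro mult_le_one)
  qed (use T in auto)
  finally show ?thesis unfolding cov by simp
qed

lemma sum_off_diagonal_le:
  fixes g :: "nat \<Rightarrow> real"
  assumes g: "summable g" "\<And>k. 0 \<le> g k"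
  shows "(\<Sum>i = 1..n. \<Sum>j\<in>{1..n} - {i}. g (if i < j then j - i else i - j)) \<le> real n * (2 * suminf g)"
proof -
  have "(\<Sum>j\<in>{1..n} - {i}. g (if i < j then j - i else i - j)) \<le> 2 * suminf g" if "i \<in> {1..n}" for i
  proof -
    have "{1..n} - {i} = {i<..n} \<union> {1..<i}" using that by auto
    then have "(\<Sum>j\<in>{1..n} - {i}. g (if i < j then j - i else i - j)) =
        (\<Sum>j\<in>{i<..n} \<union> {1..<i}. g (if i < j then j - i else i - j))" by metis
    also have "\<dots> = (\<Sum>j\<in>{i<..n}. g (if i < j then j - i else i - j)) + (\<Sum>j\<in>{1..<i}. g (if i < j then j - i else i - j))"
      by (rule sum.union_disjoint) auto
    also have "(\<Sum>j\<in>{i<..n}. g (if i < j then j - i else i - j)) = (\<Sum>j\<in>{i<..n}. g (j - i))"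
      by (intro sum.cong) auto
    also have "(\<Sum>j\<in>{1..<i}. g (if i < j then j - i else i - j)) = (\<Sum>j\<in>{1..<i}. g (i - j))"
      by (intro sum.cong) auto
    also have "(\<Sum>j\<in>{i<..n}. g (j - i)) = sum g ((\<lambda>j. j - i) ` {i<..n})"
      by (subst sum.reindex) (auto simp: inj_on_def)
    also have "(\<Sum>j\<in>{1..<i}. g (i - j)) = sum g ((\<lambda>j. i - j) ` {1..<i})"
      by (subst sum.reindex) (auto simp: inj_on_def)
    also have "sum g ((\<lambda>j. j - i) ` {i<..n}) + sum g ((\<lambda>j. i - j) ` {1..<i}) \<le> suminf g + suminf g"
      using g by (intro add_mono sum_le_suminf) auto
    finally show ?thesis by simp
  qed
  then have "(\<Sum>i = 1..n. \<Sum>j\<in>{1..n} - {i}. g (if i < j then j - i else i - j)) \<le> (\<Sum>i = 1..n. 2 * suminf g)"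
    by (intro sum_mono)
  then show ?thesis by simp
qed

section \<open>Covariances of the summands\<close>

lemma (in prob_space) mean_square_error_decomposition:
  fixes Y :: "nat \<Rightarrow> 'a \<Rightarrow> real"
  assumes n: "1 \<le> n"
    and Y: "\<And>i. i \<in> {1..n} \<Longrightarrow> Y i \<in> borel_measurable M"
    and bd: "\<And>i \<omega>. i \<in> {1..n} \<Longrightarrow> \<omega> \<in> space M \<Longrightarrow> \<bar>Y i \<omega>\<bar> \<le> B"
    and m: "\<And>i. i \<in> {1..n} \<Longrightarrow> expectation (Y i) = m"
    and v: "\<And>i. i \<in> {1..n} \<Longrightarrow> expectation (\<lambda>\<omega>. Y i \<omega> * Y i \<omega>) = v"
  shows "expectation (\<lambda>\<omega>. (1 / real n * (\<Sum>i = 1..n. Y i \<omega>) - c)\<^sup>2) =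
    (m - c)\<^sup>2 + (v - m\<^sup>2) / real n +
    (\<Sum>i = 1..n. \<Sum>j\<in>{1..n} - {i}. expectation (\<lambda>\<omega>. Y i \<omega> * Y j \<omega>) - m\<^sup>2) / (real n)\<^sup>2"
proof -
  let ?c = "\<lambda>i j. expectation (\<lambda>\<omega>. Y i \<omega> * Y j \<omega>)"
  have intY: "integrable M (Y i)" if "i \<in> {1..n}" for i
    by (rule integrable_const_bound[of _ B]) (use Y bd that in auto)
  have intYY: "integrable M (\<lambda>\<omega>. Y i \<omega> * Y j \<omega>)" if ij: "i \<in> {1..n}" "j \<in> {1..n}" for i j
  proof (rule integrable_const_bound[of _ "B * B"])
    show "AE \<omega> in M. norm (Y i \<omega> * Y j \<omega>) \<le> B * B"
    proof (rule AE_I2)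
      fix \<omega> assume \<omega>: "\<omega> \<in> space M"
      have "0 \<le> B" using bd[OF ij(1) \<omega>] by linarith
      then show "norm (Y i \<omega> * Y j \<omega>) \<le> B * B"
        unfolding real_norm_def abs_mult using bd[OF ij(1) \<omega>] bd[OF ij(2) \<omega>] by (intro mult_mono) auto
    qed
  qed (use Y ij in auto)
  have "(1 / real n * (\<Sum>i = 1..n. Y i \<omega>) - c)\<^sup>2 =
      (\<Sum>i = 1..n. \<Sum>j = 1..n. Y i \<omega> * Y j \<omega>) / (real n)\<^sup>2 - 2 * c / real n * (\<Sum>i = 1..n. Y i \<omega>) + c\<^sup>2" for \<omega>
  proof -
    have "(1 / real n * S - c)\<^sup>2 = S * S / (real n)\<^sup>2 - 2 * c / real n * S + c\<^sup>2" for S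
      using n by (simp add: power2_eq_square field_simps)
    then show ?thesis unfolding sum_product[symmetric] .
  qed
  note square = this
  have int1: "integrable M (\<lambda>\<omega>. \<Sum>i = 1..n. Y i \<omega>)"
    by (intro Bochner_Integration.integrable_sum intY)
  have int2: "integrable M (\<lambda>\<omega>. \<Sum>i = 1..n. \<Sum>j = 1..n. Y i \<omega> * Y j \<omega>)"
    by (intro Bochner_Integration.integrable_sum intYY)
  have "expectation (\<lambda>\<omega>. \<Sum>i = 1..n. \<Sum>j = 1..n. Y i \<omega> * Y j \<omega>) = (\<Sum>i = 1..n. expectation (\<lambda>\<omega>. \<Sum>j = 1..n. Y i \<omega> * Y j \<omega>))"
    by (intro Bochner_Integration.integral_sum Bochner_Integration.integrable_sum intYY)
  also have "\<dots> = (\<Sum>i = 1..n. \<Sum>j = 1..n. ?c i j)"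
    by (intro sum.cong refl Bochner_Integration.integral_sum intYY)
  finally have E2: "expectation (\<lambda>\<omega>. \<Sum>i = 1..n. \<Sum>j = 1..n. Y i \<omega> * Y j \<omega>) = \<dots>" .
  have E1: "expectation (\<lambda>\<omega>. \<Sum>i = 1..n. Y i \<omega>) = (\<Sum>i = 1..n. expectation (Y i))"
    by (intro Bochner_Integration.integral_sum intY)
  have "expectation (\<lambda>\<omega>. (1 / real n * (\<Sum>i = 1..n. Y i \<omega>) - c)\<^sup>2) =
      expectation (\<lambda>\<omega>. \<Sum>i = 1..n. \<Sum>j = 1..n. Y i \<omega> * Y j \<omega>) / (real n)\<^sup>2 -
      2 * c / real n * expectation (\<lambda>\<omega>. \<Sum>i = 1..n. Y i \<omega>) + c\<^sup>2"
    unfolding square using int1 int2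
    by (simp only: Bochner_Integration.integral_add Bochner_Integration.integral_diff Bochner_Integration.integrable_diff
      integrable_divide integrable_mult_right integrable_const integral_divide_zero integral_mult_right_zero lebesgue_integral_const)
      (simp add: prob_space)
  then have "expectation (\<lambda>\<omega>. (1 / real n * (\<Sum>i = 1..n. Y i \<omega>) - c)\<^sup>2) =
      (\<Sum>i = 1..n. \<Sum>j = 1..n. ?c i j) / (real n)\<^sup>2 - 2 * c / real n * (\<Sum>i = 1..n. expectation (Y i)) + c\<^sup>2"
    unfolding E1 E2 .
  also have "(\<Sum>i = 1..n. expectation (Y i)) = real n * m" using m by simp
  also have "(\<Sum>i = 1..n. \<Sum>j = 1..n. ?c i j) = (\<Sum>i = 1..n. v + (\<Sum>j\<in>{1..n} - {i}. ?c i j))"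
  proof (rule sum.cong[OF refl])
    fix i assume i: "i \<in> {1..n}"
    then have "(\<Sum>j = 1..n. ?c i j) = ?c i i + (\<Sum>j\<in>{1..n} - {i}. ?c i j)" by (intro sum.remove) auto
    then show "(\<Sum>j = 1..n. ?c i j) = v + (\<Sum>j\<in>{1..n} - {i}. ?c i j)" using v[OF i] by simp
  qed
  also have "\<dots> = (\<Sum>i = 1..n. v + (real n - 1) * m\<^sup>2 + (\<Sum>j\<in>{1..n} - {i}. ?c i j - m\<^sup>2))"
    using n by (intro sum.cong refl) (simp add: sum_subtractf of_nat_diff)
  also have "\<dots> = real n * (v + (real n - 1) * m\<^sup>2) + (\<Sum>i = 1..n. \<Sum>j\<in>{1..n} - {i}. ?c i j - m\<^sup>2)"
    by (simp add: sum.distrib)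
  finally have total: "expectation (\<lambda>\<omega>. (1 / real n * (\<Sum>i = 1..n. Y i \<omega>) - c)\<^sup>2) =
      (real n * (v + (real n - 1) * m\<^sup>2) + (\<Sum>i = 1..n. \<Sum>j\<in>{1..n} - {i}. ?c i j - m\<^sup>2)) / (real n)\<^sup>2 -
      2 * c / real n * (real n * m) + c\<^sup>2" .
  have "(N * (v + (N - 1) * m\<^sup>2) + W) / N\<^sup>2 - 2 * c / N * (N * m) + c\<^sup>2 = (m - c)\<^sup>2 + (v - m\<^sup>2) / N + W / N\<^sup>2"
    if "N \<noteq> 0" for N W :: real
  proof -
    have "(N * (v + (N - 1) * m\<^sup>2) + W) / N\<^sup>2 = (v + (N - 1) * m\<^sup>2) / N + W / N\<^sup>2"
      using that by (simp add: add_divide_distrib power2_eq_square)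
    moreover have "(v + (N - 1) * m\<^sup>2) / N = (v - m\<^sup>2) / N + m\<^sup>2" using that by (simp add: field_simps)
    moreover have "2 * c / N * (N * m) = 2 * m * c" using that by simp
    ultimately show ?thesis by (simp add: power2_diff)
  qed
  then show ?thesis using n unfolding total by simp
qed

text \<open>
  The interval from \<open>1 / \<nu>\<close> to \<open>(p - 2) / (2 * (p - 1))\<close> is nonempty exactly under the assumption on \<open>\<nu>\<close>; any
  \<open>\<theta>\<close> inside it serves.
\<close>
lemma exponent_gap:
  fixes p \<nu> :: real
  assumes p: "2 < p" and \<nu>: "\<nu> > 2 * (p - 1) / (p - 2)"
  obtains \<theta> where "0 < \<theta>" "\<theta> < 1" "1 < \<nu> * \<theta>" "(1 - \<theta>) / p + \<theta> < 1 / 2"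
proof -
  have q: "0 < (p - 2) / (2 * (p - 1))" using p by simp
  have \<nu>0: "0 < \<nu>" using \<nu> p by (smt (verit) divide_pos_pos)
  have "1 / \<nu> < (p - 2) / (2 * (p - 1))"
    using \<nu> \<nu>0 p by (simp add: field_simps)
  then obtain \<theta> where \<theta>: "1 / \<nu> < \<theta>" "\<theta> < (p - 2) / (2 * (p - 1))" using dense by blast
  have "0 < \<theta>" using \<theta>(1) \<nu>0 by (smt (verit) divide_pos_pos)
  moreover have lt: "\<theta> * (2 * (p - 1)) < p - 2" using \<theta>(2) p by (simp add: field_simps)
  moreover have "\<theta> < 1"
  proof (rule ccontr)
    assume "\<not> \<theta> < 1"
    then have "1 * (2 * (p - 1)) \<le> \<theta> * (2 * (p - 1))" using p by (intro mult_right_mono) auto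
    from le_less_trans[OF this lt] show False using p by simp
  qed
  moreover have "1 < \<nu> * \<theta>" using \<theta>(1) \<nu>0 by (simp add: field_simps)
  moreover have "(1 - \<theta>) / p + \<theta> < 1 / 2" using lt p by (simp add: field_simps)
  ultimately show ?thesis using that by blast
qed

lemma interpolate_bound:
  fixes c :: real
  assumes "0 \<le> c" "c \<le> x" "c \<le> y" "0 < \<theta>" "\<theta> < 1"
  shows "c \<le> x powr (1 - \<theta>) * y powr \<theta>"
proof (cases "c = 0")
  case False
  have "c = c powr (1 - \<theta>) * c powr \<theta>" using assms False by (simp add: powr_add[symmetric])
  also have "\<dots> \<le> x powr (1 - \<theta>) * y powr \<theta>" using assms by (intro mult_mono powr_mono2) auto
  finally show ?thesis .
qed simp

lemma bigo_powr_bound: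
  fixes a :: "nat \<Rightarrow> real"
  assumes O: "a \<in> O(\<lambda>n. real n powr (- \<nu>))" and bd: "\<And>n. \<bar>a n\<bar> \<le> 1"
  obtains A where "0 < A" "\<And>n. 1 \<le> n \<Longrightarrow> \<bar>a n\<bar> \<le> A * real n powr (- \<nu>)"
proof -
  obtain c where c: "0 < c" "\<forall>\<^sub>F n in sequentially. norm (a n) \<le> c * norm (real n powr (- \<nu>))"
    using landau_o.bigE[OF O] by blast
  then obtain N where N: "\<And>n. N \<le> n \<Longrightarrow> norm (a n) \<le> c * norm (real n powr (- \<nu>))"
    unfolding eventually_sequentially by blast
  have "\<bar>a n\<bar> \<le> max c (real N powr \<bar>\<nu>\<bar>) * real n powr (- \<nu>)" if n: "1 \<le> n" for n
  proof (cases "N \<le> n")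
    case True
    have "\<bar>a n\<bar> \<le> c * real n powr (- \<nu>)" using N[OF True] by simp
    also have "\<dots> \<le> max c (real N powr \<bar>\<nu>\<bar>) * real n powr (- \<nu>)" by (intro mult_right_mono) auto
    finally show ?thesis .
  next
    case False
    have "1 = real n powr \<nu> * real n powr (- \<nu>)" using n by (simp add: powr_add[symmetric])
    also have "\<dots> \<le> real N powr \<bar>\<nu>\<bar> * real n powr (- \<nu>)"
    proof (intro mult_right_mono)
      have "real n powr \<nu> \<le> real n powr \<bar>\<nu>\<bar>" using n by (intro powr_mono) auto
      also have "\<dots> \<le> real N powr \<bar>\<nu>\<bar>" using n False by (intro powr_mono2) auto
      finally show "real n powr \<nu> \<le> real N powr \<bar>\<nu>\<bar>" .
    qed auto
    also have "\<dots> \<le> max c (real N powr \<bar>\<nu>\<bar>) * real n powr (- \<nu>)" by (intro mult_right_mono) auto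
    finally show ?thesis using bd[of n] by linarith
  qed
  moreover have "0 < max c (real N powr \<bar>\<nu>\<bar>)" using c by simp
  ultimately show ?thesis using that by blast
qed

text \<open>
  The bound by the value at the mode is a statement about points of the simplex. Cutting the kernel off
  there changes nothing on the sample and gives a function to which the covariance inequalities apply.
\<close>
definition truncated_kernel :: "real ^ 'd \<Rightarrow> real \<Rightarrow> real ^ 'd \<Rightarrow> real" where
  "truncated_kernel s b x = indicator simplex_set x * dirichlet_kernel s b x"

lemma truncated_kernel_eq: "truncated_kernel s b x = indicator open_simplex x * dirichlet_kernel s b x"
  using dirichlet_density_boundary[of x] open_simplex_subset
  by (auto simp: truncated_kernel_def dirichlet_kernel_def indicator_def)

lemma borel_measurable_truncated_kernel [measurable]: "truncated_kernel s b \<in> borel_measurable borel"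
  unfolding truncated_kernel_def[abs_def] dirichlet_kernel_def by measurable

lemma truncated_kernel_bounds:
  fixes s x :: "real ^ 'd"
  assumes "s \<in> open_simplex" "0 < b"
  shows "0 \<le> truncated_kernel s b x" "truncated_kernel s b x \<le> dirichlet_kernel s b s"
  using dirichlet_kernel_nonneg[OF assms] dirichlet_kernel_le_mode[OF assms]
  by (auto simp: truncated_kernel_def indicator_def)

lemma truncated_kernel_moments:
  fixes s :: "real ^ 'd" and f :: "real ^ 'd \<Rightarrow> real"
  assumes s: "s \<in> open_simplex" and b: "0 < b" and X: "distributed M lborel X (\<lambda>x. ennreal (f x))"
    and f0: "\<And>x. 0 \<le> f x"
  shows "(LINT \<omega>|M. truncated_kernel s b (X \<omega>)) = (LINT x|kernel_measure s b. f x)"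
    and "(LINT \<omega>|M. truncated_kernel s b (X \<omega>) * truncated_kernel s b (X \<omega>)) =
      square_ratio s b * (LINT x|kernel_measure s (b / 2). f x)"
proof -
  have [measurable]: "f \<in> borel_measurable borel" using distributed_real_measurable[OF f0 X] by simp
  have "(LINT \<omega>|M. truncated_kernel s b (X \<omega>)) = (LINT x|lborel. f x * truncated_kernel s b x)"
    using distributed_integral[OF X, of "truncated_kernel s b"] f0 by simp
  also have "\<dots> = (LINT x|kernel_measure s b. f x)"
    by (simp add: integral_kernel_measure[OF s b] truncated_kernel_eq mult_ac)
  finally show "(LINT \<omega>|M. truncated_kernel s b (X \<omega>)) = (LINT x|kernel_measure s b. f x)" .
  have b2: "0 < b / 2" using b by simp
  have "(LINT \<omega>|M. truncated_kernel s b (X \<omega>) * truncated_kernel s b (X \<omega>)) =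
      (LINT x|lborel. f x * (truncated_kernel s b x * truncated_kernel s b x))"
    using distributed_integral[OF X, of "\<lambda>x. truncated_kernel s b x * truncated_kernel s b x"] f0 by simp
  also have "\<dots> = (LINT x|lborel. square_ratio s b * (indicator open_simplex x * dirichlet_kernel s (b / 2) x * f x))"
  proof (intro Bochner_Integration.integral_cong refl)
    fix x
    show "f x * (truncated_kernel s b x * truncated_kernel s b x) =
      square_ratio s b * (indicator open_simplex x * dirichlet_kernel s (b / 2) x * f x)"
      using dirichlet_kernel_square[OF s b, of x]
      by (cases "x \<in> open_simplex") (auto simp: truncated_kernel_eq power2_eq_square)
  qed
  also have "\<dots> = square_ratio s b * (LINT x|kernel_measure s (b / 2). f x)"
    by (simp add: integral_kernel_measure[OF s b2])
  finally show "(LINT \<omega>|M. truncated_kernel s b (X \<omega>) * truncated_kernel s b (X \<omega>)) = \<dots>" .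
qed

lemma kernel_measure_tendsto:
  fixes f :: "real ^ 'd \<Rightarrow> real"
  assumes smooth: "twice_cont_diff_on f simplex_set" and f: "f \<in> borel_measurable borel"
    and s: "s \<in> open_simplex"
  shows "((\<lambda>b. LINT x|kernel_measure s b. f x) \<longlongrightarrow> f s) (at_right 0)"
proof -
  obtain b0 where b0: "0 < b0" "\<And>b. 0 < b \<Longrightarrow> b < b0 \<Longrightarrow>
      \<bar>(LINT x|kernel_measure s b. f x) - f s - b * bias_coeff f s\<bar> \<le> 1 * b"
    using kernel_measure_bias[OF smooth f zero_less_one] s by blast
  have "((\<lambda>b. (LINT x|kernel_measure s b. f x) - f s) \<longlongrightarrow> 0) (at_right 0)"
  proof (rule Lim_null_comparison)
    have "\<forall>\<^sub>F b in at_right 0. b \<in> {0<..<b0}" by (rule eventually_at_right_real[OF b0(1)])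
    then show "\<forall>\<^sub>F b in at_right 0. norm ((LINT x|kernel_measure s b. f x) - f s) \<le> b * (\<bar>bias_coeff f s\<bar> + 1)"
    proof eventually_elim
      case (elim b)
      then have "\<bar>(LINT x|kernel_measure s b. f x) - f s - b * bias_coeff f s\<bar> \<le> b" using b0(2)[of b] by simp
      moreover have "\<bar>b * bias_coeff f s\<bar> = b * \<bar>bias_coeff f s\<bar>" using elim by (simp add: abs_mult)
      ultimately show ?case by (simp add: distrib_left)
    qed
    show "((\<lambda>b. b * (\<bar>bias_coeff f s\<bar> + 1)) \<longlongrightarrow> 0) (at_right 0)"
      by (auto intro!: tendsto_eq_intros)
  qed
  then show ?thesis by (rule LIM_zero_cancel)
qed

text \<open>
  Two bounds compete: the integrability of \<open>h\<close> gives \<open>b powr (- d / p)\<close> for every lag \<open>l\<close>, the mixing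
  condition gives \<open>b powr (- d) * l powr (- \<nu>)\<close>. Their geometric mean with weights \<open>1 - \<theta>\<close> and \<open>\<theta>\<close> is summable
  over the lags and still of smaller order than \<open>b powr (- d / 2)\<close>.
\<close>
lemma kernel_covariance_bound:
  fixes M :: "'a measure" and X :: "nat \<Rightarrow> 'a \<Rightarrow> real ^ 'd" and f :: "real ^ 'd \<Rightarrow> real"
    and f2 :: "nat \<Rightarrow> nat \<Rightarrow> real ^ 'd \<Rightarrow> real ^ 'd \<Rightarrow> real" and p \<nu> :: real
  assumes "prob_space M"
    and f_nonneg: "\<And>x. 0 \<le> f x"
    and X_density: "\<And>i. i \<ge> 1 \<Longrightarrow> distributed M lborel (X i) (\<lambda>x. ennreal (f x))"
    and p: "2 < p"
    and f2_nonneg: "\<And>i j x y. i \<ge> 1 \<Longrightarrow> j \<ge> 1 \<Longrightarrow> i \<noteq> j \<Longrightarrow> 0 \<le> f2 i j x y"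
    and joint_density: "\<And>i j. i \<ge> 1 \<Longrightarrow> j \<ge> 1 \<Longrightarrow> i \<noteq> j \<Longrightarrow>
          distributed M (lborel \<Otimes>\<^sub>M lborel) (\<lambda>\<omega>. (X i \<omega>, X j \<omega>)) (\<lambda>(x, y). ennreal (f2 i j x y))"
    and h_integrable: "\<And>i j. i \<ge> 1 \<Longrightarrow> j \<ge> 1 \<Longrightarrow> i \<noteq> j \<Longrightarrow>
          set_integrable (lborel \<Otimes>\<^sub>M lborel) (simplex_set \<times> simplex_set)
            (\<lambda>(x, y). \<bar>f2 i j x y - f x * f y\<bar> powr p)"
    and h_bounded: "bdd_above
          {(LINT (x, y) : simplex_set \<times> simplex_set | lborel \<Otimes>\<^sub>M lborel.
              \<bar>f2 i j x y - f x * f y\<bar> powr p) powr (1 / p) | i j. i \<ge> 1 \<and> j \<ge> 1 \<and> i \<noteq> j}"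
    and \<nu>: "\<nu> > 2 * (p - 1) / (p - 2)"
    and mixing: "strong_mixing_coeff M X \<in> O(\<lambda>n. real n powr (- \<nu>))"
    and s: "s \<in> open_simplex"
  obtains K \<beta> \<gamma> where "0 < K" "\<beta> < 1 / 2" "1 < \<gamma>"
    "\<And>b i j. 0 < b \<Longrightarrow> b \<le> 1 \<Longrightarrow> 1 \<le> i \<Longrightarrow> 1 \<le> j \<Longrightarrow> i \<noteq> j \<Longrightarrow>
       \<bar>(LINT \<omega>|M. truncated_kernel s b (X i \<omega>) * truncated_kernel s b (X j \<omega>)) -
         (LINT \<omega>|M. truncated_kernel s b (X i \<omega>)) * (LINT \<omega>|M. truncated_kernel s b (X j \<omega>))\<bar>
       \<le> K * b powr (- (real CARD('d) * \<beta>)) * real (if i < j then j - i else i - j) powr (- \<gamma>)"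
proof -
  interpret prob_space M by fact
  let ?d = "real CARD('d)"
  obtain \<theta> where \<theta>: "0 < \<theta>" "\<theta> < 1" "1 < \<nu> * \<theta>" "(1 - \<theta>) / p + \<theta> < 1 / 2"
    by (rule exponent_gap[OF p \<nu>])
  define \<beta> where "\<beta> = (1 - \<theta>) / p + \<theta>"
  obtain C where C: "0 < C" "\<And>b. 0 < b \<Longrightarrow> b \<le> 1 \<Longrightarrow> dirichlet_kernel s b s \<le> C * b powr (- (?d / 2))"
    using dirichlet_kernel_mode_bound[OF s] by blast
  obtain A where A: "0 < A" "\<And>n. 1 \<le> n \<Longrightarrow> \<bar>strong_mixing_coeff M X n\<bar> \<le> A * real n powr (- \<nu>)"
    using bigo_powr_bound[OF mixing] strong_mixing_coeff_nonneg[OF \<open>prob_space M\<close>]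
      strong_mixing_coeff_le_one[OF \<open>prob_space M\<close>] by (metis abs_of_nonneg)
  define I where "I i j = (LINT (x, y) : simplex_set \<times> simplex_set | lborel \<Otimes>\<^sub>M lborel.
              \<bar>f2 i j x y - f x * f y\<bar> powr p)" for i j
  obtain H where H: "0 \<le> H" "\<And>i j. i \<ge> 1 \<Longrightarrow> j \<ge> 1 \<Longrightarrow> i \<noteq> j \<Longrightarrow> I i j \<le> H"
  proof -
    obtain M0 where M0: "\<And>i j. i \<ge> 1 \<Longrightarrow> j \<ge> 1 \<Longrightarrow> i \<noteq> j \<Longrightarrow> I i j powr (1 / p) \<le> M0"
      using h_bounded unfolding I_def bdd_above_def by blast
    have I0: "0 \<le> I i j" for i j
      unfolding I_def set_lebesgue_integral_def by (intro Bochner_Integration.integral_nonneg) auto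
    have "I i j \<le> \<bar>M0\<bar> powr p" if "i \<ge> 1" "j \<ge> 1" "i \<noteq> j" for i j
    proof -
      have "I i j = (I i j powr (1 / p)) powr p" using p I0[of i j] by (simp add: powr_powr)
      also have "\<dots> \<le> \<bar>M0\<bar> powr p" using M0[OF that] p by (intro powr_mono2) auto
      finally show ?thesis .
    qed
    then show ?thesis using that[of "\<bar>M0\<bar> powr p"] by simp
  qed
  define K where "K = ((1 + H) * C powr (2 / p)) powr (1 - \<theta>) * (C\<^sup>2 * A) powr \<theta>"
  have "0 < K" unfolding K_def using H(1) C(1) A(1) by simp
  moreover have "\<beta> < 1 / 2" using \<theta> by (simp add: \<beta>_def)
  moreover have "1 < \<nu> * \<theta>" by (rule \<theta>)
  moreover have "\<bar>(LINT \<omega>|M. truncated_kernel s b (X i \<omega>) * truncated_kernel s b (X j \<omega>)) -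
         (LINT \<omega>|M. truncated_kernel s b (X i \<omega>)) * (LINT \<omega>|M. truncated_kernel s b (X j \<omega>))\<bar>
       \<le> K * b powr (- (?d * \<beta>)) * real (if i < j then j - i else i - j) powr (- (\<nu> * \<theta>))"
    if b: "0 < b" "b \<le> 1" and ij: "1 \<le> i" "1 \<le> j" "i \<noteq> j" for b i j
  proof -
    let ?k = "truncated_kernel s b"
    define cov where "cov i j = \<bar>(LINT \<omega>|M. ?k (X i \<omega>) * ?k (X j \<omega>)) -
         (LINT \<omega>|M. ?k (X i \<omega>)) * (LINT \<omega>|M. ?k (X j \<omega>))\<bar>" for i j
    have cov_sym: "cov i j = cov j i" for i j by (simp add: cov_def mult.commute)
    define B where "B = C * b powr (- (?d / 2))"
    have B: "0 < B" using C(1) b by (simp add: B_def)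
    have k: "0 \<le> ?k x \<and> ?k x \<le> B" for x
      using truncated_kernel_bounds[OF s b(1), of x] C(2)[OF b] by (auto simp: B_def)
    have Bpow: "B powr e = C powr e * b powr (- (?d / 2 * e))" for e
      using C(1) b by (simp add: B_def powr_mult powr_powr)
    have near: "cov i j \<le> (1 + H) * B powr (2 / p)"
    proof -
      let ?T = "B powr (2 / p)"
      have "cov i j \<le> ?T + B\<^sup>2 * ?T powr (1 - p) * H"
        unfolding cov_def
      proof (rule covariance_joint_density[OF \<open>prob_space M\<close> X_density[OF ij(1)] X_density[OF ij(2)]
            joint_density[OF ij] f_nonneg f2_nonneg[OF ij] _ _ _ sets_simplex_set _ _ _ h_integrable[OF ij]])
        show "0 \<le> ?k x \<and> ?k x \<le> B" for x by (rule k)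
        show "?k x = 0" if "x \<notin> simplex_set" for x using that by (simp add: truncated_kernel_def)
        show "integrable lborel ?k" "(LINT x|lborel. ?k x) \<le> 1"
          unfolding truncated_kernel_eq[abs_def] using dirichlet_kernel_integral[OF s b(1)] by simp_all
        show "(LINT (x, y) : simplex_set \<times> simplex_set | lborel \<Otimes>\<^sub>M lborel. \<bar>f2 i j x y - f x * f y\<bar> powr p) \<le> H"
          using H(2)[OF ij] by (simp add: I_def)
      qed (use p B in auto)
      also have "B\<^sup>2 * ?T powr (1 - p) = ?T"
      proof -
        have "B\<^sup>2 * ?T powr (1 - p) = B powr 2 * B powr (2 / p * (1 - p))" using B by (simp add: powr_powr)
        also have "\<dots> = B powr (2 + 2 / p * (1 - p))" by (rule powr_add[symmetric])
        also have "2 + 2 / p * (1 - p) = 2 / p" using p by (simp add: field_simps)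
        finally show ?thesis .
      qed
      finally show ?thesis by (simp add: algebra_simps)
    qed
    have far: "cov i j \<le> B\<^sup>2 * (A * real (j - i) powr (- \<nu>))" if "1 \<le> i" "i < j" for i j
    proof -
      have "X i \<in> borel_measurable M" "X j \<in> borel_measurable M"
        using distributed_measurable[OF X_density[of i]] distributed_measurable[OF X_density[of j]] that by auto
      then have "cov i j \<le> B\<^sup>2 * strong_mixing_coeff M X (j - i)"
        unfolding cov_def by (intro covariance_strong_mixing[OF \<open>prob_space M\<close> that _ _ _ k]) auto
      also have "\<dots> \<le> B\<^sup>2 * (A * real (j - i) powr (- \<nu>))"
        using abs_le_D1[OF A(2)[of "j - i"]] that by (intro mult_left_mono) auto
      finally show ?thesis .
    qed
    define l where "l = (if i < j then j - i else i - j)"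
    have far': "cov i j \<le> B\<^sup>2 * (A * real l powr (- \<nu>))"
      using far[of i j] far[of j i] ij cov_sym[of i j] by (auto simp: l_def)
    have "cov i j \<le> ((1 + H) * B powr (2 / p)) powr (1 - \<theta>) * (B\<^sup>2 * (A * real l powr (- \<nu>))) powr \<theta>"
      using near far' \<theta> by (intro interpolate_bound) (auto simp: cov_def)
    also have "(1 + H) * B powr (2 / p) = ((1 + H) * C powr (2 / p)) * b powr (- (?d / p))"
      by (simp add: Bpow)
    also have "B\<^sup>2 * (A * real l powr (- \<nu>)) = (C\<^sup>2 * A) * (b powr (- ?d) * real l powr (- \<nu>))"
      using Bpow[of 2] B C(1) by simp
    also have "(((1 + H) * C powr (2 / p)) * b powr (- (?d / p))) powr (1 - \<theta>) *
        ((C\<^sup>2 * A) * (b powr (- ?d) * real l powr (- \<nu>))) powr \<theta> =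
        K * ((b powr (- (?d / p))) powr (1 - \<theta>) * (b powr (- ?d)) powr \<theta>) * (real l powr (- \<nu>)) powr \<theta>"
      using H(1) C(1) A(1) by (simp add: K_def powr_mult mult_ac)
    also have "(b powr (- (?d / p))) powr (1 - \<theta>) * (b powr (- ?d)) powr \<theta> = b powr (- (?d * \<beta>))"
    proof -
      have "(b powr (- (?d / p))) powr (1 - \<theta>) * (b powr (- ?d)) powr \<theta> = b powr (- (?d / p) * (1 - \<theta>) + - ?d * \<theta>)"
        unfolding powr_powr powr_add ..
      also have "- (?d / p) * (1 - \<theta>) + - ?d * \<theta> = - (?d * \<beta>)"
        using p by (simp add: \<beta>_def field_simps)
      finally show ?thesis .
    qed
    also have "(real l powr (- \<nu>)) powr \<theta> = real l powr (- (\<nu> * \<theta>))" by (simp add: powr_powr)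
    finally show ?thesis by (simp add: cov_def l_def)
  qed
  ultimately show ?thesis using that by blast
qed

section \<open>The mean square error\<close>

theorem theorem1:
  fixes M :: "'a measure"
    and X :: "nat \<Rightarrow> 'a \<Rightarrow> real ^ 'd"
    and f :: "real ^ 'd \<Rightarrow> real"
    and f2 :: "nat \<Rightarrow> nat \<Rightarrow> real ^ 'd \<Rightarrow> real ^ 'd \<Rightarrow> real"
    and b :: "nat \<Rightarrow> real"
    and p \<nu> :: real
  assumes "prob_space M"
    and X_simplex: "\<And>i \<omega>. i \<ge> 1 \<Longrightarrow> \<omega> \<in> space M \<Longrightarrow> X i \<omega> \<in> simplex_set"
    and f_nonneg: "\<And>x. 0 \<le> f x"
    and f_support: "\<And>x. x \<notin> simplex_set \<Longrightarrow> f x = 0"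
    and X_density: "\<And>i. i \<ge> 1 \<Longrightarrow> distributed M lborel (X i) (\<lambda>x. ennreal (f x))"
    and b_pos: "\<And>n. n \<ge> 1 \<Longrightarrow> 0 < b n"
    and b_lim: "b \<longlonglongrightarrow> 0"
    and f_smooth: "twice_cont_diff_on f simplex_set"
    and p: "2 < p"
    and f2_nonneg: "\<And>i j x y. i \<ge> 1 \<Longrightarrow> j \<ge> 1 \<Longrightarrow> i \<noteq> j \<Longrightarrow> 0 \<le> f2 i j x y"
    and joint_density: "\<And>i j. i \<ge> 1 \<Longrightarrow> j \<ge> 1 \<Longrightarrow> i \<noteq> j \<Longrightarrow>
          distributed M (lborel \<Otimes>\<^sub>M lborel) (\<lambda>\<omega>. (X i \<omega>, X j \<omega>)) (\<lambda>(x, y). ennreal (f2 i j x y))"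
    and h_integrable: "\<And>i j. i \<ge> 1 \<Longrightarrow> j \<ge> 1 \<Longrightarrow> i \<noteq> j \<Longrightarrow>
          set_integrable (lborel \<Otimes>\<^sub>M lborel) (simplex_set \<times> simplex_set)
            (\<lambda>(x, y). \<bar>f2 i j x y - f x * f y\<bar> powr p)"
    and h_bounded: "bdd_above
          {(LINT (x, y) : simplex_set \<times> simplex_set | lborel \<Otimes>\<^sub>M lborel.
              \<bar>f2 i j x y - f x * f y\<bar> powr p) powr (1 / p) | i j. i \<ge> 1 \<and> j \<ge> 1 \<and> i \<noteq> j}"
    and \<nu>: "\<nu> > 2 * (p - 1) / (p - 2)"
    and mixing: "strong_mixing_coeff M X \<in> O(\<lambda>n. real n powr (- \<nu>))"
  shows "\<exists>R1 R2 :: nat \<Rightarrow> real ^ 'd \<Rightarrow> real.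
     (\<forall>n\<ge>1. \<forall>s\<in>open_simplex.
        dirichlet_kde_mse M X f n (b n) s =
          (b n)\<^sup>2 * (bias_coeff f s)\<^sup>2
          + (1 / real n) * b n powr (- (real CARD('d) / 2)) * variance_coeff s * f s
          + R1 n s + R2 n s) \<and>
     uniform_limit open_simplex (\<lambda>n s. R1 n s / (b n)\<^sup>2) (\<lambda>_. 0) sequentially \<and>
     (\<forall>s\<in>open_simplex.
        (\<lambda>n. R2 n s) \<in> o(\<lambda>n. (1 / real n) * b n powr (- (real CARD('d) / 2))))"
proof -
  interpret prob_space M by fact
  let ?d = "real CARD('d)"
  have fm: "f \<in> borel_measurable borel"
    using distributed_real_measurable[OF f_nonneg X_density[of 1]] by simp
  have Xm: "X i \<in> borel_measurable M" if "1 \<le> i" for i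
    using distributed_measurable[OF X_density[OF that]] by simp
  have b_right: "filterlim b (at_right 0) sequentially"
    unfolding filterlim_at
  proof
    show "\<forall>\<^sub>F n in sequentially. b n \<in> {0<..} \<and> b n \<noteq> 0"
      using eventually_ge_at_top[of 1]
    proof eventually_elim
      case (elim n)
      then show ?case using b_pos[of n] by simp
    qed
  qed (rule b_lim)
  define m where "m n s = (LINT x|kernel_measure s (b n). f x)" for n s
  \<comment> \<open>\<open>R1\<close> carries the squared bias and \<open>R2\<close> the variance, which makes the expansion itself an identity.\<close>
  define main where "main n s = (1 / real n) * b n powr (- (?d / 2)) * variance_coeff s * f s" for n s
  define R1 where "R1 n s = (m n s - f s)\<^sup>2 - (b n)\<^sup>2 * (bias_coeff f s)\<^sup>2" for n s
  define R2 where "R2 n s = dirichlet_kde_mse M X f n (b n) s - (m n s - f s)\<^sup>2 - main n s" for n s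
  have "uniform_limit open_simplex (\<lambda>n s. R1 n s / (b n)\<^sup>2) (\<lambda>_. 0) sequentially"
  proof (rule uniform_limitI)
    fix e :: real assume e: "0 < e"
    obtain G where G: "0 < G" "\<And>s. s \<in> open_simplex \<Longrightarrow> \<bar>bias_coeff f s\<bar> \<le> G"
      using bounded_bias_coeff[OF f_smooth] by blast
    \<comment> \<open>A difference of squares is a product: with \<open>u\<close> the bias, \<open>u - b n * bias_coeff f s\<close> is at most
      \<open>e1 * b n\<close> and \<open>u + b n * bias_coeff f s\<close> at most \<open>(1 + 2 * G) * b n\<close>.\<close>
    define e1 where "e1 = min 1 (e / (2 * (1 + 2 * G)))"
    have e1: "0 < e1" "e1 \<le> 1" using e G(1) by (auto simp: e1_def)
    have "e1 * (1 + 2 * G) \<le> e / (2 * (1 + 2 * G)) * (1 + 2 * G)"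
      using G(1) by (intro mult_right_mono) (auto simp: e1_def)
    also have "\<dots> = e / 2" using G(1) by (simp add: field_simps)
    finally have e1': "e1 * (1 + 2 * G) < e" using e by linarith
    obtain b0 where b0: "0 < b0" "\<And>b s. 0 < b \<Longrightarrow> b < b0 \<Longrightarrow> s \<in> open_simplex \<Longrightarrow>
        \<bar>(LINT x|kernel_measure s b. f x) - f s - b * bias_coeff f s\<bar> \<le> e1 * b"
      using kernel_measure_bias[OF f_smooth fm e1(1)] by blast
    have "\<forall>\<^sub>F n in sequentially. b n < b0" using b_lim b0(1) by (rule order_tendstoD)
    then show "\<forall>\<^sub>F n in sequentially. \<forall>s\<in>open_simplex. dist (R1 n s / (b n)\<^sup>2) 0 < e"
      using eventually_ge_at_top[of 1]
    proof eventually_elim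
      case (elim n)
      show ?case
      proof
        fix s :: "real ^ 'd" assume s: "s \<in> open_simplex"
        have bn: "0 < b n" using b_pos elim by simp
        let ?g = "bias_coeff f s" and ?u = "m n s - f s"
        have u: "\<bar>?u - b n * ?g\<bar> \<le> e1 * b n" using b0(2)[OF bn elim(1) s] by (simp add: m_def)
        have g: "\<bar>b n * ?g\<bar> \<le> b n * G" using G(2)[OF s] bn by (simp add: abs_mult)
        have "\<bar>?u + b n * ?g\<bar> \<le> e1 * b n + 2 * (b n * G)" using u g by linarith
        also have "\<dots> \<le> b n * (1 + 2 * G)"
          using e1 bn mult_right_mono[of e1 1 "b n"] by (simp add: algebra_simps)
        finally have v: "\<bar>?u + b n * ?g\<bar> \<le> b n * (1 + 2 * G)" .
        have "R1 n s = (?u - b n * ?g) * (?u + b n * ?g)"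
          by (simp add: R1_def power2_eq_square algebra_simps)
        then have "\<bar>R1 n s\<bar> = \<bar>?u - b n * ?g\<bar> * \<bar>?u + b n * ?g\<bar>" by (simp only: abs_mult)
        also have "\<dots> \<le> (e1 * b n) * (b n * (1 + 2 * G))"
          using e1 bn by (intro mult_mono u v) auto
        also have "\<dots> < e * (b n)\<^sup>2"
          using mult_strict_right_mono[OF e1', of "(b n)\<^sup>2"] bn by (simp add: power2_eq_square mult_ac)
        finally show "dist (R1 n s / (b n)\<^sup>2) 0 < e"
          using bn by (simp add: abs_mult pos_divide_less_eq)
      qed
    qed
  qed
  moreover have "(\<lambda>n. R2 n s) \<in> o(\<lambda>n. (1 / real n) * b n powr (- (?d / 2)))" if s: "s \<in> open_simplex" for s
  proof -
    obtain K \<beta> \<gamma> where K: "0 < K" "\<beta> < 1 / 2" "1 < \<gamma>"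
      and cov: "\<And>b i j. 0 < b \<Longrightarrow> b \<le> 1 \<Longrightarrow> 1 \<le> i \<Longrightarrow> 1 \<le> j \<Longrightarrow> i \<noteq> j \<Longrightarrow>
       \<bar>(LINT \<omega>|M. truncated_kernel s b (X i \<omega>) * truncated_kernel s b (X j \<omega>)) -
         (LINT \<omega>|M. truncated_kernel s b (X i \<omega>)) * (LINT \<omega>|M. truncated_kernel s b (X j \<omega>))\<bar>
       \<le> K * b powr (- (?d * \<beta>)) * real (if i < j then j - i else i - j) powr (- \<gamma>)"
      using kernel_covariance_bound[OF \<open>prob_space M\<close> f_nonneg X_density p f2_nonneg joint_density
          h_integrable h_bounded \<nu> mixing s] by blast
    define v where "v n = square_ratio s (b n) * (LINT x|kernel_measure s (b n / 2). f x)" for n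
    define c where "c n i j = (LINT \<omega>|M. truncated_kernel s (b n) (X i \<omega>) * truncated_kernel s (b n) (X j \<omega>)) - (m n s)\<^sup>2" for n i j
    define V where "V n = (\<Sum>i = 1..n. \<Sum>j\<in>{1..n} - {i}. c n i j)" for n
    define \<zeta> where "\<zeta> = 2 * suminf (\<lambda>k. real k powr (- \<gamma>))"
    have EY: "(LINT \<omega>|M. truncated_kernel s (b n) (X i \<omega>)) = m n s"
      and EYY: "(LINT \<omega>|M. truncated_kernel s (b n) (X i \<omega>) * truncated_kernel s (b n) (X i \<omega>)) = v n"
      if "1 \<le> n" "1 \<le> i" for n i
      unfolding m_def v_def
      using truncated_kernel_moments[OF s b_pos[OF that(1)] X_density[OF that(2)] f_nonneg] by auto
    have mse: "dirichlet_kde_mse M X f n (b n) s = (m n s - f s)\<^sup>2 + (v n - (m n s)\<^sup>2) / real n + V n / (real n)\<^sup>2"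
      if n: "1 \<le> n" for n
    proof -
      have "dirichlet_kde_mse M X f n (b n) s =
        expectation (\<lambda>\<omega>. (1 / real n * (\<Sum>i = 1..n. truncated_kernel s (b n) (X i \<omega>)) - f s)\<^sup>2)"
        unfolding dirichlet_kde_mse_def dirichlet_kde_def power2_abs using X_simplex
        by (intro Bochner_Integration.integral_cong refl) (simp add: truncated_kernel_def)
      also have "\<dots> = (m n s - f s)\<^sup>2 + (v n - (m n s)\<^sup>2) / real n + V n / (real n)\<^sup>2"
        unfolding V_def c_def
      proof (rule mean_square_error_decomposition[OF n])
        fix i assume i: "i \<in> {1..n}"
        show "(\<lambda>\<omega>. truncated_kernel s (b n) (X i \<omega>)) \<in> borel_measurable M" using Xm[of i] i by simp
        show "\<bar>truncated_kernel s (b n) (X i \<omega>)\<bar> \<le> dirichlet_kernel s (b n) s" for \<omega>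
          using truncated_kernel_bounds[OF s b_pos[OF n], of "X i \<omega>"] by simp
      qed (use EY EYY n in auto)
      finally show ?thesis .
    qed
    have bn0: "0 < b n powr e" if "1 \<le> n" for n e using b_pos[OF that] by simp
    have V: "\<forall>\<^sub>F n in sequentially. norm (b n powr (?d / 2) * (V n / real n)) \<le> K * \<zeta> * b n powr (?d * (1 / 2 - \<beta>))"
    proof -
      have "\<forall>\<^sub>F n in sequentially. b n < 1" using b_lim by (rule order_tendstoD) simp
      then show ?thesis using eventually_ge_at_top[of 1]
      proof eventually_elim
        case (elim n)
        have bn: "0 < b n" using b_pos elim by simp
        have n: "1 \<le> n" "0 < real n" using elim by auto
        let ?l = "\<lambda>i j. if i < j then j - i else i - j :: nat"
        have "\<bar>V n\<bar> \<le> (\<Sum>i = 1..n. \<Sum>j\<in>{1..n} - {i}. K * b n powr (- (?d * \<beta>)) * real (?l i j) powr (- \<gamma>))"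
          unfolding V_def
        proof (intro order_trans[OF sum_abs] sum_mono)
          fix i j assume i: "i \<in> {1..n}" and j: "j \<in> {1..n} - {i}"
          have "\<bar>c n i j\<bar> = \<bar>(LINT \<omega>|M. truncated_kernel s (b n) (X i \<omega>) * truncated_kernel s (b n) (X j \<omega>)) -
              (LINT \<omega>|M. truncated_kernel s (b n) (X i \<omega>)) * (LINT \<omega>|M. truncated_kernel s (b n) (X j \<omega>))\<bar>"
            using EY[OF n(1), of i] EY[OF n(1), of j] i j by (simp add: c_def power2_eq_square)
          also have "\<dots> \<le> K * b n powr (- (?d * \<beta>)) * real (?l i j) powr (- \<gamma>)"
            by (rule cov) (use bn elim i j in auto)
          finally show "\<bar>c n i j\<bar> \<le> \<dots>" .
        qed
        also have "\<dots> = K * b n powr (- (?d * \<beta>)) * (\<Sum>i = 1..n. \<Sum>j\<in>{1..n} - {i}. real (?l i j) powr (- \<gamma>))"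
          by (simp add: sum_distrib_left)
        also have "\<dots> \<le> K * b n powr (- (?d * \<beta>)) * (real n * \<zeta>)"
          unfolding \<zeta>_def using K
          by (intro mult_left_mono sum_off_diagonal_le) (auto simp: summable_real_powr_iff)
        finally have "\<bar>V n\<bar> / real n \<le> K * b n powr (- (?d * \<beta>)) * \<zeta>"
          using n by (simp add: pos_divide_le_eq mult_ac)
        then have "b n powr (?d / 2) * (\<bar>V n\<bar> / real n) \<le> b n powr (?d / 2) * (K * b n powr (- (?d * \<beta>)) * \<zeta>)"
          by (intro mult_left_mono) auto
        also have "\<dots> = K * \<zeta> * (b n powr (?d / 2) * b n powr (- (?d * \<beta>)))" by simp
        also have "b n powr (?d / 2) * b n powr (- (?d * \<beta>)) = b n powr (?d * (1 / 2 - \<beta>))"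
          by (simp add: powr_add[symmetric] algebra_simps)
        finally show ?case using n by (simp add: abs_mult)
      qed
    qed
    have b0: "((\<lambda>n. b n powr e) \<longlongrightarrow> 0) sequentially" if "0 < e" for e
    proof -
      have "((\<lambda>x::real. x powr e) \<longlongrightarrow> 0) (at_right 0)" using that by real_asymp
      from filterlim_compose[OF this b_right] show ?thesis .
    qed
    \<comment> \<open>The exponent \<open>1 / 2 - \<beta>\<close> is positive: the covariances are negligible against the diagonal terms.\<close>
    have V0: "((\<lambda>n. b n powr (?d / 2) * (V n / real n)) \<longlongrightarrow> 0) sequentially"
    proof (rule Lim_null_comparison[OF V])
      have "((\<lambda>n. K * \<zeta> * b n powr (?d * (1 / 2 - \<beta>))) \<longlongrightarrow> K * \<zeta> * 0) sequentially"
        using K by (intro tendsto_intros b0) auto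
      then show "((\<lambda>n. K * \<zeta> * b n powr (?d * (1 / 2 - \<beta>))) \<longlongrightarrow> 0) sequentially" by simp
    qed
    have mlim: "((\<lambda>n. m n s) \<longlongrightarrow> f s) sequentially"
      unfolding m_def by (rule filterlim_compose[OF kernel_measure_tendsto[OF f_smooth fm s] b_right])
    have "((\<lambda>n. (square_ratio s (b n) * b n powr (?d / 2)) * (LINT x|kernel_measure s (b n / 2). f x)) \<longlongrightarrow> variance_coeff s * f s) sequentially"
    proof (rule tendsto_mult)
      show "((\<lambda>n. square_ratio s (b n) * b n powr (?d / 2)) \<longlongrightarrow> variance_coeff s) sequentially"
        by (rule filterlim_compose[OF square_ratio_asymp[OF s] b_right])
      have "filterlim (\<lambda>x::real. x / 2) (at_right 0) (at_right 0)" by real_asymp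
      from filterlim_compose[OF kernel_measure_tendsto[OF f_smooth fm s] filterlim_compose[OF this b_right]]
      show "((\<lambda>n. LINT x|kernel_measure s (b n / 2). f x) \<longlongrightarrow> f s) sequentially" .
    qed
    then have vlim: "((\<lambda>n. b n powr (?d / 2) * v n) \<longlongrightarrow> variance_coeff s * f s) sequentially"
      by (simp add: v_def mult_ac)
    have "((\<lambda>n. b n powr (?d / 2) * v n - b n powr (?d / 2) * (m n s)\<^sup>2 - variance_coeff s * f s + b n powr (?d / 2) * (V n / real n))
        \<longlongrightarrow> variance_coeff s * f s - 0 * (f s)\<^sup>2 - variance_coeff s * f s + 0) sequentially"
      by (intro tendsto_intros vlim mlim V0 b0) auto
    then have "((\<lambda>n. b n powr (?d / 2) * v n - b n powr (?d / 2) * (m n s)\<^sup>2 - variance_coeff s * f s + b n powr (?d / 2) * (V n / real n))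
        \<longlongrightarrow> 0) sequentially" by simp
    moreover have "\<forall>\<^sub>F n in sequentially. b n powr (?d / 2) * v n - b n powr (?d / 2) * (m n s)\<^sup>2 - variance_coeff s * f s + b n powr (?d / 2) * (V n / real n)
        = R2 n s / ((1 / real n) * b n powr (- (?d / 2)))"
      using eventually_ge_at_top[of 1]
    proof eventually_elim
      case (elim n)
      have bp: "b n powr (- (?d / 2)) = 1 / b n powr (?d / 2)" by (simp add: powr_minus_divide)
      have n: "0 < real n" using elim by simp
      show ?case
        unfolding R2_def mse[OF elim] main_def bp using n bn0[OF elim, of "?d / 2"]
        by (simp add: field_simps power2_eq_square)
    qed
    ultimately have "((\<lambda>n. R2 n s / ((1 / real n) * b n powr (- (?d / 2)))) \<longlongrightarrow> 0) sequentially"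
      by (rule Lim_transform_eventually)
    moreover have "\<forall>\<^sub>F n in sequentially. (1 / real n) * b n powr (- (?d / 2)) \<noteq> 0"
      using eventually_ge_at_top[of 1] by eventually_elim (use bn0 b_pos in \<open>auto simp: less_imp_neq[THEN not_sym]\<close>)
    ultimately show ?thesis by (intro smalloI_tendsto)
  qed
  moreover have "dirichlet_kde_mse M X f n (b n) s =
          (b n)\<^sup>2 * (bias_coeff f s)\<^sup>2
          + (1 / real n) * b n powr (- (?d / 2)) * variance_coeff s * f s
          + R1 n s + R2 n s" for n s
    by (simp add: R1_def R2_def main_def)
  ultimately show ?thesis by blast
qed

end
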